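(* Let $T$ be an upper probability polynomial functor and $D$ a Lindenbaum, sound $T$-deduction system. Then: (1) For every $S\in\mathsf{Ing}\,T$ and every $T$-coalgebra $(Y,\delta)$, $des^\delta_S$ is a measurable map $SY\to X_S$. (2) If $f:(X,\alpha)\to(Y,\delta)$ is a $T$-coalgebra morphism, then $des^\delta_S\circ Sf=des^\alpha_S$ for all $S\in\mathsf{Ing}\,T$. (3) For the canonical $T$-coalgebra $(X_{Id},\alpha^D)$ and each $S\in\mathsf{Ing}\,T$, $des^{\alpha^D}_S:S(X_{Id})\to X_S$ is an isomorphism of uncertainty spaces with inverse $\mathsf r_S$; in particular $X_S=\{des^{\alpha^D}_S(\mathsf r_S(x)):x\in X_S\}$. (4) For every $T$-coalgebra $(Y,\delta)$, $des^\delta_{Id}:Y\to X_{Id}$ is a $T$-coalgebra morphism into $(X_{Id},\alpha^D)$, and it is the only one; hence $(X_{Id},\alpha^D)$ is a final $T$-coalgebra.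
   Context: An uncertainty space is $(X,\Sigma)$ with $\Sigma$ an algebra of subsets of $X$ (nonempty, closed under finite unions and complements $U^c=X\setminus U$); measurable maps pull measurable sets back to measurable sets; an isomorphism is a bijection measurable in both directions. A probability measure on $(X,\Sigma)$ is a finitely additive $\mu:\Sigma\to[0,1]$ with $\mu(\emptyset)=0,\mu(X)=1$. An upper probability measure is $g:\Sigma\to[0,1]$ with $g(U)=\sup_{\mu\in\mathcal P}\mu(U)$ for a nonempty set $\mathcal P$ of probability measures. $\Delta^*X$ is the set of upper probability measures on $X$ with the algebra generated by $\beta^{p,q}(U)=\{g:g(U)\ge p,\ 1-g(U^c)\ge q\}$ ($p,q\in[0,1]$, $U$ measurable); $(\Delta^*f)(g)(U)=g(f^{-1}(U))$. Products carry the algebra generated by measurable rectangles (projections $\pi_j$), coproducts (injections $in_j$) the algebra generated by the $in_j(U_j)$; a constant functor maps everything to a fixed $(M,\Sigma_M)$ and all maps to $\mathrm{id}_M$. Upper probability polynomial functors: the smallest class of endofunctors of the category of uncertainty spaces containing the identity $Id$ and constants, closed under pointwise $\times$, $+$ and composition with $\Delta^*$. A $T$-coalgebra is $(X,\alpha)$, $\alpha:X\to TX$ measurable; a morphism $f:(X,\alpha)\to(Y,\delta)$ is a measurable $f$ with $\delta\circ f=Tf\circ\alpha$; a coalgebra is final if every coalgebra has exactly one morphism into it. $\mathsf{Ing}\,T$: $\mathsf{Ing}\,Id=\{Id\}$, $\mathsf{Ing}\,M=\{M,Id\}$, $\mathsf{Ing}(T_1\times T_2)=\{T_1\times T_2\}\cup\mathsf{Ing}\,T_1\cup\mathsf{Ing}\,T_2$,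 same for $+$, $\mathsf{Ing}\,\Delta^*S=\{\Delta^*S\}\cup\mathsf{Ing}\,S$. Formulas of sort $S$ ($\varphi:S$, set $\mathsf{Form}_S$): $\bot_S$; $\varphi\to\psi$; $A:M$ for $A\in\Sigma_M$ or $A=\{m\}$; $[\mathsf{pr}_j]\varphi:S_1\times S_2$ ($\varphi:S_j$); $[\mathsf{in}_j]\varphi:S_1+S_2$ ($\varphi:S_j$); $[\mathsf{next}]\varphi:Id$ ($\varphi:T$); $[(p,q)]\varphi:\Delta^*S$ for $p,q\in[0,1]$ and $\varphi::S$ (i.e. all constant subformulas $A$ of $\varphi$ are in $\Sigma_M$). $\mathsf{pr}_j,\mathsf{in}_j,\mathsf{next}$ are the non-probabilistic labels $\kappa$ (from $S_1\times S_2$, $S_1+S_2$, $Id$ to $S_j$, $S_j$, $T$); $[\kappa]\Gamma=\{[\kappa]\psi:\psi\in\Gamma\}$. Abbreviations: $\neg,\vee,\wedge,\leftrightarrow,\top_S$ as usual; $\mathsf U_{\ge p}\varphi=[(p,0)]\varphi$, $\mathsf L_{\ge p}\varphi=[(0,p)]\varphi$, $\mathsf U_{\le p}\varphi=[(0,1-p)]\neg\varphi$, $\mathsf U_{<p}\varphi=\neg\mathsf U_{\ge p}\varphi$, $\mathsf L_{<p}\varphi=\neg\mathsf L_{\ge p}\varphi$. Semantics in $(X,\alpha)$: $[\![\bot]\!]=\emptyset$, $[\![A]\!]=A$, $[\![\varphi\to\psi]\!]=(SX\setminus[\![\varphi]\!])\cup[\![\psi]\!]$, $[\![[\mathsf{pr}_j]\varphi]\!]=\pi_j^{-1}[\![\varphi]\!]$,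 $[\![[\mathsf{in}_1]\varphi]\!]=in_1[\![\varphi]\!]\cup in_2(S_2X)$ (symmetric for $\mathsf{in}_2$), $[\![[\mathsf{next}]\varphi]\!]=\alpha^{-1}[\![\varphi]\!]_T$, $[\![[(p,q)]\varphi]\!]=\beta^{p,q}[\![\varphi]\!]$. $\alpha,x\models_S\varphi$ iff $x\in[\![\varphi]\!]^\alpha_S$; $\Gamma\models_S\varphi$ iff in every $T$-coalgebra every element satisfying $\Gamma$ satisfies $\varphi$. Description map: $des^\delta_S(y)=\{\varphi:S:\delta,y\models_S\varphi\}$. Axioms $Ax_S$: Boolean tautologies; for constant $M$: $\{c\}\to A$ if $c\in A$, $\{c\}\to\neg A$ if $c\notin A$; $\neg[\kappa]\varphi\to[\kappa]\neg\varphi$ for each non-probabilistic $\kappa$; $\neg[\mathsf{pr}_j]\bot_{S_j}$; $\neg[\mathsf{in}_1]\bot_{S_1}\leftrightarrow[\mathsf{in}_2]\bot_{S_2}$; $\neg[\mathsf{next}]\bot_T$; for $\Delta^*S'$ and $\varphi,\psi::S'$: $\mathsf U_{\le p}\varphi\to\mathsf U_{<q}\varphi$ ($p<q$), $\mathsf U_{<p}\varphi\to\mathsf U_{\le p}\varphi$, $\mathsf L_{\ge1}(\varphi\to\psi)\to(\mathsf U_{\ge p}\varphi\to\mathsf U_{\ge p}\psi)$, $[(p,q)]\varphi\leftrightarrow(\mathsf U_{\ge p}\varphi\wedge\mathsf L_{\ge q}\varphi)$. A $T$-deduction system is a family $\vdash_S\subseteq\mathcal P(\mathsf{Form}_S)\times\mathsf{Form}_S$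 ($\Gamma\vdash_S\Lambda$: $\Gamma\vdash_S\psi$ for all $\psi\in\Lambda$; $\vdash_S\varphi$: $\emptyset\vdash_S\varphi$) satisfying: Assumption ($\varphi\in\Gamma\cup Ax_S\Rightarrow\Gamma\vdash_S\varphi$); Modus ponens $\{\varphi,\varphi\to\psi\}\vdash_S\psi$; Cut; Deduction ($\Gamma\cup\{\varphi\}\vdash_S\psi\Rightarrow\Gamma\vdash_S\varphi\to\psi$); Necessitation ($\varphi::S$, $\vdash_S\varphi\Rightarrow\vdash_{\Delta^*S}\mathsf L_{\ge1}\varphi$); Constant ($\{\neg\{c\}:c\in M\}\vdash_M\bot_M$); Definite box ($\Gamma\vdash_{S'}\psi\Rightarrow[\kappa]\Gamma\vdash_S[\kappa]\psi$); Archimedean ($\{\mathsf U_{\ge q}\psi:q<p\}\vdash\mathsf U_{\ge p}\psi$, $\{\mathsf L_{\ge q}\psi:q<p\}\vdash\mathsf L_{\ge p}\psi$); Cover rules, for $\varphi,\varphi_i::S$, $k\ge0$, $J_m=\{1,\dots,m\}$: (C1) if $n\ge1$, $\vdash_S\varphi\to\bigvee_{I\subseteq J_m,|I|=n+k}\bigwedge_{i\in I}\varphi_i$, $\vdash_S\bigvee_{I\subseteq J_m,|I|=k}\bigwedge_{i\in I}\varphi_i$, $p_i\in[0,1]$, $p=\max(0,\min(1,(\sum p_i-k)/n))$, then $\vdash_{\Delta^*S}(\bigwedge_i\mathsf U_{\le p_i}\varphi_i)\to\mathsf U_{\le p}\varphi$; (C2) if $\vdash_S\bigvee_{I\subseteq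 J_m,|I|=k}\bigwedge_{i\in I}\varphi_i$ and $\sum p_i<k$, then $\vdash_{\Delta^*S}\neg\bigwedge_i\mathsf U_{\le p_i}\varphi_i$. $\Gamma$ is $\vdash_S$-consistent if $\Gamma\not\vdash_S\bot_S$, $\vdash_S$-maximal if consistent and negation complete ($\varphi\in\Gamma$ iff $\neg\varphi\notin\Gamma$). $D$ is Lindenbaum if every consistent set extends to a maximal one; sound if $\Gamma\vdash_S\varphi\Rightarrow\Gamma\models_S\varphi$. $X_S$: the $\vdash_S$-maximal sets, an uncertainty space with the algebra $\Sigma_S=\{|\varphi|_S:\varphi::S\}$, $|\varphi|_S=\{x:\varphi\in x\}$. For $x\in X_{\Delta^*S}$, $g_x(|\varphi|_S)=\sup\{q\in[0,1]:\mathsf U_{\ge q}\varphi\in x\}$. $[\kappa]^-x=\{\varphi:[\kappa]\varphi\in x\}$; $\rho_{S_1\times S_2}(x)=([\mathsf{pr}_1]^-x,[\mathsf{pr}_2]^-x)$; $\rho_{S_1+S_2}(x)=in_j([\mathsf{in}_j]^-x)$ for the unique $j$ with $\neg[\mathsf{in}_j]\bot_{S_j}\in x$; $\rho_{Id}(x)=[\mathsf{next}]^-x$; $\rho_{\Delta^*S}(x)=g_x$. $\mathsf r_S:X_S\to S(X_{Id})$: $\mathsf r_{Id}=\mathrm{id}$, $\mathsf r_M(x)$ = unique $c$ with $\{c\}\in x$, $\mathsf r_{S_1\times S_2}=(\mathsf r_{S_1}\times\mathsf r_{S_2})\circ\rho$, $\mathsf r_{S_1+S_2}=(\mathsf r_{S_1}+\mathsf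 r_{S_2})\circ\rho$, $\mathsf r_{\Delta^*S}=\Delta^*\mathsf r_S\circ\rho_{\Delta^*S}$. Canonical coalgebra: $\alpha^D=\mathsf r_T\circ\rho_{Id}:X_{Id}\to T(X_{Id})$.
   Formalization: Adds the hypothesis that D derives L_{≥q}φ ↔ U_{≤1-q}¬φ for all φ::S with Δ*S in Ing T; the listed axioms and rules do not yield this scheme, and (3) and (4) can fail without it. *)

theory Defs
  imports "HOL-Analysis.Sigma_Algebra" "HOL-Library.FuncSet" "HOL.Hull"
begin

section \<open>Uncertainty spaces\<close>

datatype 'a uspace = USpace (points: "'a set") (meas: "'a set set")

definition uncertainty_space :: "'a uspace \<Rightarrow> bool" where
  "uncertainty_space A \<longleftrightarrow> algebra (points A) (meas A)"

definition generated_space :: "'a set \<Rightarrow> 'a set set \<Rightarrow> 'a uspace" where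
  "generated_space \<Omega> G = USpace \<Omega> (algebra \<Omega> hull G)"

text \<open>The morphisms of the category of uncertainty spaces.\<close>

definition measurable_map :: "'a uspace \<Rightarrow> 'b uspace \<Rightarrow> ('a \<Rightarrow> 'b) \<Rightarrow> bool" where
  "measurable_map A B f \<longleftrightarrow> uncertainty_space A \<and> uncertainty_space B \<and>
     f \<in> points A \<rightarrow> points B \<and> (\<forall>V\<in>meas B. f -` V \<inter> points A \<in> meas A)"

definition uspace_iso :: "'a uspace \<Rightarrow> 'b uspace \<Rightarrow> ('a \<Rightarrow> 'b) \<Rightarrow> bool" where
  "uspace_iso A B f \<longleftrightarrow> bij_betw f (points A) (points B) \<and>
     measurable_map A B f \<and> measurable_map B A (inv_into (points A) f)"

definition prod_space :: "'a uspace \<Rightarrow> 'b uspace \<Rightarrow> ('a \<times> 'b) uspace" where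
  "prod_space A B = generated_space (points A \<times> points B) {U \<times> V | U V. U \<in> meas A \<and> V \<in> meas B}"

definition sum_space :: "'a uspace \<Rightarrow> 'b uspace \<Rightarrow> ('a + 'b) uspace" where
  "sum_space A B = generated_space (points A <+> points B)
     ({Inl ` U | U. U \<in> meas A} \<union> {Inr ` V | V. V \<in> meas B})"


section \<open>Upper probability measures\<close>

text \<open>Set functions on the algebra of a space are HOL functions that are \<^const>\<open>undefined\<close>
  off the algebra (\<^const>\<open>extensional\<close>), so that equality of functions is equality on the algebra.\<close>

definition probs :: "'a uspace \<Rightarrow> ('a set \<Rightarrow> real) set" where
  "probs A = {\<mu> \<in> meas A \<rightarrow>\<^sub>E {0..1}. \<mu> {} = 0 \<and> \<mu> (points A) = 1 \<and>
     (\<forall>U\<in>meas A. \<forall>V\<in>meas A. U \<inter> V = {} \<longrightarrow> \<mu> (U \<union> V) = \<mu> U + \<mu> V)}"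

definition upper_probs :: "'a uspace \<Rightarrow> ('a set \<Rightarrow> real) set" where
  "upper_probs A = {g \<in> meas A \<rightarrow>\<^sub>E {0..1}.
     \<exists>P \<subseteq> probs A. P \<noteq> {} \<and> (\<forall>U\<in>meas A. g U = (SUP \<mu>\<in>P. \<mu> U))}"

definition beta :: "'a uspace \<Rightarrow> real \<Rightarrow> real \<Rightarrow> 'a set \<Rightarrow> ('a set \<Rightarrow> real) set" where
  "beta A p q U = {g \<in> upper_probs A. g U \<ge> p \<and> 1 - g (points A - U) \<ge> q}"

definition Delta_space :: "'a uspace \<Rightarrow> ('a set \<Rightarrow> real) uspace" where
  "Delta_space A = generated_space (upper_probs A)
     {beta A p q U | p q U. p \<in> {0..1} \<and> q \<in> {0..1} \<and> U \<in> meas A}"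

definition Delta_map ::
    "'a uspace \<Rightarrow> 'b uspace \<Rightarrow> ('a \<Rightarrow> 'b) \<Rightarrow> ('a set \<Rightarrow> real) \<Rightarrow> ('b set \<Rightarrow> real)" where
  "Delta_map A B f g = (\<lambda>V\<in>meas B. g (f -` V \<inter> points A))"


section \<open>Upper probability polynomial functors\<close>

text \<open>One type \<open>'m\<close> carries all constant spaces of a functor; different constants may use
  different subsets of \<open>'m\<close> (for instance the summands of a sum type).\<close>

datatype 'm pfun =
    FId
  | FConst "'m uspace"
  | FProd "'m pfun" "'m pfun"
  | FSum "'m pfun" "'m pfun"
  | FDelta "'m pfun"

primrec upp_functor :: "'m pfun \<Rightarrow> bool" where
  "upp_functor FId \<longleftrightarrow> True"
| "upp_functor (FConst M) \<longleftrightarrow> uncertainty_space M"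
| "upp_functor (FProd S1 S2) \<longleftrightarrow> upp_functor S1 \<and> upp_functor S2"
| "upp_functor (FSum S1 S2) \<longleftrightarrow> upp_functor S1 \<and> upp_functor S2"
| "upp_functor (FDelta S) \<longleftrightarrow> upp_functor S"

primrec Ing :: "'m pfun \<Rightarrow> 'm pfun set" where
  "Ing FId = {FId}"
| "Ing (FConst M) = {FConst M, FId}"
| "Ing (FProd S1 S2) = {FProd S1 S2} \<union> Ing S1 \<union> Ing S2"
| "Ing (FSum S1 S2) = {FSum S1 S2} \<union> Ing S1 \<union> Ing S2"
| "Ing (FDelta S) = {FDelta S} \<union> Ing S"

text \<open>HOL has no type containing \<open>S X\<close> for all functors \<open>S\<close> at once if an element of
  \<open>\<Delta>\<^sup>* Y\<close> has to be a function on sets of elements of \<open>Y\<close>. But every measurable set of \<open>S X\<close> is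
  denoted by a finite expression (\<open>code\<close>) built from measurable sets of \<open>X\<close> and of the constant
  spaces, so an upper probability measure can be stored as a function on codes. The spaces \<open>S X\<close>
  are therefore carried by the single type \<open>val\<close>: at each step the space defined above is
  transported along an injection into \<open>val\<close>. That the encoding is injective, hence an isomorphism
  of uncertainty spaces onto its image, is proved in \<open>app_iso\<close> below.\<close>

datatype ('x, 'm) code =
    CId "'x set"
  | CConst "'m set"
  | CRect "('x, 'm) code" "('x, 'm) code"
  | CInl "('x, 'm) code"
  | CInr "('x, 'm) code"
  | CBeta real real "('x, 'm) code"
  | CUn "('x, 'm) code" "('x, 'm) code"
  | CCompl "('x, 'm) code"

datatype ('x, 'm) val =
    VId (un_VId: 'x)
  | VConst (un_VConst: 'm)
  | VPair (vfst: "('x, 'm) val") (vsnd: "('x, 'm) val")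
  | VInl (un_VInl: "('x, 'm) val")
  | VInr (un_VInr: "('x, 'm) val")
  | VUpper "('x, 'm) code \<Rightarrow> real"

fun holds :: "('x, 'm) val \<Rightarrow> ('x, 'm) code \<Rightarrow> bool" where
  "holds v (CUn c d) \<longleftrightarrow> holds v c \<or> holds v d"
| "holds v (CCompl c) \<longleftrightarrow> \<not> holds v c"
| "holds (VId x) (CId U) \<longleftrightarrow> x \<in> U"
| "holds (VConst m) (CConst U) \<longleftrightarrow> m \<in> U"
| "holds (VPair v w) (CRect c d) \<longleftrightarrow> holds v c \<and> holds w d"
| "holds (VInl v) (CInl c) \<longleftrightarrow> holds v c"
| "holds (VInr v) (CInr c) \<longleftrightarrow> holds v c"
| "holds (VUpper h) (CBeta p q c) \<longleftrightarrow> h c \<ge> p \<and> 1 - h (CCompl c) \<ge> q"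
| "holds _ _ \<longleftrightarrow> False"

definition extent :: "('x, 'm) val uspace \<Rightarrow> ('x, 'm) code \<Rightarrow> ('x, 'm) val set" where
  "extent A c = {v \<in> points A. holds v c}"

definition enc :: "('x, 'm) val uspace \<Rightarrow> (('x, 'm) val set \<Rightarrow> real) \<Rightarrow> ('x, 'm) val" where
  "enc A g = VUpper (\<lambda>c. g (extent A c))"

definition image_space :: "('a \<Rightarrow> 'b) \<Rightarrow> 'a uspace \<Rightarrow> 'b uspace" where
  "image_space e A = USpace (e ` points A) ((`) e ` meas A)"

text \<open>\<open>app S X\<close> is the space \<open>S X\<close>.\<close>

primrec app :: "'m pfun \<Rightarrow> 'x uspace \<Rightarrow> ('x, 'm) val uspace" where
  "app FId X = image_space VId X"
| "app (FConst M) X = image_space VConst M"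
| "app (FProd S1 S2) X = image_space (\<lambda>(v, w). VPair v w) (prod_space (app S1 X) (app S2 X))"
| "app (FSum S1 S2) X = image_space (case_sum VInl VInr) (sum_space (app S1 X) (app S2 X))"
| "app (FDelta S) X = image_space (enc (app S X)) (Delta_space (app S X))"

text \<open>\<open>fmap S X Y f\<close> is the map \<open>S f\<close> from \<open>S X\<close> to \<open>S Y\<close>, for \<open>f\<close> from \<open>X\<close> to \<open>Y\<close>.\<close>

primrec fmap :: "'m pfun \<Rightarrow> 'x uspace \<Rightarrow> 'y uspace \<Rightarrow> ('x \<Rightarrow> 'y) \<Rightarrow>
    ('x, 'm) val \<Rightarrow> ('y, 'm) val" where
  "fmap FId X Y f = (\<lambda>v. VId (f (un_VId v)))"
| "fmap (FConst M) X Y f = (\<lambda>v. VConst (un_VConst v))"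
| "fmap (FProd S1 S2) X Y f = (\<lambda>v. VPair (fmap S1 X Y f (vfst v)) (fmap S2 X Y f (vsnd v)))"
| "fmap (FSum S1 S2) X Y f = (\<lambda>v. if is_VInl v then VInl (fmap S1 X Y f (un_VInl v))
                                    else VInr (fmap S2 X Y f (un_VInr v)))"
| "fmap (FDelta S) X Y f = enc (app S Y) \<circ> Delta_map (app S X) (app S Y) (fmap S X Y f) \<circ>
                             inv_into (upper_probs (app S X)) (enc (app S X))"


subsection \<open>Adequacy of the encoding\<close>

lemma algebra_hull:
  assumes "G \<subseteq> Pow \<Omega>"
  shows "algebra \<Omega> (algebra \<Omega> hull G)"
proof -
  have "algebra \<Omega> hull G \<subseteq> Pow \<Omega>"
    using assms by (simp add: hull_minimal algebra_Pow)
  then show ?thesis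
    unfolding algebra_iff_Un by (auto simp: hull_def algebra_iff_Un)
qed

lemma hull_algebra_induct [consumes 2, case_names base empty compl union]:
  assumes "U \<in> algebra \<Omega> hull G" and G: "G \<subseteq> Pow \<Omega>"
    and "\<And>U. U \<in> G \<Longrightarrow> P U" and "P {}"
    and "\<And>U. U \<subseteq> \<Omega> \<Longrightarrow> P U \<Longrightarrow> P (\<Omega> - U)"
    and "\<And>U V. U \<subseteq> \<Omega> \<Longrightarrow> V \<subseteq> \<Omega> \<Longrightarrow> P U \<Longrightarrow> P V \<Longrightarrow> P (U \<union> V)"
  shows "P U"
proof -
  have "algebra \<Omega> {U \<in> Pow \<Omega>. P U}"
    unfolding algebra_iff_Un using assms(4-) by auto
  moreover have "G \<subseteq> {U \<in> Pow \<Omega>. P U}"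
    using G assms(3) by auto
  ultimately have "algebra \<Omega> hull G \<subseteq> {U \<in> Pow \<Omega>. P U}"
    by (rule hull_minimal[rotated])
  then show ?thesis using assms(1) by auto
qed

lemma uncertainty_generated_space:
  "G \<subseteq> Pow \<Omega> \<Longrightarrow> uncertainty_space (generated_space \<Omega> G)"
  by (simp add: uncertainty_space_def generated_space_def algebra_hull)

lemma meas_subset: "uncertainty_space A \<Longrightarrow> U \<in> meas A \<Longrightarrow> U \<subseteq> points A"
  by (auto simp: uncertainty_space_def algebra_iff_Un)

lemma uncertainty_prod_space:
  "uncertainty_space A \<Longrightarrow> uncertainty_space B \<Longrightarrow> uncertainty_space (prod_space A B)"
  unfolding prod_space_def
  by (rule uncertainty_generated_space) (auto dest: meas_subset)

lemma uncertainty_sum_space: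
  "uncertainty_space A \<Longrightarrow> uncertainty_space B \<Longrightarrow> uncertainty_space (sum_space A B)"
  unfolding sum_space_def
  by (rule uncertainty_generated_space) (auto dest: meas_subset)

lemma uncertainty_Delta_space: "uncertainty_space (Delta_space A)"
  unfolding Delta_space_def
  by (rule uncertainty_generated_space) (auto simp: beta_def)

lemma uncertainty_image_space:
  assumes "uncertainty_space A" and e: "inj_on e (points A)"
  shows "uncertainty_space (image_space e A)"
proof -
  have A: "meas A \<subseteq> Pow (points A)" "{} \<in> meas A" "\<And>U. U \<in> meas A \<Longrightarrow> points A - U \<in> meas A"
      "\<And>U V. U \<in> meas A \<Longrightarrow> V \<in> meas A \<Longrightarrow> U \<union> V \<in> meas A"
    using assms(1) by (auto simp: uncertainty_space_def algebra_iff_Un)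
  have "e ` points A - e ` U = e ` (points A - U)" if "U \<in> meas A" for U
    using that A(1) e by (subst inj_on_image_set_diff[OF e]) auto
  then show ?thesis
    unfolding uncertainty_space_def algebra_iff_Un image_space_def
  proof (intro conjI ballI)
    show "meas (USpace (e ` points A) ((`) e ` meas A)) \<subseteq> Pow (points (USpace (e ` points A) ((`) e ` meas A)))"
      using A(1) by (auto intro!: imageI)
  qed (use A in \<open>auto simp: image_Un[symmetric]\<close>)
qed

lemma iso_image_space:
  assumes "uncertainty_space A" and e: "inj_on e (points A)"
  shows "uspace_iso A (image_space e A) e"
proof -
  have sub: "\<And>U. U \<in> meas A \<Longrightarrow> U \<subseteq> points A"
    using assms(1) by (rule meas_subset)
  have 1: "e -` (e ` U) \<inter> points A = U" if "U \<in> meas A" for U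
    using sub[OF that] e by (auto dest: inj_onD)
  have 2: "inv_into (points A) e -` U \<inter> e ` points A = e ` U" if "U \<in> meas A" for U
    using sub[OF that] e by (auto simp: image_iff)
  show ?thesis
    unfolding uspace_iso_def measurable_map_def
    using assms uncertainty_image_space[OF assms] 1 2
    by (auto simp: image_space_def inj_on_imp_bij_betw inv_into_into)
qed

lemma extent_compl: "extent A (CCompl c) = points A - extent A c"
  and extent_Un: "extent A (CUn c d) = extent A c \<union> extent A d"
  by (auto simp: extent_def)

definition coded :: "('x, 'm) val uspace \<Rightarrow> bool" where
  "coded A \<longleftrightarrow> (\<forall>U\<in>meas A. \<exists>c. U = extent A c)"

lemma enc_inj:
  assumes "coded A"
  shows "inj_on (enc A) (upper_probs A)"
proof (rule inj_onI)
  fix g h assume gh: "g \<in> upper_probs A" "h \<in> upper_probs A" and eq: "enc A g = enc A h"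
  have "g U = h U" for U
  proof (cases "U \<in> meas A")
    case True
    then obtain c where "U = extent A c" using assms by (auto simp: coded_def)
    then show ?thesis using eq by (auto simp: enc_def dest: fun_cong)
  next
    case False
    then show ?thesis using gh by (auto simp: upper_probs_def PiE_def extensional_def)
  qed
  then show "g = h" by auto
qed

lemma coded_image_generated:
  assumes A: "A = image_space e (generated_space \<Omega> G)"
    and e: "inj_on e \<Omega>" and G: "G \<subseteq> Pow \<Omega>"
    and base: "\<And>U. U \<in> G \<Longrightarrow> \<exists>c. e ` U = extent A c"
    and empty: "\<exists>c. extent A c = {}"
  shows "coded A"
proof -
  have pts: "points A = e ` \<Omega>" by (simp add: A image_space_def generated_space_def)
  have "\<exists>c. e ` U = extent A c" if "U \<in> algebra \<Omega> hull G" for U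
    using that G
  proof (induction rule: hull_algebra_induct)
    case (base U)
    then show ?case by (rule assms(4))
  next
    case empty
    then show ?case using assms(5) by auto
  next
    case (compl U)
    then obtain c where "e ` U = extent A c" by auto
    then have "e ` (\<Omega> - U) = extent A (CCompl c)"
      using inj_on_image_set_diff[OF e _ compl(1), of \<Omega>] by (simp add: extent_compl pts)
    then show ?case by blast
  next
    case (union U V)
    then obtain c d where "e ` U = extent A c" "e ` V = extent A d" by auto
    then have "e ` (U \<union> V) = extent A (CUn c d)" by (simp add: extent_Un image_Un)
    then show ?case by blast
  qed
  then show ?thesis
    unfolding coded_def by (auto simp: A image_space_def generated_space_def)
qed

lemma app_coded:
  assumes "uncertainty_space X" and "upp_functor S"
  shows "uncertainty_space (app S X) \<and> coded (app S X)"
  using assms(2)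
proof (induction S)
  case FId
  have "coded (app FId X)"
    unfolding coded_def
  proof
    fix U assume "U \<in> meas (app FId X)"
    then obtain V where V: "V \<in> meas X" "U = VId ` V" by (auto simp: image_space_def)
    then have "U = extent (app FId X) (CId V)"
      using meas_subset[OF assms(1) V(1)] by (auto simp: extent_def image_space_def)
    then show "\<exists>c. U = extent (app FId X) c" by blast
  qed
  then show ?case using uncertainty_image_space[OF assms(1), of VId] by (simp add: inj_on_def)
next
  case (FConst M)
  then have M: "uncertainty_space M" by simp
  have "coded (app (FConst M) X)"
    unfolding coded_def
  proof
    fix U assume "U \<in> meas (app (FConst M) X)"
    then obtain V where V: "V \<in> meas M" "U = VConst ` V" by (auto simp: image_space_def)
    then have "U = extent (app (FConst M) X) (CConst V)"
      using meas_subset[OF M V(1)] by (auto simp: extent_def image_space_def)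
    then show "\<exists>c. U = extent (app (FConst M) X) c" by blast
  qed
  then show ?case using uncertainty_image_space[OF M, of VConst] by (simp add: inj_on_def)
next
  case (FProd S1 S2)
  let ?A = "app S1 X" and ?B = "app S2 X" and ?C = "app (FProd S1 S2) X"
  have AB: "uncertainty_space ?A" "uncertainty_space ?B" "coded ?A" "coded ?B"
    using FProd by auto
  have "coded ?C"
  proof (rule coded_image_generated)
    show "?C = image_space (\<lambda>(v, w). VPair v w) (generated_space (points ?A \<times> points ?B)
        {U \<times> V | U V. U \<in> meas ?A \<and> V \<in> meas ?B})"
      by (simp add: prod_space_def)
    show "inj_on (\<lambda>(v, w). VPair v w) (points ?A \<times> points ?B)" by (auto simp: inj_on_def)
    show "{U \<times> V | U V. U \<in> meas ?A \<and> V \<in> meas ?B} \<subseteq> Pow (points ?A \<times> points ?B)"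
      using AB by (auto dest: meas_subset)
    fix W assume "W \<in> {U \<times> V | U V. U \<in> meas ?A \<and> V \<in> meas ?B}"
    then obtain U V where W: "W = U \<times> V" "U \<in> meas ?A" "V \<in> meas ?B" by blast
    then obtain c d where cd: "U = extent ?A c" "V = extent ?B d"
      using AB unfolding coded_def by meson
    have "(\<lambda>(v, w). VPair v w) ` W = extent ?C (CRect c d)"
      by (auto simp: W cd extent_def image_space_def prod_space_def generated_space_def)
    then show "\<exists>c. (\<lambda>(v, w). VPair v w) ` W = extent ?C c" by blast
  next
    have "extent ?C (CId {}) = {}"
      by (auto simp: extent_def image_space_def prod_space_def generated_space_def)
    then show "\<exists>c. extent ?C c = {}" by blast
  qed
  moreover have "uncertainty_space ?C"
    unfolding app.simps
    by (rule uncertainty_image_space[OF uncertainty_prod_space[OF AB(1,2)]]) (auto simp: inj_on_def)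
  ultimately show ?case by blast
next
  case (FSum S1 S2)
  let ?A = "app S1 X" and ?B = "app S2 X" and ?C = "app (FSum S1 S2) X"
  let ?G = "{Inl ` U | U. U \<in> meas ?A} \<union> {Inr ` V | V. V \<in> meas ?B}"
  have AB: "uncertainty_space ?A" "uncertainty_space ?B" "coded ?A" "coded ?B"
    using FSum by auto
  have pts: "points ?C = VInl ` points ?A \<union> VInr ` points ?B"
    by (force simp: image_space_def sum_space_def generated_space_def Plus_def image_Un image_image)
  have "coded ?C"
  proof (rule coded_image_generated)
    show "?C = image_space (case_sum VInl VInr) (generated_space (points ?A <+> points ?B) ?G)"
      by (simp add: sum_space_def)
    show "inj_on (case_sum VInl VInr) (points ?A <+> points ?B)" by (auto simp: inj_on_def)
    show "?G \<subseteq> Pow (points ?A <+> points ?B)"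
      using AB by (auto dest: meas_subset)
    fix W assume "W \<in> ?G"
    then consider U where "W = Inl ` U" "U \<in> meas ?A" | V where "W = Inr ` V" "V \<in> meas ?B" by blast
    then show "\<exists>c. case_sum VInl VInr ` W = extent ?C c"
    proof cases
      case 1
      then obtain c where c: "U = extent ?A c" using AB by (auto simp: coded_def)
      have "case_sum VInl VInr ` W = extent ?C (CInl c)"
        unfolding extent_def pts by (auto simp: 1 c extent_def image_image)
      then show ?thesis by blast
    next
      case 2
      then obtain c where c: "V = extent ?B c" using AB by (auto simp: coded_def)
      have "case_sum VInl VInr ` W = extent ?C (CInr c)"
        unfolding extent_def pts by (auto simp: 2 c extent_def image_image)
      then show ?thesis by blast
    qed
  next
    have "extent ?C (CId {}) = {}"
      unfolding extent_def pts by auto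
    then show "\<exists>c. extent ?C c = {}" by blast
  qed
  moreover have "uncertainty_space ?C"
    unfolding app.simps
    by (rule uncertainty_image_space[OF uncertainty_sum_space[OF AB(1,2)]])
       (auto simp: inj_on_def split: sum.splits)
  ultimately show ?case by blast
next
  case (FDelta S)
  let ?A = "app S X" and ?C = "app (FDelta S) X"
  let ?G = "{beta ?A p q U | p q U. p \<in> {0..1} \<and> q \<in> {0..1} \<and> U \<in> meas ?A}"
  have A: "uncertainty_space ?A" "coded ?A" using FDelta by auto
  have inj: "inj_on (enc ?A) (upper_probs ?A)" by (rule enc_inj[OF A(2)])
  have pts: "points ?C = enc ?A ` upper_probs ?A"
    by (simp add: image_space_def Delta_space_def generated_space_def)
  have "coded ?C"
  proof (rule coded_image_generated)
    show "?C = image_space (enc ?A) (generated_space (upper_probs ?A) ?G)"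
      by (simp add: Delta_space_def)
    show "inj_on (enc ?A) (upper_probs ?A)" by (rule inj)
    show "?G \<subseteq> Pow (upper_probs ?A)" by (auto simp: beta_def)
    fix W assume "W \<in> ?G"
    then obtain p q U where W: "W = beta ?A p q U" "U \<in> meas ?A" by blast
    then obtain c where c: "U = extent ?A c" using A by (auto simp: coded_def)
    have "enc ?A ` W = extent ?C (CBeta p q c)"
      unfolding extent_def pts by (auto simp: W c beta_def enc_def extent_compl)
    then show "\<exists>c. enc ?A ` W = extent ?C c" by blast
  next
    have "extent ?C (CId {}) = {}"
      unfolding extent_def pts by (auto simp: enc_def)
    then show "\<exists>c. extent ?C c = {}" by blast
  qed
  moreover have "uncertainty_space ?C"
    unfolding app.simps
    by (rule uncertainty_image_space[OF uncertainty_Delta_space])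
       (simp add: Delta_space_def generated_space_def inj)
  ultimately show ?case by blast
qed

theorem app_iso:
  assumes X: "uncertainty_space X"
  shows "uspace_iso X (app FId X) VId"
    and "uncertainty_space M \<Longrightarrow> uspace_iso M (app (FConst M) X) VConst"
    and "upp_functor S1 \<Longrightarrow> upp_functor S2 \<Longrightarrow>
      uspace_iso (prod_space (app S1 X) (app S2 X)) (app (FProd S1 S2) X) (\<lambda>(v, w). VPair v w)"
    and "upp_functor S1 \<Longrightarrow> upp_functor S2 \<Longrightarrow>
      uspace_iso (sum_space (app S1 X) (app S2 X)) (app (FSum S1 S2) X) (case_sum VInl VInr)"
    and "upp_functor S \<Longrightarrow>
      uspace_iso (Delta_space (app S X)) (app (FDelta S) X) (enc (app S X))"
proof -
  show "uspace_iso X (app FId X) VId"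
    by (simp, rule iso_image_space[OF X]) (simp add: inj_on_def)
  show "uspace_iso M (app (FConst M) X) VConst" if "uncertainty_space M"
    by (simp, rule iso_image_space[OF that]) (simp add: inj_on_def)
  show "uspace_iso (prod_space (app S1 X) (app S2 X)) (app (FProd S1 S2) X) (\<lambda>(v, w). VPair v w)"
    if "upp_functor S1" "upp_functor S2"
    using app_coded[OF X that(1)] app_coded[OF X that(2)] unfolding app.simps
    by (intro iso_image_space uncertainty_prod_space) (auto simp: inj_on_def)
  show "uspace_iso (sum_space (app S1 X) (app S2 X)) (app (FSum S1 S2) X) (case_sum VInl VInr)"
    if "upp_functor S1" "upp_functor S2"
    using app_coded[OF X that(1)] app_coded[OF X that(2)] unfolding app.simps
    by (intro iso_image_space uncertainty_sum_space)
       (auto simp: inj_on_def split: sum.splits)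
  show "uspace_iso (Delta_space (app S X)) (app (FDelta S) X) (enc (app S X))"
    if "upp_functor S"
    using app_coded[OF X that] unfolding app.simps
    by (intro iso_image_space uncertainty_Delta_space)
       (simp add: Delta_space_def generated_space_def enc_inj)
qed


section \<open>Coalgebras\<close>

definition coalgebra :: "'m pfun \<Rightarrow> 'x uspace \<Rightarrow> ('x \<Rightarrow> ('x, 'm) val) \<Rightarrow> bool" where
  "coalgebra T X \<alpha> \<longleftrightarrow> measurable_map X (app T X) \<alpha>"

definition coalgebra_morphism :: "'m pfun \<Rightarrow> 'x uspace \<Rightarrow> ('x \<Rightarrow> ('x, 'm) val) \<Rightarrow>
    'y uspace \<Rightarrow> ('y \<Rightarrow> ('y, 'm) val) \<Rightarrow> ('x \<Rightarrow> 'y) \<Rightarrow> bool" where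
  "coalgebra_morphism T X \<alpha> Y \<delta> f \<longleftrightarrow> coalgebra T X \<alpha> \<and> coalgebra T Y \<delta> \<and>
     measurable_map X Y f \<and> (\<forall>x\<in>points X. \<delta> (f x) = fmap T X Y f (\<alpha> x))"

text \<open>Finality with respect to the coalgebras carried by the type \<open>'y\<close>. HOL cannot quantify over
  types inside a formula; a theorem with \<open>'y\<close> free covers all types. Maps agree if they agree on the points
  of the source.\<close>

definition final_coalgebra :: "'y itself \<Rightarrow> 'm pfun \<Rightarrow> 'x uspace \<Rightarrow> ('x \<Rightarrow> ('x, 'm) val) \<Rightarrow> bool" where
  "final_coalgebra _ T X \<alpha> \<longleftrightarrow> coalgebra T X \<alpha> \<and>
     (\<forall>(Y::'y uspace) \<delta>. coalgebra T Y \<delta> \<longrightarrow>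
        (\<exists>f. coalgebra_morphism T Y \<delta> X \<alpha> f \<and>
             (\<forall>h. coalgebra_morphism T Y \<delta> X \<alpha> h \<longrightarrow> (\<forall>y\<in>points Y. h y = f y))))"


section \<open>Formulas\<close>

datatype label = PR1 | PR2 | IN1 | IN2 | NEXT

datatype 'm form =
    Bot "'m pfun"
  | Imp "'m form" "'m form"
  | Cst "'m set"
  | Box label "'m form"
  | Prob real real "'m form"

inductive edge :: "'m pfun \<Rightarrow> label \<Rightarrow> 'm pfun \<Rightarrow> 'm pfun \<Rightarrow> bool" for T where
  "edge T PR1 (FProd S1 S2) S1"
| "edge T PR2 (FProd S1 S2) S2"
| "edge T IN1 (FSum S1 S2) S1"
| "edge T IN2 (FSum S1 S2) S2"
| "edge T NEXT FId T"

text \<open>\<open>has_sort T False S \<phi>\<close> is \<open>\<phi> : S\<close>; \<open>has_sort T True S \<phi>\<close> is \<open>\<phi> :: S\<close>, where the non-measurable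
  singletons are excluded everywhere.\<close>

inductive has_sort :: "'m pfun \<Rightarrow> bool \<Rightarrow> 'm pfun \<Rightarrow> 'm form \<Rightarrow> bool" for T where
  "has_sort T b S (Bot S)"
| "has_sort T b S \<phi> \<Longrightarrow> has_sort T b S \<psi> \<Longrightarrow> has_sort T b S (Imp \<phi> \<psi>)"
| "A \<in> meas M \<Longrightarrow> has_sort T b (FConst M) (Cst A)"
| "m \<in> points M \<Longrightarrow> has_sort T False (FConst M) (Cst {m})"
| "edge T \<kappa> S S' \<Longrightarrow> has_sort T b S' \<phi> \<Longrightarrow> has_sort T b S (Box \<kappa> \<phi>)"
| "p \<in> {0..1} \<Longrightarrow> q \<in> {0..1} \<Longrightarrow> has_sort T True S \<phi> \<Longrightarrow> has_sort T b (FDelta S) (Prob p q \<phi>)"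

definition Form :: "'m pfun \<Rightarrow> 'm pfun \<Rightarrow> 'm form set" where
  "Form T S = {\<phi>. has_sort T False S \<phi>}"

definition mForm :: "'m pfun \<Rightarrow> 'm pfun \<Rightarrow> 'm form set" where
  "mForm T S = {\<phi>. has_sort T True S \<phi>}"

text \<open>The argument \<open>S\<close> of the following abbreviations is the sort of \<open>\<phi>\<close> and \<open>\<psi>\<close>.\<close>

definition Neg :: "'m pfun \<Rightarrow> 'm form \<Rightarrow> 'm form" where
  "Neg S \<phi> = Imp \<phi> (Bot S)"
definition Top :: "'m pfun \<Rightarrow> 'm form" where
  "Top S = Neg S (Bot S)"
definition Or :: "'m pfun \<Rightarrow> 'm form \<Rightarrow> 'm form \<Rightarrow> 'm form" where
  "Or S \<phi> \<psi> = Imp (Neg S \<phi>) \<psi>"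
definition And :: "'m pfun \<Rightarrow> 'm form \<Rightarrow> 'm form \<Rightarrow> 'm form" where
  "And S \<phi> \<psi> = Neg S (Imp \<phi> (Neg S \<psi>))"
definition Iff :: "'m pfun \<Rightarrow> 'm form \<Rightarrow> 'm form \<Rightarrow> 'm form" where
  "Iff S \<phi> \<psi> = And S (Imp \<phi> \<psi>) (Imp \<psi> \<phi>)"
definition Conj :: "'m pfun \<Rightarrow> 'm form list \<Rightarrow> 'm form" where
  "Conj S \<phi>s = foldr (And S) \<phi>s (Top S)"
definition Disj :: "'m pfun \<Rightarrow> 'm form list \<Rightarrow> 'm form" where
  "Disj S \<phi>s = foldr (Or S) \<phi>s (Bot S)"

definition Uge :: "real \<Rightarrow> 'm form \<Rightarrow> 'm form" where
  "Uge p \<phi> = Prob p 0 \<phi>"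
definition Lge :: "real \<Rightarrow> 'm form \<Rightarrow> 'm form" where
  "Lge p \<phi> = Prob 0 p \<phi>"
definition Ule :: "'m pfun \<Rightarrow> real \<Rightarrow> 'm form \<Rightarrow> 'm form" where
  "Ule S p \<phi> = Prob 0 (1 - p) (Neg S \<phi>)"
definition Ult :: "'m pfun \<Rightarrow> real \<Rightarrow> 'm form \<Rightarrow> 'm form" where
  "Ult S p \<phi> = Neg (FDelta S) (Uge p \<phi>)"

text \<open>\<open>at_least S k [\<phi>\<^sub>1, \<dots>, \<phi>\<^sub>m]\<close> is the disjunction over all index sets \<open>I\<close> with \<open>|I| = k\<close> of the
  conjunctions of the \<open>\<phi>\<^sub>i\<close>, \<open>i \<in> I\<close>; \<^const>\<open>subseqs\<close> selects by position, so repetitions among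
  the \<open>\<phi>\<^sub>i\<close> are counted.\<close>

definition at_least :: "'m pfun \<Rightarrow> nat \<Rightarrow> 'm form list \<Rightarrow> 'm form" where
  "at_least S k \<phi>s = Disj S (map (Conj S) (filter (\<lambda>\<psi>s. length \<psi>s = k) (subseqs \<phi>s)))"


section \<open>Semantics\<close>

fun sem :: "'m pfun \<Rightarrow> 'x uspace \<Rightarrow> ('x \<Rightarrow> ('x, 'm) val) \<Rightarrow> 'm pfun \<Rightarrow> 'm form \<Rightarrow>
    ('x, 'm) val set" where
  "sem T X \<alpha> S (Bot S') = {}"
| "sem T X \<alpha> S (Imp \<phi> \<psi>) = (points (app S X) - sem T X \<alpha> S \<phi>) \<union> sem T X \<alpha> S \<psi>"
| "sem T X \<alpha> (FConst M) (Cst A) = VConst ` A"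
| "sem T X \<alpha> (FProd S1 S2) (Box PR1 \<phi>) =
     {v \<in> points (app (FProd S1 S2) X). vfst v \<in> sem T X \<alpha> S1 \<phi>}"
| "sem T X \<alpha> (FProd S1 S2) (Box PR2 \<phi>) =
     {v \<in> points (app (FProd S1 S2) X). vsnd v \<in> sem T X \<alpha> S2 \<phi>}"
| "sem T X \<alpha> (FSum S1 S2) (Box IN1 \<phi>) = VInl ` sem T X \<alpha> S1 \<phi> \<union> VInr ` points (app S2 X)"
| "sem T X \<alpha> (FSum S1 S2) (Box IN2 \<phi>) = VInl ` points (app S1 X) \<union> VInr ` sem T X \<alpha> S2 \<phi>"
| "sem T X \<alpha> FId (Box NEXT \<phi>) = VId ` {x \<in> points X. \<alpha> x \<in> sem T X \<alpha> T \<phi>}"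
| "sem T X \<alpha> (FDelta S) (Prob p q \<phi>) = enc (app S X) ` beta (app S X) p q (sem T X \<alpha> S \<phi>)"
| "sem T X \<alpha> _ _ = {}"

text \<open>Semantic consequence with respect to the coalgebras carried by the type \<open>'y\<close>.\<close>

definition sem_conseq :: "'y itself \<Rightarrow> 'm pfun \<Rightarrow> 'm pfun \<Rightarrow> 'm form set \<Rightarrow> 'm form \<Rightarrow> bool" where
  "sem_conseq _ T S \<Gamma> \<phi> \<longleftrightarrow> (\<forall>(Y::'y uspace) \<delta>. coalgebra T Y \<delta> \<longrightarrow>
     (\<forall>v\<in>points (app S Y). (\<forall>\<gamma>\<in>\<Gamma>. v \<in> sem T Y \<delta> S \<gamma>) \<longrightarrow> v \<in> sem T Y \<delta> S \<phi>))"

definition des :: "'m pfun \<Rightarrow> 'y uspace \<Rightarrow> ('y \<Rightarrow> ('y, 'm) val) \<Rightarrow> 'm pfun \<Rightarrow>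
    ('y, 'm) val \<Rightarrow> 'm form set" where
  "des T Y \<delta> S v = {\<phi> \<in> Form T S. v \<in> sem T Y \<delta> S \<phi>}"


section \<open>Deduction systems\<close>

text \<open>Boolean evaluation; formulas other than falsum and implications act as propositional atoms.\<close>

primrec bool_val :: "('m form \<Rightarrow> bool) \<Rightarrow> 'm form \<Rightarrow> bool" where
  "bool_val a (Bot S) = False"
| "bool_val a (Imp \<phi> \<psi>) = (bool_val a \<phi> \<longrightarrow> bool_val a \<psi>)"
| "bool_val a (Cst A) = a (Cst A)"
| "bool_val a (Box \<kappa> \<phi>) = a (Box \<kappa> \<phi>)"
| "bool_val a (Prob p q \<phi>) = a (Prob p q \<phi>)"

inductive_set Ax :: "'m pfun \<Rightarrow> 'm pfun \<Rightarrow> 'm form set" for T S where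
  taut: "\<phi> \<in> Form T S \<Longrightarrow> (\<And>a. bool_val a \<phi>) \<Longrightarrow> \<phi> \<in> Ax T S"
| const_in: "S = FConst M \<Longrightarrow> c \<in> points M \<Longrightarrow> Cst A \<in> Form T S \<Longrightarrow> c \<in> A \<Longrightarrow>
    Imp (Cst {c}) (Cst A) \<in> Ax T S"
| const_notin: "S = FConst M \<Longrightarrow> c \<in> points M \<Longrightarrow> Cst A \<in> Form T S \<Longrightarrow> c \<notin> A \<Longrightarrow>
    Imp (Cst {c}) (Neg S (Cst A)) \<in> Ax T S"
| box_neg: "edge T \<kappa> S S' \<Longrightarrow> \<phi> \<in> Form T S' \<Longrightarrow>
    Imp (Neg S (Box \<kappa> \<phi>)) (Box \<kappa> (Neg S' \<phi>)) \<in> Ax T S"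
| pr_bot: "\<kappa> \<in> {PR1, PR2} \<Longrightarrow> edge T \<kappa> S S' \<Longrightarrow> Neg S (Box \<kappa> (Bot S')) \<in> Ax T S"
| in_bot: "S = FSum S1 S2 \<Longrightarrow>
    Iff S (Neg S (Box IN1 (Bot S1))) (Box IN2 (Bot S2)) \<in> Ax T S"
| next_bot: "S = FId \<Longrightarrow> Neg S (Box NEXT (Bot T)) \<in> Ax T S"
| Ule_Ult: "S = FDelta S' \<Longrightarrow> \<phi> \<in> mForm T S' \<Longrightarrow> p \<in> {0..1} \<Longrightarrow> q \<in> {0..1} \<Longrightarrow> p < q \<Longrightarrow>
    Imp (Ule S' p \<phi>) (Ult S' q \<phi>) \<in> Ax T S"
| Ult_Ule: "S = FDelta S' \<Longrightarrow> \<phi> \<in> mForm T S' \<Longrightarrow> p \<in> {0..1} \<Longrightarrow>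
    Imp (Ult S' p \<phi>) (Ule S' p \<phi>) \<in> Ax T S"
| Uge_mono: "S = FDelta S' \<Longrightarrow> \<phi> \<in> mForm T S' \<Longrightarrow> \<psi> \<in> mForm T S' \<Longrightarrow> p \<in> {0..1} \<Longrightarrow>
    Imp (Lge 1 (Imp \<phi> \<psi>)) (Imp (Uge p \<phi>) (Uge p \<psi>)) \<in> Ax T S"
| Prob_iff: "S = FDelta S' \<Longrightarrow> \<phi> \<in> mForm T S' \<Longrightarrow> p \<in> {0..1} \<Longrightarrow> q \<in> {0..1} \<Longrightarrow>
    Iff S (Prob p q \<phi>) (And S (Uge p \<phi>) (Lge q \<phi>)) \<in> Ax T S"

type_synonym 'm derivability = "'m pfun \<Rightarrow> 'm form set \<Rightarrow> 'm form \<Rightarrow> bool"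

locale deduction_system =
  fixes T :: "'m pfun" and D :: "'m derivability"
  assumes sorted: "S \<in> Ing T \<Longrightarrow> D S \<Gamma> \<phi> \<Longrightarrow> \<Gamma> \<subseteq> Form T S \<and> \<phi> \<in> Form T S"
    and assumption: "S \<in> Ing T \<Longrightarrow> \<Gamma> \<subseteq> Form T S \<Longrightarrow> \<phi> \<in> \<Gamma> \<union> Ax T S \<Longrightarrow> D S \<Gamma> \<phi>"
    and modus_ponens: "S \<in> Ing T \<Longrightarrow> \<phi> \<in> Form T S \<Longrightarrow> \<psi> \<in> Form T S \<Longrightarrow> D S {\<phi>, Imp \<phi> \<psi>} \<psi>"
    and cut: "S \<in> Ing T \<Longrightarrow> \<Gamma> \<subseteq> Form T S \<Longrightarrow> (\<And>\<psi>. \<psi> \<in> \<Lambda> \<Longrightarrow> D S \<Gamma> \<psi>) \<Longrightarrow> D S \<Lambda> \<phi> \<Longrightarrow> D S \<Gamma> \<phi>"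
    and deduction_rule: "S \<in> Ing T \<Longrightarrow> D S (\<Gamma> \<union> {\<phi>}) \<psi> \<Longrightarrow> D S \<Gamma> (Imp \<phi> \<psi>)"
    and necessitation: "FDelta S \<in> Ing T \<Longrightarrow> \<phi> \<in> mForm T S \<Longrightarrow> D S {} \<phi> \<Longrightarrow> D (FDelta S) {} (Lge 1 \<phi>)"
    and const_rule: "FConst M \<in> Ing T \<Longrightarrow>
      D (FConst M) {Neg (FConst M) (Cst {c}) | c. c \<in> points M} (Bot (FConst M))"
    and definite_box: "S \<in> Ing T \<Longrightarrow> edge T \<kappa> S S' \<Longrightarrow> D S' \<Gamma> \<psi> \<Longrightarrow> D S (Box \<kappa> ` \<Gamma>) (Box \<kappa> \<psi>)"
    and archimedean_U: "FDelta S \<in> Ing T \<Longrightarrow> \<psi> \<in> mForm T S \<Longrightarrow> p \<in> {0..1} \<Longrightarrow>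
      D (FDelta S) {Uge q \<psi> | q. q \<in> {0..1} \<and> q < p} (Uge p \<psi>)"
    and archimedean_L: "FDelta S \<in> Ing T \<Longrightarrow> \<psi> \<in> mForm T S \<Longrightarrow> p \<in> {0..1} \<Longrightarrow>
      D (FDelta S) {Lge q \<psi> | q. q \<in> {0..1} \<and> q < p} (Lge p \<psi>)"
    and cover1: "FDelta S \<in> Ing T \<Longrightarrow> \<phi> \<in> mForm T S \<Longrightarrow> set \<phi>s \<subseteq> mForm T S \<Longrightarrow>
      set ps \<subseteq> {0..1} \<Longrightarrow> length ps = length \<phi>s \<Longrightarrow> n \<ge> 1 \<Longrightarrow>
      D S {} (Imp \<phi> (at_least S (n + k) \<phi>s)) \<Longrightarrow> D S {} (at_least S k \<phi>s) \<Longrightarrow>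
      p = max 0 (min 1 ((sum_list ps - real k) / real n)) \<Longrightarrow>
      D (FDelta S) {} (Imp (Conj (FDelta S) (map2 (Ule S) ps \<phi>s)) (Ule S p \<phi>))"
    and cover2: "FDelta S \<in> Ing T \<Longrightarrow> set \<phi>s \<subseteq> mForm T S \<Longrightarrow>
      set ps \<subseteq> {0..1} \<Longrightarrow> length ps = length \<phi>s \<Longrightarrow>
      D S {} (at_least S k \<phi>s) \<Longrightarrow> sum_list ps < real k \<Longrightarrow>
      D (FDelta S) {} (Neg (FDelta S) (Conj (FDelta S) (map2 (Ule S) ps \<phi>s)))"

text \<open>The scheme \<open>L\<^bsub>\<ge>q\<^esub>\<phi> \<leftrightarrow> U\<^bsub>\<le>1-q\<^esub>\<not>\<phi>\<close>. Unfolding the abbreviations, it reads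
  \<open>[(0,q)]\<phi> \<leftrightarrow> [(0,q)]\<not>\<not>\<phi>\<close>. It is valid in all coalgebras and is used implicitly whenever
  \<open>L\<^bsub>\<ge>q\<^esub>\<phi>\<close> and \<open>U\<^bsub>\<le>1-q\<^esub>\<not>\<phi>\<close> are treated as the same formula. It does not follow from the rules of
  \<^locale>\<open>deduction_system\<close>: those governing \<open>U\<^bsub>\<le>p\<^esub>\<close> only involve \<open>[(0,q)]\<close> applied to negations, and
  nothing ties \<open>[(0,q)]A\<close>, for a constant \<open>A\<close>, to them. Without it there is a sound Lindenbaum system
  with maximal sets that are not the description of any point of any coalgebra; conversely, if every
  maximal set is such a description, a Lindenbaum system derives this scheme.\<close>

definition lower_upper_dual :: "'m pfun \<Rightarrow> 'm derivability \<Rightarrow> bool" where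
  "lower_upper_dual T D \<longleftrightarrow> (\<forall>S \<phi>. \<forall>q\<in>{0..1}. FDelta S \<in> Ing T \<longrightarrow> \<phi> \<in> mForm T S \<longrightarrow>
     D (FDelta S) {} (Iff (FDelta S) (Lge q \<phi>) (Ule S (1 - q) (Neg S \<phi>))))"

definition consistent :: "'m derivability \<Rightarrow> 'm pfun \<Rightarrow> 'm form set \<Rightarrow> bool" where
  "consistent D S \<Gamma> \<longleftrightarrow> \<not> D S \<Gamma> (Bot S)"

definition maximal :: "'m pfun \<Rightarrow> 'm derivability \<Rightarrow> 'm pfun \<Rightarrow> 'm form set \<Rightarrow> bool" where
  "maximal T D S \<Gamma> \<longleftrightarrow> \<Gamma> \<subseteq> Form T S \<and> consistent D S \<Gamma> \<and>
     (\<forall>\<phi>\<in>Form T S. \<phi> \<in> \<Gamma> \<longleftrightarrow> Neg S \<phi> \<notin> \<Gamma>)"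

definition lindenbaum :: "'m pfun \<Rightarrow> 'm derivability \<Rightarrow> bool" where
  "lindenbaum T D \<longleftrightarrow> (\<forall>S\<in>Ing T. \<forall>\<Gamma> \<subseteq> Form T S. consistent D S \<Gamma> \<longrightarrow>
     (\<exists>\<Delta>. \<Gamma> \<subseteq> \<Delta> \<and> maximal T D S \<Delta>))"

definition sound :: "'y itself \<Rightarrow> 'm pfun \<Rightarrow> 'm derivability \<Rightarrow> bool" where
  "sound y T D \<longleftrightarrow> (\<forall>S\<in>Ing T. \<forall>\<Gamma> \<phi>. D S \<Gamma> \<phi> \<longrightarrow> sem_conseq y T S \<Gamma> \<phi>)"


section \<open>The canonical coalgebra\<close>

definition ext :: "'m pfun \<Rightarrow> 'm derivability \<Rightarrow> 'm pfun \<Rightarrow> 'm form \<Rightarrow> 'm form set set" where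
  "ext T D S \<phi> = {x. maximal T D S x \<and> \<phi> \<in> x}"

text \<open>The space \<open>X\<^sub>S\<close>.\<close>

definition can_space :: "'m pfun \<Rightarrow> 'm derivability \<Rightarrow> 'm pfun \<Rightarrow> 'm form set uspace" where
  "can_space T D S = USpace {x. maximal T D S x} (ext T D S ` mForm T S)"

definition unbox :: "label \<Rightarrow> 'm form set \<Rightarrow> 'm form set" where
  "unbox \<kappa> x = {\<phi>. Box \<kappa> \<phi> \<in> x}"

definition rho_prod :: "'m form set \<Rightarrow> 'm form set \<times> 'm form set" where
  "rho_prod x = (unbox PR1 x, unbox PR2 x)"

definition rho_sum :: "'m pfun \<Rightarrow> 'm pfun \<Rightarrow> 'm form set \<Rightarrow> 'm form set + 'm form set" where
  "rho_sum S1 S2 x =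
     (if Neg (FSum S1 S2) (Box IN1 (Bot S1)) \<in> x then Inl (unbox IN1 x) else Inr (unbox IN2 x))"

definition rho_Id :: "'m form set \<Rightarrow> 'm form set" where
  "rho_Id x = unbox NEXT x"

text \<open>\<open>rho_Delta T D S x\<close> is \<open>g\<^sub>x\<close>; the description operator expresses that its value at a
  measurable set is independent of the formula representing the set.\<close>

definition rho_Delta ::
    "'m pfun \<Rightarrow> 'm derivability \<Rightarrow> 'm pfun \<Rightarrow> 'm form set \<Rightarrow> 'm form set set \<Rightarrow> real" where
  "rho_Delta T D S x = (\<lambda>U\<in>meas (can_space T D S).
     THE r. \<forall>\<phi>\<in>mForm T S. U = ext T D S \<phi> \<longrightarrow> r = Sup {q \<in> {0..1}. Uge q \<phi> \<in> x})"

text \<open>\<open>rmap T D S\<close> is the map \<open>r\<^sub>S\<close> from \<open>X\<^sub>S\<close> to \<open>S X\<^bsub>Id\<^esub>\<close>.\<close>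

primrec rmap :: "'m pfun \<Rightarrow> 'm derivability \<Rightarrow> 'm pfun \<Rightarrow> 'm form set \<Rightarrow>
    ('m form set, 'm) val" where
  "rmap T D FId = VId"
| "rmap T D (FConst M) = (\<lambda>x. VConst (THE c. c \<in> points M \<and> Cst {c} \<in> x))"
| "rmap T D (FProd S1 S2) = (\<lambda>x. case rho_prod x of (y, z) \<Rightarrow> VPair (rmap T D S1 y) (rmap T D S2 z))"
| "rmap T D (FSum S1 S2) = (\<lambda>x. case rho_sum S1 S2 x of
     Inl y \<Rightarrow> VInl (rmap T D S1 y) | Inr z \<Rightarrow> VInr (rmap T D S2 z))"
| "rmap T D (FDelta S) = (\<lambda>x. enc (app S (can_space T D FId))
     (Delta_map (can_space T D S) (app S (can_space T D FId)) (rmap T D S) (rho_Delta T D S x)))"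

definition can_coalg :: "'m pfun \<Rightarrow> 'm derivability \<Rightarrow> 'm form set \<Rightarrow> ('m form set, 'm) val" where
  "can_coalg T D = rmap T D T \<circ> rho_Id"

end

theory Submission
  imports Defs "HOL-Library.Function_Algebras"
begin

text \<open>
  Let \<open>X\<^sub>0\<close> be the canonical carrier. Soundness makes every description a maximal set, so \<open>des\<close> takes
  values in \<open>X\<^sub>S\<close>. Structural induction on \<open>S\<close> shows that \<open>r\<^sub>S \<circ> des\<^sub>S\<close> is \<open>S h\<close> with
  \<open>h = des\<^bsub>Id\<^esub>\<close>; for \<open>S = T\<close> this says that \<open>h\<close> is a morphism into the canonical coalgebra. Conversely
  \<open>des\<^sub>S \<circ> r\<^sub>S = id\<close> on \<open>X\<^sub>S\<close> (the truth lemma), so on the canonical coalgebra \<open>h\<close> is the identity, the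
  first equation makes \<open>r\<^sub>S\<close> the inverse of \<open>des\<^sub>S\<close>, and invariance of descriptions under morphisms
  gives uniqueness.

  All this needs that the set function \<open>g\<^sub>x\<close> is an upper probability measure. The rules (C1) and (C2) say
  that \<open>n g\<^sub>x U + k \<le> \<Sum>\<^sub>i g\<^sub>x U\<^sub>i\<close> whenever the \<open>U\<^sub>i\<close> cover every point \<open>k\<close> times and every point of \<open>U\<close>
  another \<open>n\<close> times. A set function with this property extends to a sublinear functional on the bounded
  integer-valued functions, and for each \<open>W\<close> a Hahn-Banach argument yields a probability measure below it
  that agrees with it at \<open>W\<close>.
\<close>

section \<open>Additive functionals below subadditive ones\<close>

text \<open>Covers have integer multiplicities only, so the Hahn-Banach argument lives on an abelian
  group of integer-valued functions: homogeneity is available for natural factors, division is not.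
  No functional is extended step by step from smaller subgroups; Zorn's lemma gives a minimal
  sublinear functional, and minimality forces additivity.

  The order of the canonical part is dictated by \<open>Delta_map\<close>, which evaluates a set
  function at preimages and so makes sense only along measurable maps. Hence \<open>rmap\<close>
  must be shown measurable before the truth lemma can be stated usefully at \<open>FDelta\<close>.
  This works because the measurable sets of \<open>can_space T D S\<close> are exactly the extents
  of formulas of sort \<open>S\<close> without non-measurable singletons: measurability of a
  preimage amounts to writing down a formula that defines it.

  Claims about satisfaction go by induction on formulas, because \<open>Box NEXT\<close> leads from
  \<open>FId\<close> back to all of \<open>T\<close>; equations between maps go by induction on the
  functor. Soundness is tied to a carrier type, so it is assumed both for the coalgebras to be
  mapped and for the type of the canonical carrier.\<close>

definition additive_subgroup :: "'v::comm_ring_1 set \<Rightarrow> bool" where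
  "additive_subgroup V \<longleftrightarrow> 0 \<in> V \<and> (\<forall>u\<in>V. \<forall>v\<in>V. u + v \<in> V) \<and> (\<forall>v\<in>V. - v \<in> V)"

text \<open>Only one half of homogeneity under natural factors is demanded; subadditivity supplies
  the other. The ring type lets the n-fold sum be written \<open>of_nat n * v\<close>, which is
  pointwise for functions into \<open>int\<close>.\<close>

definition sublinear :: "'v::comm_ring_1 set \<Rightarrow> ('v \<Rightarrow> real) \<Rightarrow> bool" where
  "sublinear V p \<longleftrightarrow> (\<forall>u\<in>V. \<forall>v\<in>V. p (u + v) \<le> p u + p v) \<and>
     (\<forall>v\<in>V. \<forall>n::nat. n \<ge> 1 \<longrightarrow> real n * p v \<le> p (of_nat n * v))"

lemma additive_subgroup_of_nat:
  "additive_subgroup V \<Longrightarrow> v \<in> V \<Longrightarrow> of_nat n * v \<in> V"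
  by (induction n) (auto simp: additive_subgroup_def algebra_simps)

text \<open>Subadditivity at \<open>0 + 0\<close> gives \<open>0 \<le> p 0\<close>, and doubling
  gives \<open>2 * p 0 \<le> p 0\<close>.\<close>

lemma sublinear_zero: "additive_subgroup V \<Longrightarrow> sublinear V p \<Longrightarrow> p 0 = 0"
proof -
  assume "additive_subgroup V" and p: "sublinear V p"
  then have 0: "0 \<in> V" by (simp add: additive_subgroup_def)
  have "p (0 + 0) \<le> p 0 + p 0" "real 2 * p 0 \<le> p (of_nat 2 * 0)"
    using p 0 unfolding sublinear_def by (blast, metis one_le_numeral)
  then show ?thesis by simp
qed

lemma sublinear_minus:
  assumes "additive_subgroup V" and "sublinear V p" and "v \<in> V"
  shows "- p (- v) \<le> p v"
proof -
  have "p (v + - v) \<le> p v + p (- v)"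
    using assms unfolding sublinear_def additive_subgroup_def by blast
  then show ?thesis using sublinear_zero[OF assms(1,2)] by simp
qed

lemma sublinear_of_nat:
  assumes V: "additive_subgroup V" and p: "sublinear V p" and v: "v \<in> V"
  shows "p (of_nat n * v) = real n * p v"
proof (cases "n = 0")
  case True
  then show ?thesis using sublinear_zero[OF V p] by simp
next
  case False
  have "p (of_nat n * v) \<le> real n * p v" for n
  proof (induction n)
    case 0
    then show ?case using sublinear_zero[OF V p] by simp
  next
    case (Suc n)
    have "p (v + of_nat n * v) \<le> p v + p (of_nat n * v)"
      using p v additive_subgroup_of_nat[OF V v] by (simp add: sublinear_def)
    with Suc show ?case by (simp add: algebra_simps)
  qed
  moreover have "real n * p v \<le> p (of_nat n * v)"
    using False p v by (simp add: sublinear_def)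
  ultimately show ?thesis by (simp add: antisym)
qed

text \<open>The largest sublinear functional below \<open>p\<close> whose value at \<open>-w\<close> is at most \<open>-p w\<close>.\<close>

definition twist :: "('v::comm_ring_1 \<Rightarrow> real) \<Rightarrow> 'v \<Rightarrow> 'v \<Rightarrow> real" where
  "twist p w v = (INF t::nat. p (v + of_nat t * w) - real t * p w)"

context
  fixes V :: "'v::comm_ring_1 set" and p :: "'v \<Rightarrow> real" and w :: 'v
  assumes V: "additive_subgroup V" and p: "sublinear V p" and w: "w \<in> V"
begin

lemma twist_le:
  assumes v: "v \<in> V"
  shows "twist p w v \<le> p (v + of_nat t * w) - real t * p w"
  unfolding twist_def
proof (rule cINF_lower)
  \<comment> \<open>A lower bound independent of \<open>t\<close>, so that the infimum is finite:
    subadditivity for \<open>- v\<close> and \<open>v + of_nat t * w\<close>, whose sum has the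
    value \<open>real t * p w\<close>.\<close>
  have "- p (- v) \<le> p (v + of_nat t * w) - real t * p w" for t
  proof -
    have "p (- v + (v + of_nat t * w)) \<le> p (- v) + p (v + of_nat t * w)"
      using p v V additive_subgroup_of_nat[OF V w] unfolding sublinear_def additive_subgroup_def
      by blast
    then show ?thesis using sublinear_of_nat[OF V p w] by simp
  qed
  then show "bdd_below (range (\<lambda>t. p (v + of_nat t * w) - real t * p w))"
    by (auto simp: bdd_below_def)
qed simp

lemma twist_greatest:
  "(\<And>t. c \<le> p (v + of_nat t * w) - real t * p w) \<Longrightarrow> c \<le> twist p w v"
  unfolding twist_def by (rule cINF_greatest) auto

lemma twist_le_self: "v \<in> V \<Longrightarrow> twist p w v \<le> p v"
  using twist_le[of v 0] by simp

text \<open>The shift \<open>t = 1\<close> moves \<open>- w\<close> to \<open>0\<close>, where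
  \<open>p\<close> vanishes.\<close>

lemma twist_minus: "twist p w (- w) \<le> - p w"
  using twist_le[of "- w" 1] w V sublinear_zero[OF V p] by (simp add: additive_subgroup_def)

lemma sublinear_twist: "sublinear V (twist p w)"
  unfolding sublinear_def
proof (intro conjI ballI allI impI)
  fix u v assume u: "u \<in> V" and v: "v \<in> V"
  have uv: "u + v \<in> V" using u v V by (simp add: additive_subgroup_def)
  have tV: "x + of_nat t * w \<in> V" if "x \<in> V" for x t
    using that V additive_subgroup_of_nat[OF V w] by (simp add: additive_subgroup_def)
  \<comment> \<open>The shifts \<open>s\<close> and \<open>t\<close> of the summands combine into
    the single shift \<open>s + t\<close>; the two infima are then taken one after the
    other.\<close>
  have *: "twist p w (u + v) \<le> (p (u + of_nat s * w) - real s * p w) +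
      (p (v + of_nat t * w) - real t * p w)" for s t
  proof -
    have "twist p w (u + v) \<le> p (u + v + of_nat (s + t) * w) - real (s + t) * p w"
      by (rule twist_le[OF uv])
    also have "p (u + v + of_nat (s + t) * w) = p ((u + of_nat s * w) + (v + of_nat t * w))"
      by (simp add: algebra_simps)
    also have "\<dots> \<le> p (u + of_nat s * w) + p (v + of_nat t * w)"
      using p tV u v by (simp add: sublinear_def)
    finally show ?thesis by (simp add: algebra_simps)
  qed
  have "twist p w (u + v) - twist p w v \<le> twist p w u"
  proof (rule twist_greatest)
    fix s
    have "twist p w (u + v) - (p (u + of_nat s * w) - real s * p w) \<le> twist p w v"
    proof (rule twist_greatest)
      fix t
      show "twist p w (u + v) - (p (u + of_nat s * w) - real s * p w) \<le>
          p (v + of_nat t * w) - real t * p w"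
        using *[of s t] by linarith
    qed
    then show "twist p w (u + v) - twist p w v \<le> p (u + of_nat s * w) - real s * p w" by simp
  qed
  then show "twist p w (u + v) \<le> twist p w u + twist p w v" by simp
next
  fix v and n :: nat assume v: "v \<in> V" and n: "n \<ge> 1"
  show "real n * twist p w v \<le> twist p w (of_nat n * v)"
  proof (rule twist_greatest)
    fix t
    have vt: "v + of_nat t * w \<in> V"
      using v V additive_subgroup_of_nat[OF V w] by (simp add: additive_subgroup_def)
    have nvt: "of_nat n * v + of_nat t * w \<in> V"
      using v V additive_subgroup_of_nat[OF V] w by (simp add: additive_subgroup_def)
    \<comment> \<open>Over the reals one would shift \<open>v\<close> by a fraction
      \<open>t / n\<close>. With integer shifts \<open>v\<close> is shifted by \<open>t\<close>,
      which after multiplication by \<open>n\<close> is too far by \<open>(n - 1) * t\<close>;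
      subadditivity and exact homogeneity at \<open>w\<close> remove the excess.\<close>
    have nt: "n * t = (n - 1) * t + t" using n by (cases n) auto
    have "real n * twist p w v \<le> real n * (p (v + of_nat t * w) - real t * p w)"
      using twist_le[OF v] by (intro mult_left_mono) auto
    also have "\<dots> = p (of_nat n * (v + of_nat t * w)) - real (n * t) * p w"
      using sublinear_of_nat[OF V p vt] by (simp add: algebra_simps)
    also have "of_nat n * (v + of_nat t * w) =
        (of_nat n * v + of_nat t * w) + of_nat ((n - 1) * t) * w"
      using arg_cong[OF nt, of "of_nat :: nat \<Rightarrow> 'v"] by (simp add: ring_distribs flip: mult.assoc)
    also have "p \<dots> \<le> p (of_nat n * v + of_nat t * w) + p (of_nat ((n - 1) * t) * w)"
      using p nvt additive_subgroup_of_nat[OF V w] unfolding sublinear_def by blast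
    also have "p (of_nat ((n - 1) * t) * w) = real ((n - 1) * t) * p w"
      by (rule sublinear_of_nat[OF V p w])
    finally show "real n * twist p w v \<le> p (of_nat n * v + of_nat t * w) - real t * p w"
      unfolding nt of_nat_add distrib_right by linarith
  qed
qed

end

text \<open>Zorn's lemma in the reversed pointwise order, where a chain is bounded by its pointwise
  infimum. Candidates are extensional on \<open>V\<close>, so that agreement on \<open>V\<close> is
  equality, as antisymmetry demands.\<close>

lemma ex_minimal_sublinear:
  assumes V: "additive_subgroup V" and p: "sublinear V p"
  obtains m where "sublinear V m" and "\<And>v. v \<in> V \<Longrightarrow> m v \<le> p v"
    and "\<And>q v. sublinear V q \<Longrightarrow> (\<And>u. u \<in> V \<Longrightarrow> q u \<le> m u) \<Longrightarrow> v \<in> V \<Longrightarrow> q v = m v"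
proof -
  define A where "A = {q \<in> extensional V. sublinear V q \<and> (\<forall>v\<in>V. q v \<le> p v)}"
  define R where "R = (\<lambda>q r. \<forall>v\<in>V. r v \<le> (q v :: real))"
  have sub_restrict: "sublinear V (restrict q V)" if "sublinear V q" for q
    using that V additive_subgroup_of_nat[OF V] unfolding sublinear_def additive_subgroup_def by auto
  have "\<exists>m\<in>A. \<forall>q\<in>A. R m q \<longrightarrow> q = m"
  proof (rule predicate_Zorn)
    show "partial_order_on A (relation_of R A)"
    proof (rule partial_order_on_relation_ofI)
      show "q = r" if "q \<in> A" "r \<in> A" "R q r" "R r q" for q r
        using that by (intro extensionalityI[of _ V]) (simp_all add: A_def R_def order.antisym)
      show "R a c" if "R a b" "R b c" for a b c
        using that unfolding R_def by (meson order.trans)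
    qed (simp add: R_def)
  next
    fix C assume C: "C \<in> Chains (relation_of R A)"
    then have CA: "q \<in> A" if "q \<in> C" for q
      using that by (auto simp: Chains_def relation_of_def)
    have lin: "(\<forall>v\<in>V. q v \<le> r v) \<or> (\<forall>v\<in>V. r v \<le> q v)" if "q \<in> C" "r \<in> C" for q r
      using C that by (fastforce simp: Chains_def relation_of_def R_def)
    show "\<exists>u\<in>A. \<forall>a\<in>C. R a u"
    proof (cases "C = {}")
      case True
      have "restrict p V \<in> A" using p sub_restrict by (auto simp: A_def)
      then show ?thesis using True by blast
    next
      case False
      define i where "i = (\<lambda>v. INF q\<in>C. q v)"
      have i_le: "i v \<le> q v" if "v \<in> V" "q \<in> C" for v q
        unfolding i_def
      proof (rule cINF_lower)
        \<comment> \<open>A bound common to all members of the chain: \<open>r v\<close> is at least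
          \<open>- r (- v)\<close>, and \<open>r\<close> lies below \<open>p\<close>.\<close>
        have "- p (- v) \<le> r v" if "r \<in> C" for r
        proof -
          have "sublinear V r" "r (- v) \<le> p (- v)"
            using CA[OF that] \<open>v \<in> V\<close> V by (auto simp: A_def additive_subgroup_def)
          then show ?thesis using sublinear_minus[OF V _ \<open>v \<in> V\<close>, of r] by linarith
        qed
        then show "bdd_below ((\<lambda>q. q v) ` C)" by (auto simp: bdd_below_def)
      qed (use that in auto)
      have i_greatest: "(\<And>q. q \<in> C \<Longrightarrow> c \<le> q v) \<Longrightarrow> c \<le> i v" for c v
        unfolding i_def using False by (intro cINF_greatest) auto
      have "sublinear V i"
        unfolding sublinear_def
      proof (intro conjI ballI allI impI)
        fix u v assume u: "u \<in> V" and v: "v \<in> V"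
        have uv: "u + v \<in> V" using u v V by (simp add: additive_subgroup_def)
        \<comment> \<open>The infima at \<open>u\<close> and \<open>v\<close> may be approached by
          different members; the chain is linear, so the smaller of \<open>q\<close> and
          \<open>r\<close> serves for both arguments.\<close>
        have *: "i (u + v) \<le> q u + r v" if qr: "q \<in> C" "r \<in> C" for q r
        proof -
          obtain s where s: "s \<in> C" "s u \<le> q u" "s v \<le> r v"
            using lin[OF qr] qr u v by blast
          have "i (u + v) \<le> s (u + v)" using i_le uv s by simp
          also have "\<dots> \<le> s u + s v" using CA[OF s(1)] u v by (simp add: A_def sublinear_def)
          finally show ?thesis using s by linarith
        qed
        have "i (u + v) - i v \<le> i u"
        proof (rule i_greatest)
          fix q assume q: "q \<in> C"
          have "i (u + v) - q u \<le> i v"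
            using *[OF q] by (intro i_greatest) (simp add: algebra_simps)
          then show "i (u + v) - i v \<le> q u" by simp
        qed
        then show "i (u + v) \<le> i u + i v" by simp
      next
        fix v and n :: nat assume v: "v \<in> V" and n: "n \<ge> 1"
        show "real n * i v \<le> i (of_nat n * v)"
        proof (rule i_greatest)
          fix q assume q: "q \<in> C"
          have "real n * i v \<le> real n * q v" using i_le[OF v q] by (intro mult_left_mono) auto
          also have "\<dots> \<le> q (of_nat n * v)" using CA[OF q] v n by (simp add: A_def sublinear_def)
          finally show "real n * i v \<le> q (of_nat n * v)" .
        qed
      qed
      then have "restrict i V \<in> A"
        using sub_restrict False i_le CA by (fastforce simp: A_def intro: order.trans)
      moreover have "R q (restrict i V)" if "q \<in> C" for q
        using i_le that by (simp add: R_def)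
      ultimately show ?thesis by blast
    qed
  qed
  then obtain m where m: "m \<in> A" "\<And>q. q \<in> A \<Longrightarrow> R m q \<Longrightarrow> q = m" by blast
  show thesis
  proof
    show "sublinear V m" "\<And>v. v \<in> V \<Longrightarrow> m v \<le> p v" using m(1) by (auto simp: A_def)
    fix q v assume q: "sublinear V q" "\<And>u. u \<in> V \<Longrightarrow> q u \<le> m u" and v: "v \<in> V"
    have "restrict q V \<in> A"
      using sub_restrict[OF q(1)] q(2) m(1) by (fastforce simp: A_def)
    moreover have "R m (restrict q V)" using q(2) by (simp add: R_def)
    ultimately have "restrict q V = m" by (rule m(2))
    then show "q v = m v" using v by (metis restrict_apply')
  qed
qed

text \<open>Take \<open>m\<close> minimal below \<open>twist p w\<close>. For every
  \<open>v\<close>, \<open>twist m v\<close> is sublinear and below \<open>m\<close>, hence equal to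
  it, and its value at \<open>- v\<close> shows that \<open>m\<close> is odd. Subadditivity at the
  negatives then becomes superadditivity. Starting from the twist forces
  \<open>m (- w) \<le> - p w\<close>, which gives equality at \<open>w\<close>.\<close>

lemma ex_additive_dominated:
  assumes V: "additive_subgroup V" and p: "sublinear V p" and w: "w \<in> V"
  obtains m where "\<And>u v. u \<in> V \<Longrightarrow> v \<in> V \<Longrightarrow> m (u + v) = m u + m v"
    and "\<And>v. v \<in> V \<Longrightarrow> m v \<le> p v" and "m w = p w"
proof -
  obtain m where m: "sublinear V m" and le: "\<And>v. v \<in> V \<Longrightarrow> m v \<le> twist p w v"
    and min: "\<And>q v. sublinear V q \<Longrightarrow> (\<And>u. u \<in> V \<Longrightarrow> q u \<le> m u) \<Longrightarrow> v \<in> V \<Longrightarrow> q v = m v"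
  proof (rule ex_minimal_sublinear[OF V sublinear_twist[OF V p w]])
    fix m
    assume "sublinear V m" "\<And>v. v \<in> V \<Longrightarrow> m v \<le> twist p w v"
      "\<And>q v. sublinear V q \<Longrightarrow> (\<And>u. u \<in> V \<Longrightarrow> q u \<le> m u) \<Longrightarrow> v \<in> V \<Longrightarrow> q v = m v"
    then show thesis by (rule that)
  qed
  have neg: "- v \<in> V" if "v \<in> V" for v using that V by (simp add: additive_subgroup_def)
  have odd: "m (- v) = - m v" if v: "v \<in> V" for v
  proof (rule antisym)
    have "m (- v) = twist m v (- v)"
      using min[OF sublinear_twist[OF V m v] twist_le_self[OF V m v] neg[OF v]] by simp
    then show "m (- v) \<le> - m v" using twist_minus[OF V m v] by simp
    show "- m v \<le> m (- v)" using sublinear_minus[OF V m neg[OF v]] by simp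
  qed
  have sub: "m (u + v) \<le> m u + m v" if "u \<in> V" "v \<in> V" for u v
    using that m by (simp add: sublinear_def)
  show thesis
  proof
    fix u v assume uv: "u \<in> V" "v \<in> V"
    have "m (- u + - v) \<le> m (- u) + m (- v)" using sub neg uv by blast
    moreover have "m (- u + - v) = - m (u + v)"
      using odd[of "u + v"] uv V by (simp add: additive_subgroup_def)
    ultimately have "m u + m v \<le> m (u + v)" using odd uv by simp
    then show "m (u + v) = m u + m v" using sub[OF uv] by simp
  next
    fix v assume "v \<in> V"
    then show "m v \<le> p v" using le twist_le_self[OF V p w] order.trans by blast
  next
    have "m (- w) \<le> - p w" using le[OF neg[OF w]] twist_minus[OF V p w] by linarith
    then have "p w \<le> m w" using odd[OF w] by simp
    moreover have "m w \<le> p w" using le[OF w] twist_le_self[OF V p w w] by linarith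
    ultimately show "m w = p w" by simp
  qed
qed

section \<open>Upper probabilities and covers\<close>

text \<open>A list rather than a set of sets, so that repetitions count; repeating a cover is how
  denominators are cleared below.\<close>

definition cover_count :: "'a set list \<Rightarrow> 'a \<Rightarrow> nat" where
  "cover_count Us x = length (filter (\<lambda>U. x \<in> U) Us)"

lemma cover_count_append [simp]:
  "cover_count (Us @ Vs) x = cover_count Us x + cover_count Vs x"
  by (simp add: cover_count_def)

lemma cover_count_concat_replicate [simp]:
  "cover_count (concat (replicate n Us)) x = n * cover_count Us x"
  by (induction n) (auto simp: cover_count_def)

lemma sum_list_concat_replicate [simp]:
  "sum_list (map f (concat (replicate n xs))) = real n * sum_list (map f xs)"
  by (induction n) (auto simp: algebra_simps)

text \<open>The case \<open>n = 0\<close>, in which \<open>U\<close> plays no role, corresponds to the rule (C2).\<close>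

definition cover_condition :: "'a uspace \<Rightarrow> ('a set \<Rightarrow> real) \<Rightarrow> bool" where
  "cover_condition A g \<longleftrightarrow> (\<forall>n k U Us. U \<in> meas A \<longrightarrow> set Us \<subseteq> meas A \<longrightarrow>
     (\<forall>x\<in>points A. (if x \<in> U then n else 0) + k \<le> cover_count Us x) \<longrightarrow>
     real n * g U + real k \<le> sum_list (map g Us))"

text \<open>Suppose \<open>n * f + k\<close> is dominated by the sum of the indicators of the
  \<open>Us\<close>. A monotone sublinear functional that extends \<open>g\<close> and respects
  added constants must then send \<open>f\<close> to at most the quotient shown. The infimum of
  these bounds is the extension used here.\<close>

definition cover_values :: "'a uspace \<Rightarrow> ('a set \<Rightarrow> real) \<Rightarrow> ('a \<Rightarrow> int) \<Rightarrow> real set" where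
  "cover_values A g f = {(sum_list (map g Us) - real k) / real n | n k Us.
     n \<ge> 1 \<and> set Us \<subseteq> meas A \<and> (\<forall>x\<in>points A. int n * f x + int k \<le> int (cover_count Us x))}"

definition bounded_funs :: "'a uspace \<Rightarrow> ('a \<Rightarrow> int) set" where
  "bounded_funs A = {f. \<exists>c::nat. \<forall>x\<in>points A. \<bar>f x\<bar> \<le> int c}"

lemma additive_subgroup_bounded_funs: "additive_subgroup (bounded_funs A)"
  unfolding additive_subgroup_def bounded_funs_def
proof (intro conjI ballI; clarsimp)
  fix u v :: "'a \<Rightarrow> int" and c d :: nat
  assume "\<forall>x\<in>points A. \<bar>u x\<bar> \<le> int c" "\<forall>x\<in>points A. \<bar>v x\<bar> \<le> int d"
  then have "\<forall>x\<in>points A. \<bar>u x + v x\<bar> \<le> int (c + d)" by fastforce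
  then show "\<exists>c. \<forall>x\<in>points A. \<bar>u x + v x\<bar> \<le> int c" by blast
qed

lemma of_nat_fun_mult: "((of_nat n :: 'a \<Rightarrow> int) * f) x = int n * f x"
  by (induction n) (auto simp: algebra_simps)

context
  fixes A :: "'a uspace" and g :: "'a set \<Rightarrow> real"
  assumes A: "uncertainty_space A" and g: "cover_condition A g" and nonneg: "\<And>U. U \<in> meas A \<Longrightarrow> 0 \<le> g U"
begin

lemma cover_values_lower:
  assumes f: "\<And>x. x \<in> points A \<Longrightarrow> - int c \<le> f x" and r: "r \<in> cover_values A g f"
  shows "- real c \<le> r"
proof -
  obtain n k Us where r: "r = (sum_list (map g Us) - real k) / real n" and n: "n \<ge> 1"
    and Us: "set Us \<subseteq> meas A" and cov: "\<And>x. x \<in> points A \<Longrightarrow> int n * f x + int k \<le> int (cover_count Us x)"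
    using r by (auto simp: cover_values_def)
  have "real k - real n * real c \<le> sum_list (map g Us)"
  \<comment> \<open>The lower bound of \<open>f\<close> turns the cover into one of multiplicity
    \<open>k - n * c\<close>, to which the cover condition with \<open>n = 0\<close> applies. The
    subtraction is in \<open>nat\<close>; where it would be negative, nonnegativity of
    \<open>g\<close> suffices.\<close>
  proof (cases "n * c \<le> k")
    case True
    have "k - n * c \<le> cover_count Us x" if x: "x \<in> points A" for x
    proof -
      have "int n * (- int c) \<le> int n * f x" using f[OF x] by (intro mult_left_mono) auto
      then have "int k - int n * int c \<le> int (cover_count Us x)" using cov[OF x] by simp
      then show ?thesis by (simp add: nat_le_iff flip: of_nat_mult)
    qed
    moreover have "{} \<in> meas A" using A by (simp add: uncertainty_space_def algebra_iff_Un)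
    ultimately have "real 0 * g {} + real (k - n * c) \<le> sum_list (map g Us)"
      using g[unfolded cover_condition_def, rule_format, of "{}" Us 0 "k - n * c"] Us by simp
    then show ?thesis using True by (simp add: of_nat_diff)
  next
    case False
    then have "k < n * c" by simp
    then have "real k < real (n * c)" by (simp only: of_nat_less_iff)
    then have "real k - real n * real c < 0" by simp
    moreover have "0 \<le> sum_list (map g Us)" using Us nonneg by (intro sum_list_nonneg) auto
    ultimately show ?thesis by linarith
  qed
  then show ?thesis using n by (simp add: r field_simps)
qed

lemma bdd_below_cover_values: "f \<in> bounded_funs A \<Longrightarrow> bdd_below (cover_values A g f)"
proof -
  assume "f \<in> bounded_funs A"
  then obtain c :: nat where "\<forall>x\<in>points A. \<bar>f x\<bar> \<le> int c"
    by (auto simp: bounded_funs_def)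
  then have "- int c \<le> f x" if "x \<in> points A" for x using that by fastforce
  then show ?thesis using cover_values_lower by (meson bdd_below.I)
qed

lemma cover_values_nonempty:
  assumes "f \<in> bounded_funs A"
  shows "cover_values A g f \<noteq> {}"
proof -
  obtain c :: nat where c: "\<And>x. x \<in> points A \<Longrightarrow> f x \<le> int c"
    using assms by (auto simp: bounded_funs_def abs_le_iff)
  have "points A \<in> meas A" using A unfolding uncertainty_space_def algebra_iff_Un by (metis Diff_empty)
  \<comment> \<open>A function bounded by \<open>c\<close> is dominated by \<open>c\<close> copies
    of the whole space.\<close>
  then have "(sum_list (map g (replicate c (points A))) - real 0) / real 1 \<in> cover_values A g f"
    unfolding cover_values_def using c
    by (intro CollectI exI[of _ 1] exI[of _ 0] exI[of _ "replicate c (points A)"])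
       (auto simp: cover_count_def set_replicate_conv_if)
  then show ?thesis by blast
qed

lemma sublinear_Inf_cover_values: "sublinear (bounded_funs A) (\<lambda>f. Inf (cover_values A g f))"
  unfolding sublinear_def
proof (intro conjI ballI allI impI)
  fix u v assume u: "u \<in> bounded_funs A" and v: "v \<in> bounded_funs A"
  have uv: "u + v \<in> bounded_funs A"
    using u v additive_subgroup_bounded_funs[of A] by (simp add: additive_subgroup_def)
  have *: "Inf (cover_values A g (u + v)) \<le> r + s"
    if "r \<in> cover_values A g u" "s \<in> cover_values A g v" for r s
  proof -
    obtain n k Us where r: "r = (sum_list (map g Us) - real k) / real n" "n \<ge> 1"
      "set Us \<subseteq> meas A" "\<And>x. x \<in> points A \<Longrightarrow> int n * u x + int k \<le> int (cover_count Us x)"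
      using \<open>r \<in> _\<close> by (auto simp: cover_values_def)
    obtain n' k' Vs where s: "s = (sum_list (map g Vs) - real k') / real n'" "n' \<ge> 1"
      "set Vs \<subseteq> meas A" "\<And>x. x \<in> points A \<Longrightarrow> int n' * v x + int k' \<le> int (cover_count Vs x)"
      using \<open>s \<in> _\<close> by (auto simp: cover_values_def)
    \<comment> \<open>Common denominator \<open>n * n'\<close>: each cover is repeated as often as
      the other denominator says.\<close>
    let ?W = "concat (replicate n' Us) @ concat (replicate n Vs)"
    have "int (n * n') * (u + v) x + int (n' * k + n * k') \<le> int (cover_count ?W x)"
      if x: "x \<in> points A" for x
    proof -
      have "int n' * (int n * u x + int k) \<le> int n' * int (cover_count Us x)"
        "int n * (int n' * v x + int k') \<le> int n * int (cover_count Vs x)"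
        using r(4)[OF x] s(4)[OF x] by (auto intro!: mult_left_mono)
      then show ?thesis by (simp add: algebra_simps)
    qed
    then have "(sum_list (map g ?W) - real (n' * k + n * k')) / real (n * n') \<in> cover_values A g (u + v)"
      unfolding cover_values_def using r s
      by (intro CollectI exI[of _ "n * n'"] exI[of _ "n' * k + n * k'"] exI[of _ ?W]) auto
    moreover have "(sum_list (map g ?W) - real (n' * k + n * k')) / real (n * n') = r + s"
      using r(2) s(2) by (simp add: r(1) s(1) sum_list_append field_simps)
    ultimately show ?thesis
      using cInf_lower[OF _ bdd_below_cover_values[OF uv]] by simp
  qed
  have "Inf (cover_values A g (u + v)) - Inf (cover_values A g v) \<le> Inf (cover_values A g u)"
  proof (rule cInf_greatest[OF cover_values_nonempty[OF u]])
    fix r assume r: "r \<in> cover_values A g u"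
    have "Inf (cover_values A g (u + v)) - r \<le> Inf (cover_values A g v)"
      using *[OF r] by (intro cInf_greatest[OF cover_values_nonempty[OF v]]) (simp add: algebra_simps)
    then show "Inf (cover_values A g (u + v)) - Inf (cover_values A g v) \<le> r" by simp
  qed
  then show "Inf (cover_values A g (u + v)) \<le> Inf (cover_values A g u) + Inf (cover_values A g v)"
    by simp
next
  fix v and n :: nat assume v: "v \<in> bounded_funs A" and n: "n \<ge> 1"
  have nv: "of_nat n * v \<in> bounded_funs A"
    by (rule additive_subgroup_of_nat[OF additive_subgroup_bounded_funs v])
  show "real n * Inf (cover_values A g v) \<le> Inf (cover_values A g (of_nat n * v))"
  proof (rule cInf_greatest[OF cover_values_nonempty[OF nv]])
    fix r assume "r \<in> cover_values A g (of_nat n * v)"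
    then obtain m k Us where r: "r = (sum_list (map g Us) - real k) / real m" "m \<ge> 1"
      "set Us \<subseteq> meas A" "\<And>x. x \<in> points A \<Longrightarrow> int m * (int n * v x) + int k \<le> int (cover_count Us x)"
      unfolding cover_values_def of_nat_fun_mult by auto
    \<comment> \<open>A cover for the multiple \<open>n\<close> of \<open>v\<close> with denominator
      \<open>m\<close> is also a cover for \<open>v\<close> with denominator
      \<open>m * n\<close>.\<close>
    have "r / real n \<in> cover_values A g v"
      unfolding cover_values_def using r n
      by (intro CollectI exI[of _ "m * n"] exI[of _ k] exI[of _ Us]) (auto simp: mult.assoc)
    then have "Inf (cover_values A g v) \<le> r / real n"
      using bdd_below_cover_values[OF v] by (rule cInf_lower)
    then show "real n * Inf (cover_values A g v) \<le> r" using n by (simp add: field_simps)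
  qed
qed

lemma indicator_bounded_funs: "(indicator U :: _ \<Rightarrow> int) \<in> bounded_funs A"
  unfolding bounded_funs_def by (auto intro!: exI[of _ 1] simp: indicator_def)

text \<open>The cover consisting of \<open>U\<close> alone gives one inequality; the other is the
  cover condition itself. So the functional really extends \<open>g\<close>.\<close>

lemma Inf_cover_values_indicator:
  assumes U: "U \<in> meas A"
  shows "Inf (cover_values A g (indicator U)) = g U"
proof (rule antisym)
  have "(sum_list (map g [U]) - real 0) / real 1 \<in> cover_values A g (indicator U)"
    unfolding cover_values_def using U
    by (intro CollectI exI[of _ 1] exI[of _ 0] exI[of _ "[U]"]) (auto simp: cover_count_def indicator_def)
  then show "Inf (cover_values A g (indicator U)) \<le> g U"
    using cInf_lower[OF _ bdd_below_cover_values[OF indicator_bounded_funs]] by fastforce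
  show "g U \<le> Inf (cover_values A g (indicator U))"
  proof (rule cInf_greatest[OF cover_values_nonempty[OF indicator_bounded_funs]])
    fix r assume "r \<in> cover_values A g (indicator U)"
    then obtain n k Us where r: "r = (sum_list (map g Us) - real k) / real n" "n \<ge> 1"
      "set Us \<subseteq> meas A" "\<And>x. x \<in> points A \<Longrightarrow> int n * indicator U x + int k \<le> int (cover_count Us x)"
      by (auto simp: cover_values_def)
    have "(if x \<in> U then n else 0) + k \<le> cover_count Us x" if "x \<in> points A" for x
      using r(4)[OF that] by (auto simp: indicator_def split: if_splits)
    then have "real n * g U + real k \<le> sum_list (map g Us)"
      using g U r(3) by (simp add: cover_condition_def)
    then show "g U \<le> r" using r(2) by (simp add: r(1) field_simps)
  qed
qed

lemma ex_prob_below: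
  assumes le1: "g (points A) \<le> 1" and W: "W \<in> meas A"
  obtains \<mu> where "\<mu> \<in> probs A" and "\<And>U. U \<in> meas A \<Longrightarrow> \<mu> U \<le> g U" and "\<mu> W = g W"
proof -
  let ?V = "bounded_funs A" and ?p = "\<lambda>f. Inf (cover_values A g f)"
  obtain m where add: "\<And>u v. u \<in> ?V \<Longrightarrow> v \<in> ?V \<Longrightarrow> m (u + v) = m u + m v"
    and le: "\<And>v. v \<in> ?V \<Longrightarrow> m v \<le> ?p v" and eq: "m (indicator W) = ?p (indicator W)"
    using ex_additive_dominated[OF additive_subgroup_bounded_funs sublinear_Inf_cover_values
        indicator_bounded_funs] by metis
  have neg: "- v \<in> ?V" if "v \<in> ?V" for v
    using that additive_subgroup_bounded_funs[of A] by (simp add: additive_subgroup_def)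
  have zero: "m 0 = 0"
    using add[of 0 0] additive_subgroup_bounded_funs[of A] by (simp add: additive_subgroup_def)
  have minus: "m (- v) = - m v" if "v \<in> ?V" for v
    using add[OF that neg[OF that]] zero by simp
  \<comment> \<open>The empty cover, with \<open>n = 1\<close>. Used with \<open>k = 0\<close> on
    minus an indicator it gives positivity of the measure, and with \<open>k = 1\<close> on minus
    the indicator of the whole space it gives total mass at least one.\<close>
  have p_le: "?p v \<le> - real k" if "v \<in> ?V" "\<And>x. x \<in> points A \<Longrightarrow> v x \<le> - int k" for v k
  proof -
    have "(sum_list (map g []) - real k) / real 1 \<in> cover_values A g v"
      unfolding cover_values_def using that(2)
      by (intro CollectI exI[of _ 1] exI[of _ k] exI[of _ "[]"]) (force simp: cover_count_def)
    then show ?thesis using cInf_lower[OF _ bdd_below_cover_values[OF that(1)]] by fastforce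
  qed
  have alg: "{} \<in> meas A" "points A \<in> meas A" "\<And>U V. U \<in> meas A \<Longrightarrow> V \<in> meas A \<Longrightarrow> U \<union> V \<in> meas A"
    using A algebra.top unfolding uncertainty_space_def algebra_iff_Un by blast+
  define \<mu> where "\<mu> = (\<lambda>U\<in>meas A. m (indicator U))"
  have le_g: "\<mu> U \<le> g U" if "U \<in> meas A" for U
    using le[OF indicator_bounded_funs, of U] Inf_cover_values_indicator that by (simp add: \<mu>_def)
  have ge0: "0 \<le> m (indicator U)" for U
  proof -
    have "m (- indicator U) \<le> - real 0"
      by (rule order.trans[OF le p_le]; (intro neg indicator_bounded_funs)?) (simp add: indicator_def)
    then show ?thesis using minus[OF indicator_bounded_funs] by simp
  qed
  have union: "m (indicator (U \<union> V)) = m (indicator U) + m (indicator V)" if "U \<inter> V = {}" for U V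
  proof -
    have "indicator (U \<union> V) = (indicator U + indicator V :: 'a \<Rightarrow> int)"
      using that by (auto simp: indicator_def fun_eq_iff)
    then show ?thesis using add[OF indicator_bounded_funs indicator_bounded_funs] by simp
  qed
  have one: "m (indicator (points A)) = 1"
  proof (rule antisym)
    show "m (indicator (points A)) \<le> 1" using le_g[OF alg(2)] alg(2) le1 by (simp add: \<mu>_def)
    have "m (- indicator (points A)) \<le> - real 1"
      by (rule order.trans[OF le p_le]; (intro neg indicator_bounded_funs)?) (simp add: indicator_def)
    then show "1 \<le> m (indicator (points A))" using minus[OF indicator_bounded_funs] by simp
  qed
  have le1: "m (indicator U) \<le> 1" if U: "U \<in> meas A" for U
  proof -
    have "U \<union> (points A - U) = points A" using meas_subset[OF A U] by auto
    then show ?thesis using union[of U "points A - U"] one ge0[of "points A - U"] by auto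
  qed
  have empty: "m (indicator {}) = 0" using union[of "{}" "{}"] by simp
  show thesis
  proof
    show "\<mu> \<in> probs A"
      unfolding probs_def using alg ge0 le1 one empty union by (auto simp: \<mu>_def)
    show "\<mu> W = g W" using eq W Inf_cover_values_indicator by (simp add: \<mu>_def)
  qed (rule le_g)
qed

end

text \<open>With all probability measures below \<open>g\<close> as the witnessing set, each
  supremum is a maximum, since a measure touching \<open>g\<close> can be found for every single
  set.\<close>

theorem upper_probs_if_cover_condition:
  assumes A: "uncertainty_space A" and g: "g \<in> meas A \<rightarrow>\<^sub>E {0..1}" and cov: "cover_condition A g"
  shows "g \<in> upper_probs A"
proof -
  have nonneg: "\<And>U. U \<in> meas A \<Longrightarrow> 0 \<le> g U" using g by (auto simp: PiE_def Pi_def)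
  have pts: "points A \<in> meas A" using A unfolding uncertainty_space_def algebra_iff_Un by (metis Diff_empty)
  then have le1: "g (points A) \<le> 1" using g by (auto simp: PiE_def Pi_def)
  define P where "P = {\<mu> \<in> probs A. \<forall>U\<in>meas A. \<mu> U \<le> g U}"
  have *: "\<exists>\<mu>\<in>P. \<mu> U = g U" if U: "U \<in> meas A" for U
  proof (rule ex_prob_below[OF A cov nonneg le1 U])
    fix \<mu> assume "\<mu> \<in> probs A" "\<And>U. U \<in> meas A \<Longrightarrow> \<mu> U \<le> g U" "\<mu> U = g U"
    then show ?thesis unfolding P_def by blast
  qed
  have "g U = (SUP \<mu>\<in>P. \<mu> U)" if U: "U \<in> meas A" for U
  proof -
    obtain \<mu> where \<mu>: "\<mu> \<in> P" "\<mu> U = g U" using *[OF U] by blast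
    have upper: "\<nu> U \<le> g U" if "\<nu> \<in> P" for \<nu> using that U by (simp add: P_def)
    then have "bdd_above ((\<lambda>\<mu>. \<mu> U) ` P)" by (auto simp: bdd_above_def)
    then have "\<mu> U \<le> (SUP \<mu>\<in>P. \<mu> U)" using \<mu>(1) by (rule cSUP_upper2) simp
    moreover have "(SUP \<mu>\<in>P. \<mu> U) \<le> g U" using \<mu>(1) upper by (intro cSUP_least) auto
    ultimately show ?thesis using \<mu>(2) by simp
  qed
  moreover have "P \<noteq> {}" using *[OF pts] by blast
  moreover have "P \<subseteq> probs A" by (auto simp: P_def)
  ultimately have "\<exists>P\<subseteq>probs A. P \<noteq> {} \<and> (\<forall>U\<in>meas A. g U = (SUP \<mu>\<in>P. \<mu> U))"
    by (intro exI[of _ P] conjI ballI)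
  then show ?thesis using g by (simp add: upper_probs_def)
qed

section \<open>Ingredients of a functor\<close>

lemma Ing_self [simp]: "S \<in> Ing S"
  by (cases S) auto

lemma FId_in_Ing [simp]: "FId \<in> Ing S"
  by (induction S) auto

lemma Ing_FProdD: "FProd S1 S2 \<in> Ing T \<Longrightarrow> S1 \<in> Ing T \<and> S2 \<in> Ing T"
  by (induction T) auto

lemma Ing_FSumD: "FSum S1 S2 \<in> Ing T \<Longrightarrow> S1 \<in> Ing T \<and> S2 \<in> Ing T"
  by (induction T) auto

lemma Ing_FDeltaD: "FDelta S \<in> Ing T \<Longrightarrow> S \<in> Ing T"
  by (induction T) auto

lemma Ing_edge: "edge T \<kappa> S S' \<Longrightarrow> S \<in> Ing T \<Longrightarrow> S' \<in> Ing T"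
  by (auto elim!: edge.cases dest: Ing_FProdD Ing_FSumD)

lemma upp_functor_Ing: "upp_functor T \<Longrightarrow> S \<in> Ing T \<Longrightarrow> upp_functor S"
  by (induction T) auto

section \<open>Measurability in the spaces \<open>S X\<close>\<close>

lemma meas_closed:
  assumes "uncertainty_space A"
  shows "{} \<in> meas A" and "points A \<in> meas A"
    and "U \<in> meas A \<Longrightarrow> points A - U \<in> meas A"
    and "U \<in> meas A \<Longrightarrow> V \<in> meas A \<Longrightarrow> U \<union> V \<in> meas A"
    and "U \<in> meas A \<Longrightarrow> V \<in> meas A \<Longrightarrow> U \<inter> V \<in> meas A"
proof -
  interpret algebra "points A" "meas A" using assms by (simp add: uncertainty_space_def)
  show "{} \<in> meas A" "points A \<in> meas A" "U \<in> meas A \<Longrightarrow> points A - U \<in> meas A"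
    "U \<in> meas A \<Longrightarrow> V \<in> meas A \<Longrightarrow> U \<union> V \<in> meas A"
    "U \<in> meas A \<Longrightarrow> V \<in> meas A \<Longrightarrow> U \<inter> V \<in> meas A" by auto
qed

lemma measurable_mapD:
  assumes "measurable_map A B f"
  shows "x \<in> points A \<Longrightarrow> f x \<in> points B" and "V \<in> meas B \<Longrightarrow> f -` V \<inter> points A \<in> meas A"
    and "uncertainty_space A" and "uncertainty_space B"
  using assms by (auto simp: measurable_map_def)

lemma uncertainty_app: "uncertainty_space X \<Longrightarrow> upp_functor S \<Longrightarrow> uncertainty_space (app S X)"
  using app_coded by blast

lemma enc_inj_app:
  "uncertainty_space X \<Longrightarrow> upp_functor S \<Longrightarrow> inj_on (enc (app S X)) (upper_probs (app S X))"
  using app_coded enc_inj by blast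

lemma points_app:
  "points (app FId X) = VId ` points X"
  "points (app (FConst M) X) = VConst ` points M"
  "points (app (FProd S1 S2) X) = {VPair v w | v w. v \<in> points (app S1 X) \<and> w \<in> points (app S2 X)}"
  "points (app (FSum S1 S2) X) = VInl ` points (app S1 X) \<union> VInr ` points (app S2 X)"
  "points (app (FDelta S) X) = enc (app S X) ` upper_probs (app S X)"
  by (force simp: image_space_def prod_space_def sum_space_def Delta_space_def generated_space_def)+

lemma meas_app_FId: "meas (app FId X) = (`) VId ` meas X"
  and meas_app_FConst: "meas (app (FConst M) X) = (`) VConst ` meas M"
  by (auto simp: image_space_def)

lemma hull_base: "U \<in> G \<Longrightarrow> U \<in> algebra \<Omega> hull G"
  by (rule hull_inc)

lemma meas_app_FProd:
  assumes "U \<in> meas (app S1 X)" and "V \<in> meas (app S2 X)"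
  shows "{VPair v w | v w. v \<in> U \<and> w \<in> V} \<in> meas (app (FProd S1 S2) X)"
proof -
  have "{VPair v w | v w. v \<in> U \<and> w \<in> V} = (\<lambda>(v, w). VPair v w) ` (U \<times> V)" by force
  then show ?thesis
    using assms by (auto simp: image_space_def prod_space_def generated_space_def intro!: imageI hull_base)
qed

lemma meas_app_VInl:
  assumes "U \<in> meas (app S1 X)"
  shows "VInl ` U \<in> meas (app (FSum S1 S2) X)"
proof -
  have "VInl ` U = case_sum VInl VInr ` Inl ` U" by (simp add: image_image)
  then show ?thesis
    using assms by (auto simp: image_space_def sum_space_def generated_space_def intro!: imageI hull_base)
qed

lemma meas_app_VInr:
  assumes "U \<in> meas (app S2 X)"
  shows "VInr ` U \<in> meas (app (FSum S1 S2) X)"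
proof -
  have "VInr ` U = case_sum VInl VInr ` Inr ` U" by (simp add: image_image)
  then show ?thesis
    using assms by (auto simp: image_space_def sum_space_def generated_space_def intro!: imageI hull_base)
qed

lemma meas_app_beta:
  "p \<in> {0..1} \<Longrightarrow> q \<in> {0..1} \<Longrightarrow> U \<in> meas (app S X) \<Longrightarrow>
    enc (app S X) ` beta (app S X) p q U \<in> meas (app (FDelta S) X)"
  by (auto simp: image_space_def Delta_space_def generated_space_def intro!: imageI hull_base)

text \<open>Measurability is tested on generators. Since sets of the target are images under
  \<open>e\<close>, the complement step needs injectivity of \<open>e\<close>.\<close>

lemma measurable_into_image_generated:
  assumes A: "uncertainty_space A" and e: "inj_on e \<Omega>" and G: "G \<subseteq> Pow \<Omega>"
    and B: "B = image_space e (generated_space \<Omega> G)"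
    and f: "\<And>x. x \<in> points A \<Longrightarrow> f x \<in> e ` \<Omega>"
    and base: "\<And>U. U \<in> G \<Longrightarrow> {x \<in> points A. f x \<in> e ` U} \<in> meas A"
  shows "measurable_map A B f"
proof -
  have "{x \<in> points A. f x \<in> e ` U} \<in> meas A" if "U \<in> algebra \<Omega> hull G" for U
    using that G
  proof (induction rule: hull_algebra_induct)
    case (compl U)
    have "f x \<in> e ` (\<Omega> - U) \<longleftrightarrow> f x \<notin> e ` U" if "x \<in> points A" for x
      using f[OF that] e compl(1) by (subst inj_on_image_set_diff[OF e]) auto
    then have "{x \<in> points A. f x \<in> e ` (\<Omega> - U)} = points A - {x \<in> points A. f x \<in> e ` U}" by auto
    then show ?case using compl(2) meas_closed(3)[OF A] by simp
  next
    case (union U V)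
    have "{x \<in> points A. f x \<in> e ` (U \<union> V)} = {x \<in> points A. f x \<in> e ` U} \<union> {x \<in> points A. f x \<in> e ` V}"
      by auto
    then show ?case using union meas_closed(4)[OF A] by simp
  qed (use base meas_closed(1)[OF A] in auto)
  moreover have "f -` W \<inter> points A = {x \<in> points A. f x \<in> W}" for W by auto
  ultimately show ?thesis
    using f A uncertainty_image_space[OF uncertainty_generated_space[OF G], of e] e
    unfolding measurable_map_def B by (auto simp: image_space_def generated_space_def)
qed

lemma measurable_into_FProd:
  assumes A: "uncertainty_space A" and X: "uncertainty_space X" and S: "upp_functor S1" "upp_functor S2"
    and f: "\<And>x. x \<in> points A \<Longrightarrow> f x \<in> points (app (FProd S1 S2) X)"
    and 1: "\<And>U. U \<in> meas (app S1 X) \<Longrightarrow> {x \<in> points A. vfst (f x) \<in> U} \<in> meas A"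
    and 2: "\<And>U. U \<in> meas (app S2 X) \<Longrightarrow> {x \<in> points A. vsnd (f x) \<in> U} \<in> meas A"
  shows "measurable_map A (app (FProd S1 S2) X) f"
proof (rule measurable_into_image_generated[OF A])
  let ?\<Omega> = "points (app S1 X) \<times> points (app S2 X)"
  let ?G = "{U \<times> V | U V. U \<in> meas (app S1 X) \<and> V \<in> meas (app S2 X)}"
  show "inj_on (\<lambda>(v, w). VPair v w) ?\<Omega>" by (auto simp: inj_on_def)
  show "?G \<subseteq> Pow ?\<Omega>" using meas_subset uncertainty_app[OF X] S by fastforce
  show "app (FProd S1 S2) X = image_space (\<lambda>(v, w). VPair v w) (generated_space ?\<Omega> ?G)"
    by (simp add: prod_space_def)
  show "f x \<in> (\<lambda>(v, w). VPair v w) ` ?\<Omega>" if "x \<in> points A" for x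
    using f[OF that] unfolding points_app by force
  fix W assume "W \<in> ?G"
  then obtain U V where W: "W = U \<times> V" "U \<in> meas (app S1 X)" "V \<in> meas (app S2 X)" by blast
  have "f x \<in> (\<lambda>(v, w). VPair v w) ` W \<longleftrightarrow> vfst (f x) \<in> U \<and> vsnd (f x) \<in> V" if "x \<in> points A" for x
    using f[OF that] unfolding points_app W by force
  then have "{x \<in> points A. f x \<in> (\<lambda>(v, w). VPair v w) ` W} =
      {x \<in> points A. vfst (f x) \<in> U} \<inter> {x \<in> points A. vsnd (f x) \<in> V}" by blast
  then show "{x \<in> points A. f x \<in> (\<lambda>(v, w). VPair v w) ` W} \<in> meas A"
    using 1[OF W(2)] 2[OF W(3)] meas_closed(5)[OF A] by simp
qed

lemma measurable_into_FSum:
  assumes A: "uncertainty_space A" and X: "uncertainty_space X" and S: "upp_functor S1" "upp_functor S2"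
    and f: "\<And>x. x \<in> points A \<Longrightarrow> f x \<in> points (app (FSum S1 S2) X)"
    and 1: "\<And>U. U \<in> meas (app S1 X) \<Longrightarrow> {x \<in> points A. f x \<in> VInl ` U} \<in> meas A"
    and 2: "\<And>U. U \<in> meas (app S2 X) \<Longrightarrow> {x \<in> points A. f x \<in> VInr ` U} \<in> meas A"
  shows "measurable_map A (app (FSum S1 S2) X) f"
proof (rule measurable_into_image_generated[OF A])
  let ?\<Omega> = "points (app S1 X) <+> points (app S2 X)"
  let ?G = "{Inl ` U | U. U \<in> meas (app S1 X)} \<union> {Inr ` V | V. V \<in> meas (app S2 X)}"
  show "inj_on (case_sum VInl VInr) ?\<Omega>" by (auto simp: inj_on_def split: sum.splits)
  show "?G \<subseteq> Pow ?\<Omega>"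
    using meas_subset[OF uncertainty_app[OF X S(1)]] meas_subset[OF uncertainty_app[OF X S(2)]] by fastforce
  show "app (FSum S1 S2) X = image_space (case_sum VInl VInr) (generated_space ?\<Omega> ?G)"
    by (simp add: sum_space_def)
  show "f x \<in> case_sum VInl VInr ` ?\<Omega>" if "x \<in> points A" for x
    using f[OF that] unfolding points_app by (force simp: Plus_def)
  show "{x \<in> points A. f x \<in> case_sum VInl VInr ` W} \<in> meas A" if "W \<in> ?G" for W
    using that 1 2 by (auto simp: image_image)
qed

text \<open>Presenting \<open>f\<close> as encoded values of \<open>g\<close> lets the test be made
  on set functions instead of functions on codes.\<close>

lemma measurable_into_FDelta:
  assumes A: "uncertainty_space A" and X: "uncertainty_space X" and S: "upp_functor S"
    and f: "\<And>x. x \<in> points A \<Longrightarrow> f x = enc (app S X) (g x)"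
    and g: "\<And>x. x \<in> points A \<Longrightarrow> g x \<in> upper_probs (app S X)"
    and *: "\<And>p q U. p \<in> {0..1} \<Longrightarrow> q \<in> {0..1} \<Longrightarrow> U \<in> meas (app S X) \<Longrightarrow>
      {x \<in> points A. g x \<in> beta (app S X) p q U} \<in> meas A"
  shows "measurable_map A (app (FDelta S) X) f"
proof (rule measurable_into_image_generated[OF A])
  let ?e = "enc (app S X)"
  let ?\<Omega> = "upper_probs (app S X)"
  let ?G = "{beta (app S X) p q U | p q U. p \<in> {0..1} \<and> q \<in> {0..1} \<and> U \<in> meas (app S X)}"
  show inj: "inj_on ?e ?\<Omega>" by (rule enc_inj_app[OF X S])
  show "?G \<subseteq> Pow ?\<Omega>" by (auto simp: beta_def)
  show "app (FDelta S) X = image_space ?e (generated_space ?\<Omega> ?G)"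
    by (simp add: Delta_space_def)
  show "f x \<in> ?e ` ?\<Omega>" if "x \<in> points A" for x
    using f g that by simp
  fix W assume "W \<in> ?G"
  then obtain p q U where W: "W = beta (app S X) p q U" and pqU: "p \<in> {0..1}" "q \<in> {0..1}" "U \<in> meas (app S X)"
    by blast
  have "f x \<in> ?e ` W \<longleftrightarrow> g x \<in> W" if "x \<in> points A" for x
    using inj_on_image_mem_iff[OF inj g[OF that], of W] f[OF that] by (simp add: W beta_def)
  then have "{x \<in> points A. f x \<in> ?e ` W} = {x \<in> points A. g x \<in> W}" by blast
  then show "{x \<in> points A. f x \<in> ?e ` W} \<in> meas A" using *[OF pqU] by (simp add: W)
qed

section \<open>Push-forward of upper probabilities and the action of functors on maps\<close>

lemma Delta_map_probs:
  assumes f: "measurable_map A B f" and \<mu>: "\<mu> \<in> probs A"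
  shows "Delta_map A B f \<mu> \<in> probs B"
proof -
  note fD = measurable_mapD[OF f]
  have \<mu>D: "\<mu> {} = 0" "\<mu> (points A) = 1" "\<And>U. U \<in> meas A \<Longrightarrow> \<mu> U \<in> {0..1}"
    "\<And>U V. U \<in> meas A \<Longrightarrow> V \<in> meas A \<Longrightarrow> U \<inter> V = {} \<Longrightarrow> \<mu> (U \<union> V) = \<mu> U + \<mu> V"
    using \<mu> by (auto simp: probs_def PiE_def Pi_def)
  have "f -` points B \<inter> points A = points A" using fD(1) by auto
  moreover have "\<mu> (f -` (U \<union> V) \<inter> points A) = \<mu> (f -` U \<inter> points A) + \<mu> (f -` V \<inter> points A)"
    if "U \<in> meas B" "V \<in> meas B" "U \<inter> V = {}" for U V
  proof -
    have "\<mu> ((f -` U \<inter> points A) \<union> (f -` V \<inter> points A)) = \<mu> (f -` U \<inter> points A) + \<mu> (f -` V \<inter> points A)"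
      using that fD(2) by (intro \<mu>D(4)) auto
    then show ?thesis by (simp add: vimage_Un Int_Un_distrib2)
  qed
  ultimately show ?thesis
    using \<mu>D(1-3) fD(2) meas_closed[OF fD(4)] by (auto simp: probs_def Delta_map_def)
qed

lemma Delta_map_upper_probs:
  assumes f: "measurable_map A B f" and g: "g \<in> upper_probs A"
  shows "Delta_map A B f g \<in> upper_probs B"
proof -
  note fD = measurable_mapD[OF f]
  obtain P where P: "P \<subseteq> probs A" "P \<noteq> {}" "\<And>U. U \<in> meas A \<Longrightarrow> g U = (SUP \<mu>\<in>P. \<mu> U)"
    using g by (auto simp: upper_probs_def)
  let ?Q = "Delta_map A B f ` P"
  have "Delta_map A B f g V = (SUP \<mu>\<in>?Q. \<mu> V)" if "V \<in> meas B" for V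
    using that P(3)[OF fD(2)[OF that]] by (simp add: Delta_map_def image_image)
  moreover have "?Q \<subseteq> probs B" "?Q \<noteq> {}" using P Delta_map_probs[OF f] by auto
  moreover have "Delta_map A B f g \<in> meas B \<rightarrow>\<^sub>E {0..1}"
    using g fD(2) by (auto simp: upper_probs_def Delta_map_def PiE_def Pi_def)
  ultimately show ?thesis unfolding upper_probs_def by blast
qed

text \<open>Both thresholds transfer because preimages commute with complements relative to the
  points.\<close>

lemma Delta_map_beta_iff:
  assumes f: "measurable_map A B f" and g: "g \<in> upper_probs A" and V: "V \<in> meas B"
  shows "Delta_map A B f g \<in> beta B p q V \<longleftrightarrow> g \<in> beta A p q (f -` V \<inter> points A)"
proof -
  note fD = measurable_mapD[OF f]
  have "f -` (points B - V) \<inter> points A = points A - f -` V \<inter> points A" using fD(1) by auto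
  then show ?thesis
    using V g Delta_map_upper_probs[OF f g] meas_closed(3)[OF fD(4) V] by (auto simp: beta_def Delta_map_def)
qed

lemma fmap_FDelta_enc:
  assumes "uncertainty_space X" and "upp_functor S" and "g \<in> upper_probs (app S X)"
  shows "fmap (FDelta S) X Y f (enc (app S X) g) =
    enc (app S Y) (Delta_map (app S X) (app S Y) (fmap S X Y f) g)"
  using enc_inj_app[OF assms(1,2)] assms(3) by simp

lemma measurable_fmap:
  fixes S :: "'m pfun"
  assumes f: "measurable_map X Y f"
  shows "upp_functor S \<Longrightarrow> measurable_map (app S X) (app S Y) (fmap S X Y f)"
proof (induction S)
  case FId
  let ?F = "fmap (FId :: 'm pfun) X Y f"
  have "?F -` VId ` V \<inter> VId ` points X = VId ` (f -` V \<inter> points X)" for V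
    by auto
  then have "?F -` W \<inter> VId ` points X \<in> (`) VId ` meas X" if "W \<in> (`) VId ` meas Y" for W
    using that measurable_mapD(2)[OF f] by auto
  then show ?case
    using measurable_mapD(1,3,4)[OF f] uncertainty_app[of X FId] uncertainty_app[of Y FId]
    unfolding measurable_map_def meas_app_FId points_app by auto
next
  case (FConst M)
  have "fmap (FConst M) X Y f -` VConst ` V \<inter> VConst ` points M = VConst ` V" if "V \<in> meas M" for V
    using meas_subset[OF _ that] FConst by auto
  then have "fmap (FConst M) X Y f -` W \<inter> VConst ` points M \<in> (`) VConst ` meas M"
    if "W \<in> (`) VConst ` meas M" for W
    using that by auto
  then show ?case
    using measurable_mapD(3,4)[OF f] uncertainty_app[of X "FConst M"] uncertainty_app[of Y "FConst M"] FConst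
    unfolding measurable_map_def meas_app_FConst points_app by auto
next
  case (FProd S1 S2)
  then have S: "upp_functor S1" "upp_functor S2"
    and m: "measurable_map (app S1 X) (app S1 Y) (fmap S1 X Y f)"
      "measurable_map (app S2 X) (app S2 Y) (fmap S2 X Y f)" by auto
  note XY = measurable_mapD(3,4)[OF f]
  show ?case
  proof (rule measurable_into_FProd[OF uncertainty_app[OF XY(1) FProd.prems] XY(2) S])
    fix v assume "v \<in> points (app (FProd S1 S2) X)"
    then show "fmap (FProd S1 S2) X Y f v \<in> points (app (FProd S1 S2) Y)"
      using measurable_mapD(1)[OF m(1)] measurable_mapD(1)[OF m(2)] unfolding points_app by auto
  next
    fix U assume "U \<in> meas (app S1 Y)"
    then have "{VPair v w |v w. v \<in> fmap S1 X Y f -` U \<inter> points (app S1 X) \<and> w \<in> points (app S2 X)}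
        \<in> meas (app (FProd S1 S2) X)"
      using measurable_mapD[OF m(1)] meas_closed(2)[OF uncertainty_app[OF XY(1) S(2)]]
      by (intro meas_app_FProd)
    moreover have "{v \<in> points (app (FProd S1 S2) X). vfst (fmap (FProd S1 S2) X Y f v) \<in> U} =
        {VPair v w |v w. v \<in> fmap S1 X Y f -` U \<inter> points (app S1 X) \<and> w \<in> points (app S2 X)}"
      unfolding points_app by auto
    ultimately show "{v \<in> points (app (FProd S1 S2) X). vfst (fmap (FProd S1 S2) X Y f v) \<in> U}
        \<in> meas (app (FProd S1 S2) X)" by simp
  next
    fix U assume "U \<in> meas (app S2 Y)"
    then have "{VPair v w |v w. v \<in> points (app S1 X) \<and> w \<in> fmap S2 X Y f -` U \<inter> points (app S2 X)}
        \<in> meas (app (FProd S1 S2) X)"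
      using measurable_mapD[OF m(2)] meas_closed(2)[OF uncertainty_app[OF XY(1) S(1)]]
      by (intro meas_app_FProd)
    moreover have "{v \<in> points (app (FProd S1 S2) X). vsnd (fmap (FProd S1 S2) X Y f v) \<in> U} =
        {VPair v w |v w. v \<in> points (app S1 X) \<and> w \<in> fmap S2 X Y f -` U \<inter> points (app S2 X)}"
      unfolding points_app by auto
    ultimately show "{v \<in> points (app (FProd S1 S2) X). vsnd (fmap (FProd S1 S2) X Y f v) \<in> U}
        \<in> meas (app (FProd S1 S2) X)" by simp
  qed
next
  case (FSum S1 S2)
  then have S: "upp_functor S1" "upp_functor S2"
    and m: "measurable_map (app S1 X) (app S1 Y) (fmap S1 X Y f)"
      "measurable_map (app S2 X) (app S2 Y) (fmap S2 X Y f)" by auto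
  note XY = measurable_mapD(3,4)[OF f]
  show ?case
  proof (rule measurable_into_FSum[OF uncertainty_app[OF XY(1) FSum.prems] XY(2) S])
    fix v assume "v \<in> points (app (FSum S1 S2) X)"
    then show "fmap (FSum S1 S2) X Y f v \<in> points (app (FSum S1 S2) Y)"
      using measurable_mapD(1)[OF m(1)] measurable_mapD(1)[OF m(2)] unfolding points_app by auto
  next
    fix U assume "U \<in> meas (app S1 Y)"
    then have "VInl ` (fmap S1 X Y f -` U \<inter> points (app S1 X)) \<in> meas (app (FSum S1 S2) X)"
      using measurable_mapD[OF m(1)] by (intro meas_app_VInl)
    moreover have "{v \<in> points (app (FSum S1 S2) X). fmap (FSum S1 S2) X Y f v \<in> VInl ` U} =
        VInl ` (fmap S1 X Y f -` U \<inter> points (app S1 X))"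
      unfolding points_app by auto
    ultimately show "{v \<in> points (app (FSum S1 S2) X). fmap (FSum S1 S2) X Y f v \<in> VInl ` U}
        \<in> meas (app (FSum S1 S2) X)" by simp
  next
    fix U assume "U \<in> meas (app S2 Y)"
    then have "VInr ` (fmap S2 X Y f -` U \<inter> points (app S2 X)) \<in> meas (app (FSum S1 S2) X)"
      using measurable_mapD[OF m(2)] by (intro meas_app_VInr)
    moreover have "{v \<in> points (app (FSum S1 S2) X). fmap (FSum S1 S2) X Y f v \<in> VInr ` U} =
        VInr ` (fmap S2 X Y f -` U \<inter> points (app S2 X))"
      unfolding points_app by auto
    ultimately show "{v \<in> points (app (FSum S1 S2) X). fmap (FSum S1 S2) X Y f v \<in> VInr ` U}
        \<in> meas (app (FSum S1 S2) X)" by simp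
  qed
next
  case (FDelta S)
  then have S: "upp_functor S" and m: "measurable_map (app S X) (app S Y) (fmap S X Y f)" by auto
  note XY = measurable_mapD(3,4)[OF f]
  let ?i = "inv_into (upper_probs (app S X)) (enc (app S X))"
  have i: "?i v \<in> upper_probs (app S X)" "enc (app S X) (?i v) = v"
    if "v \<in> points (app (FDelta S) X)" for v
    using that inv_into_into f_inv_into_f unfolding points_app by metis+
  show ?case
  proof (rule measurable_into_FDelta[OF uncertainty_app[OF XY(1) FDelta.prems] XY(2) S])
    fix v assume "v \<in> points (app (FDelta S) X)"
    then show "Delta_map (app S X) (app S Y) (fmap S X Y f) (?i v) \<in> upper_probs (app S Y)"
      using i by (intro Delta_map_upper_probs[OF m])
    show "fmap (FDelta S) X Y f v = enc (app S Y) (Delta_map (app S X) (app S Y) (fmap S X Y f) (?i v))"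
      by simp
  next
    fix p q :: real and U assume pq: "p \<in> {0..1}" "q \<in> {0..1}" and U: "U \<in> meas (app S Y)"
    \<comment> \<open>The preimage of a generator is, after encoding, the generator with the same
      thresholds for the preimage of \<open>U\<close>, which is measurable by induction.\<close>
    let ?W = "beta (app S X) p q (fmap S X Y f -` U \<inter> points (app S X))"
    have "v \<in> enc (app S X) ` ?W \<longleftrightarrow> ?i v \<in> ?W" if "v \<in> points (app (FDelta S) X)" for v
      using inj_on_image_mem_iff[OF enc_inj_app[OF XY(1) S] i(1)[OF that], of ?W] i(2)[OF that]
      by (simp add: beta_def)
    moreover have "enc (app S X) ` ?W \<subseteq> points (app (FDelta S) X)"
      unfolding points_app by (auto simp: beta_def)
    ultimately have "{v \<in> points (app (FDelta S) X).
        Delta_map (app S X) (app S Y) (fmap S X Y f) (?i v) \<in> beta (app S Y) p q U} = enc (app S X) ` ?W"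
      using Delta_map_beta_iff[OF m i(1) U] by blast
    then show "{v \<in> points (app (FDelta S) X).
        Delta_map (app S X) (app S Y) (fmap S X Y f) (?i v) \<in> beta (app S Y) p q U} \<in> meas (app (FDelta S) X)"
      using meas_app_beta[OF pq measurable_mapD(2)[OF m U]] by simp
  qed
qed

text \<open>Asked of \<open>h\<close> only on the points, because it will be applied to the
  description map of the canonical coalgebra.\<close>

lemma fmap_id:
  assumes X: "uncertainty_space X" and h: "\<And>x. x \<in> points X \<Longrightarrow> h x = x"
  shows "upp_functor S \<Longrightarrow> v \<in> points (app S X) \<Longrightarrow> fmap S X X h v = v"
proof (induction S arbitrary: v)
  case FId
  then show ?case unfolding points_app using h by auto
next
  case (FConst M)
  then show ?case unfolding points_app by auto
next
  case (FProd S1 S2)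
  from FProd.prems(2) show ?case unfolding points_app using FProd.IH FProd.prems(1) by auto
next
  case (FSum S1 S2)
  from FSum.prems(2) show ?case unfolding points_app using FSum.IH FSum.prems(1) by auto
next
  case (FDelta S)
  then have S: "upp_functor S" by simp
  obtain g where g: "g \<in> upper_probs (app S X)" and v: "v = enc (app S X) g"
    using FDelta.prems(2) unfolding points_app by blast
  have "fmap S X X h -` U \<inter> points (app S X) = U" if "U \<in> meas (app S X)" for U
    using FDelta.IH[OF S] meas_subset[OF uncertainty_app[OF X S] that] by auto
  then have "Delta_map (app S X) (app S X) (fmap S X X h) g = g"
    using g by (auto simp: Delta_map_def upper_probs_def PiE_def extensional_def)
  then show ?case using fmap_FDelta_enc[OF X S g, of X h] unfolding v by simp
qed

section \<open>Descriptions are invariant under morphisms\<close>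

text \<open>The flag stays a variable with premise \<open>b\<close> so that rule induction applies;
  the rule for arbitrary singletons has the flag \<open>False\<close> and drops out.\<close>

lemma meas_sem:
  assumes T: "upp_functor T" and \<alpha>: "coalgebra T X \<alpha>"
  shows "has_sort T b S \<phi> \<Longrightarrow> b \<Longrightarrow> S \<in> Ing T \<Longrightarrow> sem T X \<alpha> S \<phi> \<in> meas (app S X)"
proof (induction rule: has_sort.induct)
  case (1 b S)
  note X = measurable_mapD(3)[OF \<alpha>[unfolded coalgebra_def]]
  show ?case using meas_closed(1)[OF uncertainty_app[OF X upp_functor_Ing[OF T 1(2)]]] by simp
next
  case (2 b S \<phi> \<psi>)
  note X = measurable_mapD(3)[OF \<alpha>[unfolded coalgebra_def]]
  show ?case using 2 meas_closed[OF uncertainty_app[OF X upp_functor_Ing[OF T 2(6)]]] by simp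
next
  case (3 A M b)
  then show ?case by (simp add: image_space_def)
next
  case (4 m M)
  then show ?case by simp
next
  case (5 \<kappa> S S' b \<phi>)
  have IH: "sem T X \<alpha> S' \<phi> \<in> meas (app S' X)" using 5 Ing_edge by blast
  note X = measurable_mapD(3)[OF \<alpha>[unfolded coalgebra_def]]
  note [simp del] = app.simps
  from 5(1) show ?case
  proof cases
    case (1 S2)
    then have "{VPair v w | v w. v \<in> sem T X \<alpha> S' \<phi> \<and> w \<in> points (app S2 X)} \<in> meas (app S X)"
      using 5(5) T X IH by (auto intro!: meas_app_FProd meas_closed uncertainty_app dest: Ing_FProdD upp_functor_Ing)
    moreover have "sem T X \<alpha> S' \<phi> \<subseteq> points (app S' X)"
      using IH meas_subset uncertainty_app[OF X] upp_functor_Ing[OF T] 5(1,5) Ing_edge by metis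
    then have "sem T X \<alpha> S (Box \<kappa> \<phi>) = {VPair v w | v w. v \<in> sem T X \<alpha> S' \<phi> \<and> w \<in> points (app S2 X)}"
      unfolding 1 by (auto simp: points_app)
    ultimately show ?thesis by simp
  next
    case (2 S1)
    then have "{VPair v w | v w. v \<in> points (app S1 X) \<and> w \<in> sem T X \<alpha> S' \<phi>} \<in> meas (app S X)"
      using 5(5) T X IH by (auto intro!: meas_app_FProd meas_closed uncertainty_app dest: Ing_FProdD upp_functor_Ing)
    moreover have "sem T X \<alpha> S' \<phi> \<subseteq> points (app S' X)"
      using IH meas_subset uncertainty_app[OF X] upp_functor_Ing[OF T] 5(1,5) Ing_edge by metis
    then have "sem T X \<alpha> S (Box \<kappa> \<phi>) = {VPair v w | v w. v \<in> points (app S1 X) \<and> w \<in> sem T X \<alpha> S' \<phi>}"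
      unfolding 2 by (auto simp: points_app)
    ultimately show ?thesis by simp
  next
    case (3 S2)
    then have S: "upp_functor (FSum S' S2)" using 5(5) T upp_functor_Ing by blast
    show ?thesis
      using meas_closed(4)[OF uncertainty_app[OF X S] meas_app_VInl[OF IH]
          meas_app_VInr[OF meas_closed(2)[OF uncertainty_app[OF X]]]] S by (simp add: 3)
  next
    case (4 S1)
    then have S: "upp_functor (FSum S1 S')" using 5(5) T upp_functor_Ing by blast
    show ?thesis
      using meas_closed(4)[OF uncertainty_app[OF X S] meas_app_VInl[OF meas_closed(2)[OF uncertainty_app[OF X]]]
          meas_app_VInr[OF IH]] S by (simp add: 4)
  next
    case 5
    have "\<alpha> -` sem T X \<alpha> T \<phi> \<inter> points X \<in> meas X"
      using measurable_mapD(2)[OF \<alpha>[unfolded coalgebra_def]] IH 5 by simp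
    moreover have "{x \<in> points X. \<alpha> x \<in> sem T X \<alpha> T \<phi>} = \<alpha> -` sem T X \<alpha> T \<phi> \<inter> points X" by auto
    ultimately show ?thesis by (simp add: 5 meas_app_FId)
  qed
next
  case (6 p q S \<phi> b)
  then have "sem T X \<alpha> S \<phi> \<in> meas (app S X)" using Ing_FDeltaD by blast
  with 6 show ?case by (simp add: meas_app_beta del: app.simps)
qed

text \<open>By induction on the formula, for all points of its sort at once: the probability case
  needs the induction hypothesis as an equation between sets.\<close>

lemma sem_fmap_iff:
  assumes T: "upp_functor T" and m: "coalgebra_morphism T X \<alpha> Y \<delta> f"
  shows "has_sort T b S \<phi> \<Longrightarrow> S \<in> Ing T \<Longrightarrow> v \<in> points (app S X) \<Longrightarrow>
    fmap S X Y f v \<in> sem T Y \<delta> S \<phi> \<longleftrightarrow> v \<in> sem T X \<alpha> S \<phi>"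
proof (induction arbitrary: v rule: has_sort.induct)
  case (1 b S)
  show ?case by simp
next
  case (2 b S \<phi> \<psi>)
  have "fmap S X Y f v \<in> points (app S Y)"
    using measurable_mapD(1)[OF measurable_fmap] m upp_functor_Ing[OF T] 2(5,6)
    unfolding coalgebra_morphism_def by blast
  then show ?case using 2 by simp
next
  case (3 A M b)
  then show ?case unfolding points_app by auto
next
  case (4 m M)
  then show ?case unfolding points_app by auto
next
  case (5 \<kappa> S S' b \<phi>)
  have IH: "fmap S' X Y f v \<in> sem T Y \<delta> S' \<phi> \<longleftrightarrow> v \<in> sem T X \<alpha> S' \<phi>" if "v \<in> points (app S' X)" for v
    using 5 Ing_edge that by blast
  have fv: "fmap S X Y f v \<in> points (app S Y)"
    using measurable_mapD(1)[OF measurable_fmap] m upp_functor_Ing[OF T] 5(4,5)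
    unfolding coalgebra_morphism_def by blast
  note [simp del] = app.simps
  from 5(1) show ?case
  proof cases
    case (1 S2)
    with fv 5(5) IH show ?thesis by (auto simp: points_app)
  next
    case (2 S1)
    with fv 5(5) IH show ?thesis by (auto simp: points_app)
  next
    case (3 S2)
    with fv 5(5) IH show ?thesis by (auto simp: points_app)
  next
    case (4 S2)
    with fv 5(5) IH show ?thesis by (auto simp: points_app)
  next
    case 5
    obtain x where x: "x \<in> points X" "v = VId x" using \<open>v \<in> points (app S X)\<close> by (auto simp: 5 points_app)
    \<comment> \<open>The one use of the commuting square; it moves the claim from
      \<open>FId\<close> to the smaller formula at sort \<open>T\<close>.\<close>
    have "\<delta> (f x) = fmap T X Y f (\<alpha> x)" "\<alpha> x \<in> points (app T X)" "f x \<in> points Y"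
      using m x measurable_mapD(1) unfolding coalgebra_morphism_def coalgebra_def by metis+
    then show ?thesis using IH[of "\<alpha> x"] x by (auto simp: 5)
  qed
next
  case (6 p q S \<phi> b)
  have X: "uncertainty_space X" and Y: "uncertainty_space Y" and f: "measurable_map X Y f"
    and coalg: "coalgebra T X \<alpha>" "coalgebra T Y \<delta>"
    using m measurable_mapD(3,4) unfolding coalgebra_morphism_def by blast+
  have S: "S \<in> Ing T" "upp_functor S" using 6(5) Ing_FDeltaD upp_functor_Ing[OF T] by blast+
  obtain g where g: "g \<in> upper_probs (app S X)" and v: "v = enc (app S X) g"
    using 6(6) unfolding points_app by blast
  note fS = measurable_fmap[OF f S(2)]
  have sub: "sem T X \<alpha> S \<phi> \<subseteq> points (app S X)"
    using meas_subset[OF uncertainty_app[OF X S(2)] meas_sem[OF T coalg(1) 6(3) _ S(1)]] by simp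
  \<comment> \<open>The interpretation in \<open>X\<close> is the preimage of the one in
    \<open>Y\<close>. Both are measurable, because the formula under \<open>Prob\<close> contains no
    non-measurable singleton, so \<open>Delta_map\<close> takes its intended value.\<close>
  have "fmap S X Y f -` sem T Y \<delta> S \<phi> \<inter> points (app S X) = sem T X \<alpha> S \<phi>"
    using 6(4)[OF S(1)] sub by auto
  then have *: "Delta_map (app S X) (app S Y) (fmap S X Y f) g \<in> beta (app S Y) p q (sem T Y \<delta> S \<phi>) \<longleftrightarrow>
      g \<in> beta (app S X) p q (sem T X \<alpha> S \<phi>)"
    using Delta_map_beta_iff[OF fS g meas_sem[OF T coalg(2) 6(3) _ S(1)]] by simp

  show ?case
    unfolding sem.simps v fmap_FDelta_enc[OF X S(2) g]
    using * inj_on_image_mem_iff[OF enc_inj_app[OF X S(2)] g]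
      inj_on_image_mem_iff[OF enc_inj_app[OF Y S(2)] Delta_map_upper_probs[OF fS g]]
    by (auto simp: beta_def)
qed

section \<open>Sorts of formulas\<close>

lemma has_sort_simps [simp]:
  "has_sort T b S (Bot S') \<longleftrightarrow> S' = S"
  "has_sort T b S (Imp \<phi> \<psi>) \<longleftrightarrow> has_sort T b S \<phi> \<and> has_sort T b S \<psi>"
  "has_sort T b (FDelta S) (Prob p q \<phi>) \<longleftrightarrow> p \<in> {0..1} \<and> q \<in> {0..1} \<and> has_sort T True S \<phi>"
  by (subst has_sort.simps; auto)+

lemma edge_unique: "edge T \<kappa> S S' \<Longrightarrow> edge T \<kappa> S S'' \<Longrightarrow> S' = S''"
  by (auto elim!: edge.cases)

lemma has_sort_Box: "edge T \<kappa> S S' \<Longrightarrow> has_sort T b S (Box \<kappa> \<phi>) \<longleftrightarrow> has_sort T b S' \<phi>"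
  by (subst has_sort.simps) (auto dest: edge_unique)

lemma has_sort_connectives [simp]:
  "has_sort T b S (Neg S \<phi>) \<longleftrightarrow> has_sort T b S \<phi>"
  "has_sort T b S (Top S)"
  "has_sort T b S (Or S \<phi> \<psi>) \<longleftrightarrow> has_sort T b S \<phi> \<and> has_sort T b S \<psi>"
  "has_sort T b S (And S \<phi> \<psi>) \<longleftrightarrow> has_sort T b S \<phi> \<and> has_sort T b S \<psi>"
  "has_sort T b S (Iff S \<phi> \<psi>) \<longleftrightarrow> has_sort T b S \<phi> \<and> has_sort T b S \<psi>"
  by (auto simp: Neg_def Top_def Or_def And_def Iff_def)

lemma has_sort_Conj [simp]: "has_sort T b S (Conj S \<phi>s) \<longleftrightarrow> (\<forall>\<phi>\<in>set \<phi>s. has_sort T b S \<phi>)"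
  by (induction \<phi>s) (auto simp: Conj_def)

lemma has_sort_Disj [simp]: "has_sort T b S (Disj S \<phi>s) \<longleftrightarrow> (\<forall>\<phi>\<in>set \<phi>s. has_sort T b S \<phi>)"
  by (induction \<phi>s) (auto simp: Disj_def)

lemma has_sort_False: "has_sort T b S \<phi> \<Longrightarrow> has_sort T False S \<phi>"
  by (induction rule: has_sort.induct) (auto intro: has_sort.intros)

lemma mForm_subset_Form: "mForm T S \<subseteq> Form T S"
  by (auto simp: mForm_def Form_def intro: has_sort_False)

lemma set_subseqs_subset: "ys \<in> set (subseqs xs) \<Longrightarrow> set ys \<subseteq> set xs"
  using subseqs_powset[of xs] by blast

lemma has_sort_at_least: "\<forall>\<phi>\<in>set \<phi>s. has_sort T b S \<phi> \<Longrightarrow> has_sort T b S (at_least S k \<phi>s)"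
  by (auto simp: at_least_def dest!: set_subseqs_subset)

text \<open>With the next lemma: at least \<open>k\<close> entries satisfy \<open>P\<close> iff some
  subsequence of length \<open>k\<close> consists of such entries. This gives
  \<open>at_least\<close> its counting meaning in maximal sets.\<close>

lemma length_le_filter_subseqs:
  "ys \<in> set (subseqs xs) \<Longrightarrow> \<forall>y\<in>set ys. P y \<Longrightarrow> length ys \<le> length (filter P xs)"
proof (induction xs arbitrary: ys)
  case (Cons x xs)
  then show ?case by (force simp: Let_def)
qed simp

lemma ex_subseqs_filter:
  "k \<le> length (filter P xs) \<Longrightarrow> \<exists>ys\<in>set (subseqs xs). length ys = k \<and> (\<forall>y\<in>set ys. P y)"
proof (induction xs arbitrary: k)
  case (Cons x xs)
  show ?case
  proof (cases "k \<le> length (filter P xs)")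
    case True
    then show ?thesis using Cons.IH by (fastforce simp: Let_def)
  next
    case False
    then obtain j where j: "k = Suc j" "j \<le> length (filter P xs)" "P x"
      using Cons.prems by (cases k) (auto split: if_splits)
    then obtain ys where "ys \<in> set (subseqs xs)" "length ys = j" "\<forall>y\<in>set ys. P y"
      using Cons.IH by blast
    then show ?thesis using j by (intro bexI[of _ "x # ys"]) (auto simp: Let_def)
  qed
qed simp

section \<open>Maximal sets\<close>

text \<open>Soundness stays outside since it refers to the carrier type of the coalgebras; it is
  added where descriptions are studied.\<close>

locale lindenbaum_system = deduction_system T D for T :: "'m pfun" and D +
  assumes upp: "upp_functor T" and dual: "lower_upper_dual T D" and lind: "lindenbaum T D"
begin

abbreviation "X S \<equiv> can_space T D S"

lemma derive_mp:
  assumes S: "S \<in> Ing T" and 1: "D S \<Gamma> \<phi>" and 2: "D S \<Gamma> (Imp \<phi> \<psi>)"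
  shows "D S \<Gamma> \<psi>"
proof -
  have F: "\<Gamma> \<subseteq> Form T S" "\<phi> \<in> Form T S" "\<psi> \<in> Form T S"
    using sorted[OF S 1] sorted[OF S 2] by (auto simp: Form_def)
  show ?thesis
    by (rule cut[OF S F(1) _ modus_ponens[OF S F(2,3)]]) (use 1 2 in auto)
qed

lemma derive_assumption: "S \<in> Ing T \<Longrightarrow> \<Gamma> \<subseteq> Form T S \<Longrightarrow> \<phi> \<in> \<Gamma> \<Longrightarrow> D S \<Gamma> \<phi>"
  and derive_axiom: "S \<in> Ing T \<Longrightarrow> \<Gamma> \<subseteq> Form T S \<Longrightarrow> \<phi> \<in> Ax T S \<Longrightarrow> D S \<Gamma> \<phi>"
  by (auto intro: assumption)

lemma derive_mono:
  "S \<in> Ing T \<Longrightarrow> D S \<Gamma> \<phi> \<Longrightarrow> \<Gamma> \<subseteq> \<Gamma>' \<Longrightarrow> \<Gamma>' \<subseteq> Form T S \<Longrightarrow> D S \<Gamma>' \<phi>"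
  by (rule cut) (auto intro: derive_assumption)

lemma maximalD:
  assumes "maximal T D S x"
  shows "x \<subseteq> Form T S" and "\<not> D S x (Bot S)"
    and "\<phi> \<in> Form T S \<Longrightarrow> Neg S \<phi> \<in> x \<longleftrightarrow> \<phi> \<notin> x"
  using assms by (auto simp: maximal_def consistent_def)

lemma maximal_closed:
  assumes S: "S \<in> Ing T" and x: "maximal T D S x" and d: "D S x \<phi>"
  shows "\<phi> \<in> x"
proof (rule ccontr)
  assume "\<phi> \<notin> x"
  then have "Imp \<phi> (Bot S) \<in> x" using maximalD[OF x] sorted[OF S d] by (auto simp: Neg_def)
  then have "D S x (Bot S)"
    using derive_mp[OF S d derive_assumption[OF S maximalD(1)[OF x]]] by blast
  then show False using maximalD[OF x] by blast
qed

lemma maximal_axiom: "S \<in> Ing T \<Longrightarrow> maximal T D S x \<Longrightarrow> \<phi> \<in> Ax T S \<Longrightarrow> \<phi> \<in> x"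
  by (rule maximal_closed[OF _ _ derive_axiom[OF _ maximalD(1)]])

lemma maximal_consequence:
  "S \<in> Ing T \<Longrightarrow> maximal T D S x \<Longrightarrow> D S \<Gamma> \<phi> \<Longrightarrow> \<Gamma> \<subseteq> x \<Longrightarrow> \<phi> \<in> x"
  by (rule maximal_closed[OF _ _ derive_mono[OF _ _ _ maximalD(1)]])

lemma maximal_theorem: "S \<in> Ing T \<Longrightarrow> maximal T D S x \<Longrightarrow> D S {} \<phi> \<Longrightarrow> \<phi> \<in> x"
  by (rule maximal_consequence[of S x "{}"]) auto

context
  fixes S x
  assumes S: "S \<in> Ing T" and x: "maximal T D S x"
begin

lemma maximal_Bot: "Bot S \<notin> x"
  using derive_assumption[OF S maximalD(1)[OF x]] maximalD(2)[OF x] by blast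

lemma maximal_mp: "\<phi> \<in> x \<Longrightarrow> Imp \<phi> \<psi> \<in> x \<Longrightarrow> \<psi> \<in> x"
  by (rule maximal_closed[OF S x derive_mp[OF S derive_assumption derive_assumption]])
    (use S maximalD(1)[OF x] in auto)

lemma maximal_Imp:
  assumes \<phi>: "\<phi> \<in> Form T S" and \<psi>: "\<psi> \<in> Form T S"
  shows "Imp \<phi> \<psi> \<in> x \<longleftrightarrow> (\<phi> \<in> x \<longrightarrow> \<psi> \<in> x)"
proof
  assume "\<phi> \<in> x \<longrightarrow> \<psi> \<in> x"
  moreover have "Imp (Neg S \<phi>) (Imp \<phi> \<psi>) \<in> x" "Imp \<psi> (Imp \<phi> \<psi>) \<in> x"
    using \<phi> \<psi> by (auto intro!: maximal_axiom[OF S x] Ax.taut simp: Form_def Neg_def)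
  ultimately show "Imp \<phi> \<psi> \<in> x" using maximal_mp maximalD(3)[OF x \<phi>] by blast
qed (auto dest: maximal_mp)

lemma maximal_Neg: "\<phi> \<in> Form T S \<Longrightarrow> Neg S \<phi> \<in> x \<longleftrightarrow> \<phi> \<notin> x"
  by (rule maximalD(3)[OF x])

lemma maximal_Top: "Top S \<in> x"
  using maximal_Neg[of "Bot S"] maximal_Bot by (simp add: Top_def Form_def)

lemma maximal_Or: "\<phi> \<in> Form T S \<Longrightarrow> \<psi> \<in> Form T S \<Longrightarrow> Or S \<phi> \<psi> \<in> x \<longleftrightarrow> \<phi> \<in> x \<or> \<psi> \<in> x"
  using maximal_Imp[of "Neg S \<phi>" \<psi>] maximal_Neg[of \<phi>] by (auto simp: Or_def Form_def)

lemma maximal_And: "\<phi> \<in> Form T S \<Longrightarrow> \<psi> \<in> Form T S \<Longrightarrow> And S \<phi> \<psi> \<in> x \<longleftrightarrow> \<phi> \<in> x \<and> \<psi> \<in> x"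
  using maximal_Imp[of \<phi> "Neg S \<psi>"] maximal_Neg[of \<psi>] maximal_Neg[of "Imp \<phi> (Neg S \<psi>)"]
  by (auto simp: And_def Form_def)

lemma maximal_Iff: "\<phi> \<in> Form T S \<Longrightarrow> \<psi> \<in> Form T S \<Longrightarrow> Iff S \<phi> \<psi> \<in> x \<longleftrightarrow> (\<phi> \<in> x \<longleftrightarrow> \<psi> \<in> x)"
  using maximal_And[of "Imp \<phi> \<psi>" "Imp \<psi> \<phi>"] maximal_Imp[of \<phi> \<psi>] maximal_Imp[of \<psi> \<phi>]
  by (auto simp: Iff_def Form_def)

lemma maximal_Conj: "set \<phi>s \<subseteq> Form T S \<Longrightarrow> Conj S \<phi>s \<in> x \<longleftrightarrow> set \<phi>s \<subseteq> x"
proof (induction \<phi>s)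
  case Nil
  then show ?case using maximal_Top by (simp add: Conj_def)
next
  case (Cons \<phi> \<phi>s)
  then have "Conj S \<phi>s \<in> Form T S" by (auto simp: Form_def)
  then show ?case using Cons maximal_And[of \<phi> "Conj S \<phi>s"] by (simp add: Conj_def)
qed

lemma maximal_Disj: "set \<phi>s \<subseteq> Form T S \<Longrightarrow> Disj S \<phi>s \<in> x \<longleftrightarrow> (\<exists>\<phi>\<in>set \<phi>s. \<phi> \<in> x)"
proof (induction \<phi>s)
  case Nil
  then show ?case using maximal_Bot by (simp add: Disj_def)
next
  case (Cons \<phi> \<phi>s)
  then have "Disj S \<phi>s \<in> Form T S" by (auto simp: Form_def)
  then show ?case using Cons maximal_Or[of \<phi> "Disj S \<phi>s"] by (simp add: Disj_def)
qed

lemma maximal_at_least: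
  assumes \<phi>s: "set \<phi>s \<subseteq> Form T S"
  shows "at_least S k \<phi>s \<in> x \<longleftrightarrow> k \<le> length (filter (\<lambda>\<phi>. \<phi> \<in> x) \<phi>s)"
proof -
  let ?L = "filter (\<lambda>\<psi>s. length \<psi>s = k) (subseqs \<phi>s)"
  have F: "set \<psi>s \<subseteq> Form T S" if "\<psi>s \<in> set (subseqs \<phi>s)" for \<psi>s
    using set_subseqs_subset[OF that] \<phi>s by blast
  then have "set (map (Conj S) ?L) \<subseteq> Form T S" by (fastforce simp: Form_def)
  then have "at_least S k \<phi>s \<in> x \<longleftrightarrow> (\<exists>\<psi>s\<in>set (subseqs \<phi>s). length \<psi>s = k \<and> Conj S \<psi>s \<in> x)"
    unfolding at_least_def using maximal_Disj by auto
  also have "\<dots> \<longleftrightarrow> (\<exists>\<psi>s\<in>set (subseqs \<phi>s). length \<psi>s = k \<and> (\<forall>\<psi>\<in>set \<psi>s. \<psi> \<in> x))"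
    using maximal_Conj[OF F] by (auto simp: subset_iff)
  also have "\<dots> \<longleftrightarrow> k \<le> length (filter (\<lambda>\<phi>. \<phi> \<in> x) \<phi>s)"
    using length_le_filter_subseqs ex_subseqs_filter by blast
  finally show ?thesis .
qed

end

text \<open>The Lindenbaum property enters here: if \<open>\<phi>\<close> is not derivable, its
  negation is consistent and extends to a maximal set. Facts about all maximal sets thereby become
  the theorems that necessitation and the cover rules take as premises.\<close>

lemma derivable_iff:
  assumes S: "S \<in> Ing T" and \<phi>: "\<phi> \<in> Form T S"
  shows "D S {} \<phi> \<longleftrightarrow> (\<forall>x. maximal T D S x \<longrightarrow> \<phi> \<in> x)"
proof
  assume "D S {} \<phi>"
  then show "\<forall>x. maximal T D S x \<longrightarrow> \<phi> \<in> x" using maximal_theorem[OF S] by blast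
next
  assume *: "\<forall>x. maximal T D S x \<longrightarrow> \<phi> \<in> x"
  have N: "Neg S \<phi> \<in> Form T S" using \<phi> by (simp add: Form_def)
  have "D S {Neg S \<phi>} (Bot S)"
  proof (rule ccontr)
    assume "\<not> D S {Neg S \<phi>} (Bot S)"
    then obtain x where "{Neg S \<phi>} \<subseteq> x" "maximal T D S x"
      using lind[unfolded lindenbaum_def, rule_format, OF S, of "{Neg S \<phi>}"] N
      by (auto simp: consistent_def)
    then show False using * maximalD(3)[OF _ \<phi>] by blast
  qed
  then have "D S {} (Imp (Neg S \<phi>) (Bot S))" using deduction_rule[OF S, of "{}"] by simp
  moreover have "D S {} (Imp (Imp (Neg S \<phi>) (Bot S)) \<phi>)"
    using \<phi> N by (intro derive_axiom[OF S] Ax.taut) (auto simp: Form_def Neg_def)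
  ultimately show "D S {} \<phi>" by (rule derive_mp[OF S])
qed

section \<open>The uncertainty spaces of maximal sets\<close>

lemma points_can_space: "points (X S) = {x. maximal T D S x}"
  and meas_can_space: "meas (X S) = ext T D S ` mForm T S"
  by (auto simp: can_space_def)

lemma mFormD: "\<phi> \<in> mForm T S \<Longrightarrow> \<phi> \<in> Form T S"
  using mForm_subset_Form by blast

lemma ext_Neg:
  assumes "S \<in> Ing T" and "\<phi> \<in> mForm T S"
  shows "ext T D S (Neg S \<phi>) = points (X S) - ext T D S \<phi>"
  using maximal_Neg[OF assms(1) _ mFormD[OF assms(2)]] by (auto simp: ext_def points_can_space)

lemma mForm_Neg: "\<phi> \<in> mForm T S \<Longrightarrow> Neg S \<phi> \<in> mForm T S"
  by (simp add: mForm_def)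

lemma uncertainty_can_space:
  assumes S: "S \<in> Ing T"
  shows "uncertainty_space (X S)"
  unfolding uncertainty_space_def algebra_iff_Un meas_can_space
proof (intro conjI ballI)
  show "ext T D S ` mForm T S \<subseteq> Pow (points (X S))" by (auto simp: ext_def points_can_space)
  have "ext T D S (Bot S) = {}" using maximal_Bot[OF S] by (auto simp: ext_def)
  then show "{} \<in> ext T D S ` mForm T S" by (force simp: mForm_def)
next
  fix U assume "U \<in> ext T D S ` mForm T S"
  then obtain \<phi> where "\<phi> \<in> mForm T S" "U = ext T D S \<phi>" by blast
  then show "points (X S) - U \<in> ext T D S ` mForm T S"
    using ext_Neg[OF S] mForm_Neg by (metis imageI)
next
  fix U V assume "U \<in> ext T D S ` mForm T S" "V \<in> ext T D S ` mForm T S"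
  then obtain \<phi> \<psi> where *: "\<phi> \<in> mForm T S" "U = ext T D S \<phi>" "\<psi> \<in> mForm T S" "V = ext T D S \<psi>" by blast
  then have "U \<union> V = ext T D S (Or S \<phi> \<psi>)"
    using maximal_Or[OF S _ mFormD mFormD] by (auto simp: ext_def)
  then show "U \<union> V \<in> ext T D S ` mForm T S" using * by (auto simp: mForm_def)
qed

lemma ext_in_meas: "\<phi> \<in> mForm T S \<Longrightarrow> ext T D S \<phi> \<in> meas (X S)"
  by (simp add: meas_can_space)

lemma Imp_derivable:
  assumes "S \<in> Ing T" and "\<phi> \<in> mForm T S" "\<psi> \<in> mForm T S" and "ext T D S \<phi> \<subseteq> ext T D S \<psi>"
  shows "D S {} (Imp \<phi> \<psi>)"
proof -
  have "Imp \<phi> \<psi> \<in> Form T S" using assms(2,3)[THEN mFormD] by (simp add: Form_def)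
  then show ?thesis
    using derivable_iff[OF assms(1)] maximal_Imp[OF assms(1) _ mFormD mFormD] assms by (auto simp: ext_def)
qed

section \<open>Definite boxes\<close>

lemma unbox_iff: "\<phi> \<in> unbox \<kappa> x \<longleftrightarrow> Box \<kappa> \<phi> \<in> x"
  by (simp add: unbox_def)

text \<open>The definite box rule makes the unboxed set deductively closed, absence of the boxed
  falsum makes it consistent, and the axiom that pushes negation inside the box makes it
  complete.\<close>

lemma maximal_unbox:
  assumes e: "edge T \<kappa> S S'" and S: "S \<in> Ing T" and x: "maximal T D S x"
    and bot: "Box \<kappa> (Bot S') \<notin> x"
  shows "maximal T D S' (unbox \<kappa> x)"
proof -
  have F: "Box \<kappa> \<phi> \<in> Form T S \<longleftrightarrow> \<phi> \<in> Form T S'" for \<phi>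
    by (simp add: Form_def has_sort_Box[OF e])
  have S': "S' \<in> Ing T" by (rule Ing_edge[OF e S])
  have closed: "\<phi> \<in> unbox \<kappa> x" if "D S' \<Gamma> \<phi>" "\<Gamma> \<subseteq> unbox \<kappa> x" for \<Gamma> \<phi>
  proof -
    have "Box \<kappa> ` \<Gamma> \<subseteq> x" using that(2) by (auto simp: unbox_def)
    then have "Box \<kappa> \<phi> \<in> x" by (rule maximal_consequence[OF S x definite_box[OF S e that(1)]])
    then show ?thesis by (simp add: unbox_def)
  qed
  have sub: "unbox \<kappa> x \<subseteq> Form T S'" using maximalD(1)[OF x] F by (auto simp: unbox_def)
  have cons: "\<not> D S' (unbox \<kappa> x) (Bot S')"
    using closed[of "unbox \<kappa> x" "Bot S'"] bot by (auto simp: unbox_iff)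
  have "\<phi> \<in> unbox \<kappa> x \<longleftrightarrow> Neg S' \<phi> \<notin> unbox \<kappa> x" if \<phi>: "\<phi> \<in> Form T S'" for \<phi>
  proof
    assume "\<phi> \<in> unbox \<kappa> x"
    then show "Neg S' \<phi> \<notin> unbox \<kappa> x"
      using derive_mp[OF S' derive_assumption[OF S' sub] derive_assumption[OF S' sub], of \<phi> "Bot S'"] cons
      by (auto simp: Neg_def)
  next
    assume "Neg S' \<phi> \<notin> unbox \<kappa> x"
    moreover have "Imp (Neg S (Box \<kappa> \<phi>)) (Box \<kappa> (Neg S' \<phi>)) \<in> x"
      by (rule maximal_axiom[OF S x Ax.box_neg[OF e \<phi>]])
    ultimately have "Neg S (Box \<kappa> \<phi>) \<notin> x"
      using maximal_mp[OF S x, of "Neg S (Box \<kappa> \<phi>)"] by (auto simp: unbox_iff)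
    then show "\<phi> \<in> unbox \<kappa> x" using maximal_Neg[OF S x, of "Box \<kappa> \<phi>"] F \<phi> by (simp add: unbox_iff)
  qed
  then show ?thesis using sub cons by (simp add: maximal_def consistent_def)
qed

lemma maximal_unbox_PR:
  assumes "edge T \<kappa> S S'" and "\<kappa> \<in> {PR1, PR2}" and S: "S \<in> Ing T" and x: "maximal T D S x"
  shows "maximal T D S' (unbox \<kappa> x)"
proof -
  have "Neg S (Box \<kappa> (Bot S')) \<in> x" by (rule maximal_axiom[OF S x Ax.pr_bot[OF assms(2,1)]])
  moreover have "Box \<kappa> (Bot S') \<in> Form T S" by (simp add: Form_def has_sort_Box[OF assms(1)])
  ultimately show ?thesis by (intro maximal_unbox[OF assms(1) S x]) (simp add: maximal_Neg[OF S x])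
qed

lemma maximal_unbox_NEXT:
  assumes x: "maximal T D FId x"
  shows "maximal T D T (unbox NEXT x)"
proof -
  have e: "edge T NEXT FId T" by (rule edge.intros)
  have "Neg FId (Box NEXT (Bot T)) \<in> x" by (rule maximal_axiom[OF FId_in_Ing x Ax.next_bot]) simp
  moreover have "Box NEXT (Bot T) \<in> Form T FId" by (simp add: Form_def has_sort_Box[OF e])
  ultimately show ?thesis
    by (intro maximal_unbox[OF e FId_in_Ing x]) (simp add: maximal_Neg[OF FId_in_Ing x])
qed

text \<open>A maximal set of a sum sort lies in exactly one summand, and the box of falsum belongs
  to it exactly for the other one. For that other summand every box holds vacuously.\<close>

lemma maximal_FSum:
  assumes S: "FSum S1 S2 \<in> Ing T" and x: "maximal T D (FSum S1 S2) x"
  shows "Box IN2 (Bot S2) \<in> x \<longleftrightarrow> Box IN1 (Bot S1) \<notin> x"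
    and "Box IN1 (Bot S1) \<notin> x \<Longrightarrow> maximal T D S1 (unbox IN1 x)"
    and "Box IN1 (Bot S1) \<in> x \<Longrightarrow> maximal T D S2 (unbox IN2 x)"
    and "Box IN1 (Bot S1) \<in> x \<Longrightarrow> \<phi> \<in> Form T S1 \<Longrightarrow> Box IN1 \<phi> \<in> x"
    and "Box IN1 (Bot S1) \<notin> x \<Longrightarrow> \<psi> \<in> Form T S2 \<Longrightarrow> Box IN2 \<psi> \<in> x"
    and "Neg (FSum S1 S2) (Box IN1 (Bot S1)) \<in> x \<longleftrightarrow> Box IN1 (Bot S1) \<notin> x"
proof -
  have e: "edge T IN1 (FSum S1 S2) S1" "edge T IN2 (FSum S1 S2) S2" by (rule edge.intros)+
  have S12: "S1 \<in> Ing T" "S2 \<in> Ing T" using Ing_FSumD[OF S] by auto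
  have F: "Box IN1 (Bot S1) \<in> Form T (FSum S1 S2)" "Box IN2 (Bot S2) \<in> Form T (FSum S1 S2)"
    "Neg (FSum S1 S2) (Box IN1 (Bot S1)) \<in> Form T (FSum S1 S2)"
    by (simp_all add: Form_def has_sort_Box[OF e(1)] has_sort_Box[OF e(2)])
  show neg: "Neg (FSum S1 S2) (Box IN1 (Bot S1)) \<in> x \<longleftrightarrow> Box IN1 (Bot S1) \<notin> x"
    by (rule maximal_Neg[OF S x F(1)])
  have "Iff (FSum S1 S2) (Neg (FSum S1 S2) (Box IN1 (Bot S1))) (Box IN2 (Bot S2)) \<in> x"
    by (rule maximal_axiom[OF S x Ax.in_bot]) simp
  then show iff: "Box IN2 (Bot S2) \<in> x \<longleftrightarrow> Box IN1 (Bot S1) \<notin> x"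
    using maximal_Iff[OF S x F(3,2)] neg by simp
  show "Box IN1 (Bot S1) \<notin> x \<Longrightarrow> maximal T D S1 (unbox IN1 x)"
    "Box IN1 (Bot S1) \<in> x \<Longrightarrow> maximal T D S2 (unbox IN2 x)"
    using maximal_unbox[OF e(1) S x] maximal_unbox[OF e(2) S x] iff by auto
  \<comment> \<open>Sent through the definite box rule, this makes the boxed falsum imply every
    boxed formula.\<close>
  have ex_falso: "D S' {Bot S'} \<phi>" if S': "S' \<in> Ing T" and \<phi>: "\<phi> \<in> Form T S'" for S' \<phi>
  proof -
    have "{Bot S'} \<subseteq> Form T S'" by (simp add: Form_def)
    moreover have "Imp (Bot S') \<phi> \<in> Ax T S'" using \<phi> by (intro Ax.taut) (auto simp: Form_def)
    ultimately show ?thesis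
      by (intro derive_mp[OF S' derive_assumption[OF S'] derive_axiom[OF S']]) auto
  qed
  show "Box IN1 (Bot S1) \<in> x \<Longrightarrow> \<phi> \<in> Form T S1 \<Longrightarrow> Box IN1 \<phi> \<in> x"
    using maximal_consequence[OF S x definite_box[OF S e(1) ex_falso[OF S12(1)]]] by simp
  show "Box IN1 (Bot S1) \<notin> x \<Longrightarrow> \<psi> \<in> Form T S2 \<Longrightarrow> Box IN2 \<psi> \<in> x"
    using maximal_consequence[OF S x definite_box[OF S e(2) ex_falso[OF S12(2)]]] iff by simp
qed

section \<open>The upper probability measures \<open>g\<^sub>x\<close>\<close>

text \<open>The value of \<open>rho_Delta\<close> in terms of formulas, usable before independence
  of the representing formula is known.\<close>

definition upper_value :: "'m form set \<Rightarrow> 'm form \<Rightarrow> real" where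
  "upper_value x \<phi> = Sup {q \<in> {0..1}. Uge q \<phi> \<in> x}"

context
  fixes S x
  assumes FS: "FDelta S \<in> Ing T" and x: "maximal T D (FDelta S) x"
begin

lemma Ing_S: "S \<in> Ing T"
  by (rule Ing_FDeltaD[OF FS])

lemma Form_modal:
  assumes "\<phi> \<in> mForm T S" and "p \<in> {0..1}"
  shows "Uge p \<phi> \<in> Form T (FDelta S)" and "Lge p \<phi> \<in> Form T (FDelta S)"
    and "Ule S p \<phi> \<in> Form T (FDelta S)" and "Ult S p \<phi> \<in> Form T (FDelta S)"
  using assms by (auto simp: Form_def mForm_def Uge_def Lge_def Ule_def Ult_def)

lemma Ult_iff: "\<phi> \<in> mForm T S \<Longrightarrow> p \<in> {0..1} \<Longrightarrow> Ult S p \<phi> \<in> x \<longleftrightarrow> Uge p \<phi> \<notin> x"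
  unfolding Ult_def by (rule maximal_Neg[OF FS x Form_modal(1)])

lemma Ule_imp_Ult:
  assumes "\<phi> \<in> mForm T S" and "p \<in> {0..1}" and "q \<in> {0..1}" and "p < q" and "Ule S p \<phi> \<in> x"
  shows "Uge q \<phi> \<notin> x"
  using maximal_mp[OF FS x assms(5) maximal_axiom[OF FS x Ax.Ule_Ult[OF refl assms(1-4)]]] Ult_iff assms
  by blast

lemma Ult_imp_Ule:
  assumes "\<phi> \<in> mForm T S" and "p \<in> {0..1}" and "Uge p \<phi> \<notin> x"
  shows "Ule S p \<phi> \<in> x"
  using maximal_mp[OF FS x _ maximal_axiom[OF FS x Ax.Ult_Ule[OF refl assms(1,2)]]] Ult_iff assms
  by blast

text \<open>Two axioms chained: failure of the bound \<open>p\<close> yields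
  \<open>Ule S p \<phi>\<close>, which excludes every larger bound.\<close>

lemma Uge_antimono:
  assumes "\<phi> \<in> mForm T S" and "Uge q \<phi> \<in> x" and "0 \<le> p" and "p \<le> q" and "q \<le> 1"
  shows "Uge p \<phi> \<in> x"
  using Ule_imp_Ult[OF assms(1), of p q] Ult_imp_Ule[OF assms(1), of p] assms by (cases "p = q") auto

text \<open>At threshold \<open>0\<close> the Archimedean rule has no premises.\<close>

lemma Uge_zero: "\<phi> \<in> mForm T S \<Longrightarrow> Uge 0 \<phi> \<in> x"
  by (rule maximal_consequence[OF FS x archimedean_U[OF FS]]) auto

lemma upper_value_bounds: "\<phi> \<in> mForm T S \<Longrightarrow> upper_value x \<phi> \<in> {0..1}"
  using Uge_zero unfolding upper_value_def
  by (auto intro!: cSup_upper cSup_least simp: bdd_above_def)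

text \<open>The Archimedean rule says that the supremum is attained.\<close>

lemma Uge_iff:
  assumes \<phi>: "\<phi> \<in> mForm T S" and p: "p \<in> {0..1}"
  shows "Uge p \<phi> \<in> x \<longleftrightarrow> p \<le> upper_value x \<phi>"
proof
  assume "Uge p \<phi> \<in> x"
  then show "p \<le> upper_value x \<phi>"
    unfolding upper_value_def using p by (intro cSup_upper) (auto simp: bdd_above_def)
next
  assume le: "p \<le> upper_value x \<phi>"
  have "Uge q \<phi> \<in> x" if q: "q \<in> {0..1}" "q < p" for q
  proof -
    have "{q \<in> {0..1}. Uge q \<phi> \<in> x} \<noteq> {}" using Uge_zero[OF \<phi>] by force
    moreover have "q < Sup {q \<in> {0..1}. Uge q \<phi> \<in> x}" using q le by (simp add: upper_value_def)
    ultimately obtain r where "r \<in> {0..1}" "Uge r \<phi> \<in> x" "q < r"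
      using less_cSupE by blast
    then show ?thesis using Uge_antimono[OF \<phi>, of r q] q by auto
  qed
  then show "Uge p \<phi> \<in> x"
    by (intro maximal_consequence[OF FS x archimedean_U[OF FS \<phi> p]]) auto
qed

lemma Ule_iff:
  assumes \<phi>: "\<phi> \<in> mForm T S" and p: "p \<in> {0..1}"
  shows "Ule S p \<phi> \<in> x \<longleftrightarrow> upper_value x \<phi> \<le> p"
proof
  assume "Ule S p \<phi> \<in> x"
  then have "q \<le> p" if "q \<in> {0..1}" "Uge q \<phi> \<in> x" for q
    using Ule_imp_Ult[OF \<phi> p] that by force
  then show "upper_value x \<phi> \<le> p"
    unfolding upper_value_def using Uge_zero[OF \<phi>] by (intro cSup_least) force+
next
  assume le: "upper_value x \<phi> \<le> p"
  \<comment> \<open>\<open>Ule S p \<phi>\<close> is by definition \<open>Lge (1 - p)\<close> of the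
    negation, so the boundary case comes from the Archimedean rule for \<open>Lge\<close>; strictly
    below it, \<open>Ult_imp_Ule\<close> at \<open>1 - q > p\<close> applies.\<close>
  have "Lge q (Neg S \<phi>) \<in> x" if q: "q \<in> {0..1}" "q < 1 - p" for q
  proof -
    have "Uge (1 - q) \<phi> \<notin> x" using Uge_iff[OF \<phi>, of "1 - q"] le q by auto
    then show ?thesis using Ult_imp_Ule[OF \<phi>, of "1 - q"] q by (simp add: Ule_def Lge_def)
  qed
  then have "Lge (1 - p) (Neg S \<phi>) \<in> x"
    using p \<phi> by (intro maximal_consequence[OF FS x archimedean_L[OF FS mForm_Neg]]) auto
  then show "Ule S p \<phi> \<in> x" by (simp add: Ule_def Lge_def)
qed

text \<open>The use of \<open>lower_upper_dual\<close>: it replaces \<open>\<phi>\<close> by its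
  double negation under \<open>Lge\<close>, the only shape that the preceding lemma
  controls.\<close>

lemma Lge_iff:
  assumes \<phi>: "\<phi> \<in> mForm T S" and p: "p \<in> {0..1}"
  shows "Lge p \<phi> \<in> x \<longleftrightarrow> p \<le> 1 - upper_value x (Neg S \<phi>)"
proof -
  have p': "1 - p \<in> {0..1}" using p by auto
  have "D (FDelta S) {} (Iff (FDelta S) (Lge p \<phi>) (Ule S (1 - p) (Neg S \<phi>)))"
    using dual FS \<phi> p unfolding lower_upper_dual_def by blast
  then have "Lge p \<phi> \<in> x \<longleftrightarrow> Ule S (1 - p) (Neg S \<phi>) \<in> x"
    using maximal_theorem[OF FS x] maximal_Iff[OF FS x Form_modal(2)[OF \<phi> p]
        Form_modal(3)[OF mForm_Neg[OF \<phi>] p']] by blast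
  then show ?thesis using Ule_iff[OF mForm_Neg[OF \<phi>] p'] by auto
qed

lemma Prob_iff_upper_value:
  assumes \<phi>: "\<phi> \<in> mForm T S" and p: "p \<in> {0..1}" and q: "q \<in> {0..1}"
  shows "Prob p q \<phi> \<in> x \<longleftrightarrow> p \<le> upper_value x \<phi> \<and> q \<le> 1 - upper_value x (Neg S \<phi>)"
proof -
  have F: "Prob p q \<phi> \<in> Form T (FDelta S)" using \<phi> p q by (simp add: Form_def mForm_def)
  note U = Form_modal(1)[OF \<phi> p] and L = Form_modal(2)[OF \<phi> q]
  have "And (FDelta S) (Uge p \<phi>) (Lge q \<phi>) \<in> Form T (FDelta S)" using U L by (simp add: Form_def)
  then have "Prob p q \<phi> \<in> x \<longleftrightarrow> And (FDelta S) (Uge p \<phi>) (Lge q \<phi>) \<in> x"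
    using maximal_axiom[OF FS x Ax.Prob_iff[OF refl \<phi> p q]] maximal_Iff[OF FS x F] by blast
  then show ?thesis using maximal_And[OF FS x U L] Uge_iff[OF \<phi> p] Lge_iff[OF \<phi> q] by simp
qed

text \<open>Inclusion of extents is a derivable implication; necessitation and the monotonicity
  axiom, at the attained value of \<open>\<phi>\<close>, carry it over. Applied both ways it makes
  the description operator in \<open>rho_Delta\<close> well defined.\<close>

lemma upper_value_mono:
  assumes \<phi>: "\<phi> \<in> mForm T S" and \<psi>: "\<psi> \<in> mForm T S" and sub: "ext T D S \<phi> \<subseteq> ext T D S \<psi>"
  shows "upper_value x \<phi> \<le> upper_value x \<psi>"
proof -
  have "Imp \<phi> \<psi> \<in> mForm T S" using \<phi> \<psi> by (simp add: mForm_def)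
  then have L: "Lge 1 (Imp \<phi> \<psi>) \<in> x"
    using maximal_theorem[OF FS x necessitation[OF FS _ Imp_derivable[OF Ing_S \<phi> \<psi> sub]]] by simp
  let ?p = "upper_value x \<phi>"
  have p: "?p \<in> {0..1}" by (rule upper_value_bounds[OF \<phi>])
  have "Imp (Uge ?p \<phi>) (Uge ?p \<psi>) \<in> x"
    by (rule maximal_mp[OF FS x L maximal_axiom[OF FS x Ax.Uge_mono[OF refl \<phi> \<psi> p]]])
  moreover have "Uge ?p \<phi> \<in> x" using Uge_iff[OF \<phi> p] by simp
  ultimately have "Uge ?p \<psi> \<in> x" using maximal_mp[OF FS x] by blast
  then show ?thesis using Uge_iff[OF \<psi> p] by simp
qed

lemma rho_Delta_ext:
  assumes \<phi>: "\<phi> \<in> mForm T S"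
  shows "rho_Delta T D S x (ext T D S \<phi>) = upper_value x \<phi>"
proof -
  have "(THE r. \<forall>\<psi>\<in>mForm T S. ext T D S \<phi> = ext T D S \<psi> \<longrightarrow> r = upper_value x \<psi>) = upper_value x \<phi>"
  proof (rule the_equality)
    show "\<forall>\<psi>\<in>mForm T S. ext T D S \<phi> = ext T D S \<psi> \<longrightarrow> upper_value x \<phi> = upper_value x \<psi>"
      using upper_value_mono \<phi> by (simp add: order.antisym)
  qed (use \<phi> in blast)
  then show ?thesis using ext_in_meas[OF \<phi>] by (simp add: rho_Delta_def upper_value_def)
qed

lemma cover_condition_rho_Delta: "cover_condition (X S) (rho_Delta T D S x)"
  unfolding cover_condition_def
proof (intro allI impI)
  fix n k U Us
  assume U: "U \<in> meas (X S)" and Us: "set Us \<subseteq> meas (X S)"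
    and cov: "\<forall>y\<in>points (X S). (if y \<in> U then n else 0) + k \<le> cover_count Us y"
  obtain \<phi> where \<phi>: "\<phi> \<in> mForm T S" "U = ext T D S \<phi>" using U by (auto simp: meas_can_space)
  define \<phi>s where "\<phi>s = map (inv_into (mForm T S) (ext T D S)) Us"
  have "set \<phi>s \<subseteq> mForm T S"
    using Us unfolding \<phi>s_def meas_can_space by (auto intro: inv_into_into)
  moreover have "map (ext T D S) \<phi>s = Us"
    using Us unfolding \<phi>s_def meas_can_space map_map comp_def
    by (intro map_idI) (metis f_inv_into_f subsetD)
  ultimately have \<phi>s: "set \<phi>s \<subseteq> mForm T S" "Us = map (ext T D S) \<phi>s" by simp_all
  have \<phi>sF: "set \<phi>s \<subseteq> Form T S" using \<phi>s(1) mForm_subset_Form by blast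
  \<comment> \<open>The thresholds are the exact values, so all the premises \<open>Ule\<close> of
    the cover rules belong to \<open>x\<close>.\<close>
  define ps where "ps = map (upper_value x) \<phi>s"
  have ps: "set ps \<subseteq> {0..1}" "length ps = length \<phi>s"
    using upper_value_bounds \<phi>s(1) by (auto simp: ps_def)
  have "map (rho_Delta T D S x) Us = ps"
    unfolding \<phi>s(2) ps_def using rho_Delta_ext \<phi>s(1) by (auto simp: subset_iff)
  then have sum: "sum_list (map (rho_Delta T D S x) Us) = sum_list ps" by simp
  have count: "cover_count Us y = length (filter (\<lambda>\<phi>. \<phi> \<in> y) \<phi>s)" if "maximal T D S y" for y
    using that unfolding cover_count_def \<phi>s(2) by (simp add: filter_map comp_def ext_def)
  have at: "at_least S j \<phi>s \<in> y \<longleftrightarrow> j \<le> cover_count Us y" if "maximal T D S y" for y j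
    using maximal_at_least[OF Ing_S that \<phi>sF] count[OF that] by simp
  have F: "at_least S j \<phi>s \<in> Form T S" for j
    using \<phi>sF has_sort_at_least[of \<phi>s T False S j] by (auto simp: Form_def)
  have cov': "(if \<phi> \<in> y then n else 0) + k \<le> cover_count Us y" if "maximal T D S y" for y
    using bspec[OF cov, of y] that by (simp add: points_can_space \<phi>(2) ext_def)
  have "at_least S k \<phi>s \<in> y" if y: "maximal T D S y" for y
    using cov'[OF y] at[OF y, of k] by linarith
  then have k: "D S {} (at_least S k \<phi>s)" unfolding derivable_iff[OF Ing_S F] by simp
  have map2: "set (map2 (Ule S) ps \<phi>s) = (\<lambda>\<psi>. Ule S (upper_value x \<psi>) \<psi>) ` set \<phi>s"
    unfolding ps_def by (simp add: zip_map1 zip_same_conv_map comp_def)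
  have conj: "Conj (FDelta S) (map2 (Ule S) ps \<phi>s) \<in> x"
  proof -
    have "set (map2 (Ule S) ps \<phi>s) \<subseteq> x"
      unfolding map2 using Ule_iff upper_value_bounds \<phi>s(1) by auto
    then show ?thesis
      using maximal_Conj[OF FS x order.trans[OF _ maximalD(1)[OF x]]] by simp
  qed
  \<comment> \<open>Rule (C2). It settles \<open>n = 0\<close>, and it is needed first because it
    makes the quotient in (C1) nonnegative.\<close>
  have "real k \<le> sum_list ps"
  proof (rule ccontr)
    assume "\<not> real k \<le> sum_list ps"
    then have "Neg (FDelta S) (Conj (FDelta S) (map2 (Ule S) ps \<phi>s)) \<in> x"
      by (intro maximal_theorem[OF FS x cover2[OF FS \<phi>s(1) ps k]]) simp
    then show False using maximal_mp[OF FS x conj] maximal_Bot[OF FS x] unfolding Neg_def by metis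
  qed
  moreover have "real n * upper_value x \<phi> + real k \<le> sum_list ps" if "n \<ge> 1" "real k \<le> sum_list ps"
  proof -
    have "Imp \<phi> (at_least S (n + k) \<phi>s) \<in> Form T S"
      using mFormD[OF \<phi>(1)] F[of "n + k"] by (simp add: Form_def)
    moreover have "Imp \<phi> (at_least S (n + k) \<phi>s) \<in> y" if y: "maximal T D S y" for y
      using cov'[OF y] by (cases "\<phi> \<in> y") (simp_all add: maximal_Imp[OF Ing_S y mFormD[OF \<phi>(1)] F] at[OF y])
    ultimately have nk: "D S {} (Imp \<phi> (at_least S (n + k) \<phi>s))"
      by (intro derivable_iff[OF Ing_S, THEN iffD2]) auto
    \<comment> \<open>The truncation loses nothing: at \<open>0\<close> it is idle by the bound just
      obtained, and at \<open>1\<close> it only strengthens the conclusion.\<close>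
    let ?p = "max 0 (min 1 ((sum_list ps - real k) / real n))"
    have "Imp (Conj (FDelta S) (map2 (Ule S) ps \<phi>s)) (Ule S ?p \<phi>) \<in> x"
      by (rule maximal_theorem[OF FS x cover1[OF FS \<phi>(1) \<phi>s(1) ps that(1) nk k refl]])
    then have "Ule S ?p \<phi> \<in> x" by (rule maximal_mp[OF FS x conj])
    moreover have "?p \<in> {0..1}" by auto
    ultimately have "upper_value x \<phi> \<le> ?p" by (simp only: Ule_iff[OF \<phi>(1)])
    moreover have "0 \<le> (sum_list ps - real k) / real n" using that(2) by (intro divide_nonneg_nonneg) auto
    ultimately have "upper_value x \<phi> \<le> (sum_list ps - real k) / real n" by linarith
    then have "upper_value x \<phi> * real n \<le> sum_list ps - real k"
      using that(1) by (simp add: pos_le_divide_eq)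
    then show ?thesis by (simp add: mult.commute)
  qed
  ultimately show "real n * rho_Delta T D S x U + real k \<le> sum_list (map (rho_Delta T D S x) Us)"
    unfolding sum \<phi>(2) rho_Delta_ext[OF \<phi>(1)] by (cases "n = 0") simp_all
qed

theorem rho_Delta_upper_probs: "rho_Delta T D S x \<in> upper_probs (X S)"
proof (rule upper_probs_if_cover_condition[OF uncertainty_can_space[OF Ing_S] _ cover_condition_rho_Delta])
  have "rho_Delta T D S x \<in> extensional (meas (X S))" by (simp add: rho_Delta_def)
  moreover have "rho_Delta T D S x U \<in> {0..1}" if "U \<in> meas (X S)" for U
    using that rho_Delta_ext upper_value_bounds by (force simp: meas_can_space)
  ultimately show "rho_Delta T D S x \<in> meas (X S) \<rightarrow>\<^sub>E {0..1}" by (simp add: PiE_def Pi_def)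
qed

lemma Prob_iff_beta:
  assumes \<phi>: "\<phi> \<in> mForm T S" and pq: "p \<in> {0..1}" "q \<in> {0..1}"
  shows "Prob p q \<phi> \<in> x \<longleftrightarrow> rho_Delta T D S x \<in> beta (X S) p q (ext T D S \<phi>)"
  unfolding Prob_iff_upper_value[OF assms] beta_def ext_Neg[OF Ing_S \<phi>, symmetric]
    rho_Delta_ext[OF \<phi>] rho_Delta_ext[OF mForm_Neg[OF \<phi>]] mem_Collect_eq
  using rho_Delta_upper_probs by blast

end

end

section \<open>The canonical coalgebra\<close>

lemma enc_beta_iff:
  assumes "uncertainty_space Y" and "upp_functor S" and "g \<in> upper_probs (app S Y)"
  shows "enc (app S Y) g \<in> enc (app S Y) ` beta (app S Y) p q U \<longleftrightarrow> g \<in> beta (app S Y) p q U"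
  using inj_on_image_mem_iff[OF enc_inj_app[OF assms(1,2)] assms(3)] by (auto simp: beta_def)

lemma measurable_comp:
  assumes f: "measurable_map A B f" and g: "measurable_map B C g"
  shows "measurable_map A C (g \<circ> f)"
proof -
  note fD = measurable_mapD[OF f] and gD = measurable_mapD[OF g]
  have "(g \<circ> f) -` V \<inter> points A = f -` (g -` V \<inter> points B) \<inter> points A" for V
    using fD(1) by auto
  then have "(g \<circ> f) -` V \<inter> points A \<in> meas A" if "V \<in> meas C" for V
    using fD(2)[OF gD(2)[OF that]] by simp
  then show ?thesis using fD(1,3) gD(1,4) by (simp add: measurable_map_def)
qed

lemma uspace_iso_measurable: "uspace_iso A B f \<Longrightarrow> measurable_map A B f"
  by (simp add: uspace_iso_def)

context lindenbaum_system
begin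

abbreviation "X0 \<equiv> can_space T D FId"

lemmas uncertainty_X0 = uncertainty_can_space[OF FId_in_Ing]

lemma upp_Ing: "S \<in> Ing T \<Longrightarrow> upp_functor S"
  by (rule upp_functor_Ing[OF upp])

text \<open>The rule for constants excludes that all singletons are refuted. Once one singleton is
  in \<open>x\<close>, the axioms decide every other constant formula, and with it
  uniqueness.\<close>

lemma rmap_FConst:
  assumes S: "FConst M \<in> Ing T" and x: "maximal T D (FConst M) x"
  obtains c where "c \<in> points M" and "rmap T D (FConst M) x = VConst c"
    and "\<And>A. Cst A \<in> Form T (FConst M) \<Longrightarrow> Cst A \<in> x \<longleftrightarrow> c \<in> A"
proof -
  have F: "Cst {c} \<in> Form T (FConst M)" if "c \<in> points M" for c
    using that by (auto simp: Form_def intro: has_sort.intros)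
  have "\<exists>c\<in>points M. Cst {c} \<in> x"
  proof (rule ccontr)
    assume "\<not> (\<exists>c\<in>points M. Cst {c} \<in> x)"
    then have "{Neg (FConst M) (Cst {c}) | c. c \<in> points M} \<subseteq> x"
      using maximal_Neg[OF S x F] by blast
    then have "Bot (FConst M) \<in> x" by (rule maximal_consequence[OF S x const_rule[OF S]])
    then show False using maximal_Bot[OF S x] by blast
  qed
  then obtain c where c: "c \<in> points M" "Cst {c} \<in> x" by blast
  have iff: "Cst A \<in> x \<longleftrightarrow> c \<in> A" if A: "Cst A \<in> Form T (FConst M)" for A
  proof (cases "c \<in> A")
    case True
    have "Cst A \<in> x"
      by (rule maximal_mp[OF S x c(2) maximal_axiom[OF S x Ax.const_in[OF refl c(1) A True]]])
    then show ?thesis using True by simp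
  next
    case False
    have "Neg (FConst M) (Cst A) \<in> x"
      by (rule maximal_mp[OF S x c(2) maximal_axiom[OF S x Ax.const_notin[OF refl c(1) A False]]])
    then show ?thesis using False maximal_Neg[OF S x A] by simp
  qed
  have "(THE c. c \<in> points M \<and> Cst {c} \<in> x) = c"
  proof (rule the_equality)
    show "d = c" if "d \<in> points M \<and> Cst {d} \<in> x" for d
      using that iff[OF F, of d] by simp
  qed (use c in simp)
  then show thesis using that[OF c(1) _ iff] by simp
qed

lemma rmap_FSum:
  assumes "FSum S1 S2 \<in> Ing T" and "maximal T D (FSum S1 S2) x"
  shows "rmap T D (FSum S1 S2) x = (if Box IN1 (Bot S1) \<in> x then VInr (rmap T D S2 (unbox IN2 x))
    else VInl (rmap T D S1 (unbox IN1 x)))"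
  using maximal_FSum(6)[OF assms] by (simp add: rho_sum_def)

lemma rmap_FProd:
  "rmap T D (FProd S1 S2) x = VPair (rmap T D S1 (unbox PR1 x)) (rmap T D S2 (unbox PR2 x))"
  by (simp add: rho_prod_def)

text \<open>Turns measurability into a defining formula; the converse below turns a formula into
  measurability. The induction for \<open>rmap\<close> builds larger formulas between the
  two.\<close>

lemma measurable_can_space_meas:
  assumes "measurable_map (X S) A f" and "U \<in> meas A"
  obtains \<phi> where "\<phi> \<in> mForm T S" and "\<And>x. maximal T D S x \<Longrightarrow> f x \<in> U \<longleftrightarrow> \<phi> \<in> x"
proof -
  obtain \<phi> where \<phi>: "\<phi> \<in> mForm T S" "f -` U \<inter> points (X S) = ext T D S \<phi>"
    using measurable_mapD(2)[OF assms] by (auto simp: meas_can_space)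
  then have "f x \<in> U \<longleftrightarrow> \<phi> \<in> x" if "maximal T D S x" for x
    using that by (auto simp: points_can_space ext_def set_eq_iff)
  then show thesis using \<phi>(1) that by blast
qed

lemma meas_can_spaceI:
  assumes "\<phi> \<in> mForm T S" and "\<And>x. maximal T D S x \<Longrightarrow> P x \<longleftrightarrow> \<phi> \<in> x"
  shows "{x \<in> points (X S). P x} \<in> meas (X S)"
proof -
  have "{x \<in> points (X S). P x} = ext T D S \<phi>" using assms(2) by (auto simp: points_can_space ext_def)
  then show ?thesis using ext_in_meas[OF assms(1)] by simp
qed

lemma measurable_rmap: "S \<in> Ing T \<Longrightarrow> measurable_map (X S) (app S X0) (rmap T D S)"
proof (induction S)
  case FId
  show ?case unfolding rmap.simps by (rule uspace_iso_measurable[OF app_iso(1)[OF uncertainty_X0]])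
next
  case (FConst M)
  note US = uncertainty_can_space[OF FConst]
  have "rmap T D (FConst M) x \<in> points (app (FConst M) X0)" if "x \<in> points (X (FConst M))" for x
    using that by (auto simp only: points_can_space points_app mem_Collect_eq intro: rmap_FConst[OF FConst])
  moreover have "rmap T D (FConst M) -` W \<inter> points (X (FConst M)) \<in> meas (X (FConst M))"
    if W: "W \<in> meas (app (FConst M) X0)" for W
  proof -
    obtain A where A: "A \<in> meas M" "W = VConst ` A" using W unfolding meas_app_FConst by blast
    have F: "Cst A \<in> mForm T (FConst M)" using A by (auto simp: mForm_def intro: has_sort.intros)
    have "{x \<in> points (X (FConst M)). rmap T D (FConst M) x \<in> W} \<in> meas (X (FConst M))"
    proof (rule meas_can_spaceI[OF F])
      fix x assume x: "maximal T D (FConst M) x"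
      obtain c where "rmap T D (FConst M) x = VConst c" "Cst A \<in> x \<longleftrightarrow> c \<in> A"
        using rmap_FConst[OF FConst x] mFormD[OF F] by metis
      then show "rmap T D (FConst M) x \<in> W \<longleftrightarrow> Cst A \<in> x" by (auto simp: A(2))
    qed
    moreover have "rmap T D (FConst M) -` W \<inter> points (X (FConst M)) =
      {x \<in> points (X (FConst M)). rmap T D (FConst M) x \<in> W}" by blast
    ultimately show ?thesis by simp
  qed
  ultimately show ?case
    using US uncertainty_app[OF uncertainty_X0 upp_Ing[OF FConst]] unfolding measurable_map_def by blast
next
  case (FProd S1 S2)
  let ?S = "FProd S1 S2"
  have S12: "S1 \<in> Ing T" "S2 \<in> Ing T" using Ing_FProdD[OF FProd.prems] by auto
  note m1 = FProd.IH(1)[OF S12(1)] and m2 = FProd.IH(2)[OF S12(2)]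
  have e: "edge T PR1 ?S S1" "edge T PR2 ?S S2" by (rule edge.intros)+
  have u: "maximal T D S1 (unbox PR1 x)" "maximal T D S2 (unbox PR2 x)" if "maximal T D ?S x" for x
    using maximal_unbox_PR[OF e(1) _ FProd.prems that] maximal_unbox_PR[OF e(2) _ FProd.prems that] by auto
  show ?case
  proof (rule measurable_into_FProd[OF uncertainty_can_space[OF FProd.prems] uncertainty_X0
        upp_Ing[OF S12(1)] upp_Ing[OF S12(2)]])
    fix x assume "x \<in> points (X ?S)"
    then show "rmap T D ?S x \<in> points (app ?S X0)"
      using measurable_mapD(1)[OF m1] measurable_mapD(1)[OF m2] u
      unfolding points_app rmap_FProd points_can_space by blast
  next
    fix U assume "U \<in> meas (app S1 X0)"
    then obtain \<phi> where \<phi>: "\<phi> \<in> mForm T S1" "\<And>x. maximal T D S1 x \<Longrightarrow> rmap T D S1 x \<in> U \<longleftrightarrow> \<phi> \<in> x"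
      using measurable_can_space_meas[OF m1] by metis
    then show "{x \<in> points (X ?S). vfst (rmap T D ?S x) \<in> U} \<in> meas (X ?S)"
      using u(1) by (intro meas_can_spaceI[of "Box PR1 \<phi>"])
        (auto simp: mForm_def has_sort_Box[OF e(1)] rmap_FProd unbox_iff simp del: rmap.simps)
  next
    fix U assume "U \<in> meas (app S2 X0)"
    then obtain \<phi> where \<phi>: "\<phi> \<in> mForm T S2" "\<And>x. maximal T D S2 x \<Longrightarrow> rmap T D S2 x \<in> U \<longleftrightarrow> \<phi> \<in> x"
      using measurable_can_space_meas[OF m2] by metis
    then show "{x \<in> points (X ?S). vsnd (rmap T D ?S x) \<in> U} \<in> meas (X ?S)"
      using u(2) by (intro meas_can_spaceI[of "Box PR2 \<phi>"])
        (auto simp: mForm_def has_sort_Box[OF e(2)] rmap_FProd unbox_iff simp del: rmap.simps)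
  qed
next
  case (FSum S1 S2)
  let ?S = "FSum S1 S2"
  let ?N = "Box IN1 (Bot S1)"
  have S12: "S1 \<in> Ing T" "S2 \<in> Ing T" using Ing_FSumD[OF FSum.prems] by auto
  note m1 = FSum.IH(1)[OF S12(1)] and m2 = FSum.IH(2)[OF S12(2)]
  have e: "edge T IN1 ?S S1" "edge T IN2 ?S S2" by (rule edge.intros)+
  note sum = maximal_FSum[OF FSum.prems]
  have N: "?N \<in> mForm T ?S" by (simp add: mForm_def has_sort_Box[OF e(1)])
  show ?case
  proof (rule measurable_into_FSum[OF uncertainty_can_space[OF FSum.prems] uncertainty_X0
        upp_Ing[OF S12(1)] upp_Ing[OF S12(2)]])
    fix x assume "x \<in> points (X ?S)"
    then have x: "maximal T D ?S x" by (simp add: points_can_space)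
    show "rmap T D ?S x \<in> points (app ?S X0)"
      using measurable_mapD(1)[OF m1] measurable_mapD(1)[OF m2] sum(2,3)[OF x]
      unfolding points_app rmap_FSum[OF FSum.prems x] points_can_space by simp
  next
    fix U assume "U \<in> meas (app S1 X0)"
    then obtain \<phi> where \<phi>: "\<phi> \<in> mForm T S1" "\<And>x. maximal T D S1 x \<Longrightarrow> rmap T D S1 x \<in> U \<longleftrightarrow> \<phi> \<in> x"
      using measurable_can_space_meas[OF m1] by metis
    have B: "Box IN1 \<phi> \<in> mForm T ?S" using \<phi>(1) by (simp add: mForm_def has_sort_Box[OF e(1)])
    show "{x \<in> points (X ?S). rmap T D ?S x \<in> VInl ` U} \<in> meas (X ?S)"
    proof (rule meas_can_spaceI)
      \<comment> \<open>\<open>Box IN1 \<phi>\<close> also holds throughout the second summand, so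
        the first conjunct must select the first summand. For \<open>VInr\<close> below,
        \<open>?N\<close> itself does the selecting.\<close>
      show "And ?S (Neg ?S ?N) (Box IN1 \<phi>) \<in> mForm T ?S" using B N by (simp add: mForm_def)
      fix x assume x: "maximal T D ?S x"
      have "Neg ?S ?N \<in> Form T ?S" using mFormD[OF mForm_Neg[OF N]] .
      then have "And ?S (Neg ?S ?N) (Box IN1 \<phi>) \<in> x \<longleftrightarrow> ?N \<notin> x \<and> \<phi> \<in> unbox IN1 x"
        using maximal_And[OF FSum.prems x _ mFormD[OF B]] maximal_Neg[OF FSum.prems x mFormD[OF N]]
        by (simp add: unbox_iff)
      then show "rmap T D ?S x \<in> VInl ` U \<longleftrightarrow> And ?S (Neg ?S ?N) (Box IN1 \<phi>) \<in> x"
        unfolding rmap_FSum[OF FSum.prems x] using \<phi>(2)[OF sum(2)[OF x]] by auto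
    qed
  next
    fix U assume "U \<in> meas (app S2 X0)"
    then obtain \<phi> where \<phi>: "\<phi> \<in> mForm T S2" "\<And>x. maximal T D S2 x \<Longrightarrow> rmap T D S2 x \<in> U \<longleftrightarrow> \<phi> \<in> x"
      using measurable_can_space_meas[OF m2] by metis
    have B: "Box IN2 \<phi> \<in> mForm T ?S" using \<phi>(1) by (simp add: mForm_def has_sort_Box[OF e(2)])
    show "{x \<in> points (X ?S). rmap T D ?S x \<in> VInr ` U} \<in> meas (X ?S)"
    proof (rule meas_can_spaceI)
      show "And ?S ?N (Box IN2 \<phi>) \<in> mForm T ?S" using B N by (simp add: mForm_def)
      fix x assume x: "maximal T D ?S x"
      have "And ?S ?N (Box IN2 \<phi>) \<in> x \<longleftrightarrow> ?N \<in> x \<and> \<phi> \<in> unbox IN2 x"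
        using maximal_And[OF FSum.prems x mFormD[OF N] mFormD[OF B]] by (simp add: unbox_iff)
      then show "rmap T D ?S x \<in> VInr ` U \<longleftrightarrow> And ?S ?N (Box IN2 \<phi>) \<in> x"
        unfolding rmap_FSum[OF FSum.prems x] using \<phi>(2)[OF sum(3)[OF x]] by auto
    qed
  qed
next
  case (FDelta S)
  have S: "S \<in> Ing T" by (rule Ing_FDeltaD[OF FDelta.prems])
  note m = FDelta.IH[OF S]
  let ?g = "\<lambda>x. Delta_map (X S) (app S X0) (rmap T D S) (rho_Delta T D S x)"
  show ?case
  proof (rule measurable_into_FDelta[OF uncertainty_can_space[OF FDelta.prems] uncertainty_X0 upp_Ing[OF S]])
    show "rmap T D (FDelta S) x = enc (app S X0) (?g x)" for x by simp
    show "?g x \<in> upper_probs (app S X0)" if "x \<in> points (X (FDelta S))" for x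
      using that rho_Delta_upper_probs[OF FDelta.prems]
      by (intro Delta_map_upper_probs[OF m]) (simp add: points_can_space)
    fix p q :: real and U assume pq: "p \<in> {0..1}" "q \<in> {0..1}" and U: "U \<in> meas (app S X0)"
    obtain \<phi> where \<phi>: "\<phi> \<in> mForm T S" "rmap T D S -` U \<inter> points (X S) = ext T D S \<phi>"
      using measurable_mapD(2)[OF m U] by (auto simp: meas_can_space)
    show "{x \<in> points (X (FDelta S)). ?g x \<in> beta (app S X0) p q U} \<in> meas (X (FDelta S))"
    proof (rule meas_can_spaceI)
      show "Prob p q \<phi> \<in> mForm T (FDelta S)" using \<phi>(1) pq by (simp add: mForm_def)
      fix x assume x: "maximal T D (FDelta S) x"
      show "?g x \<in> beta (app S X0) p q U \<longleftrightarrow> Prob p q \<phi> \<in> x"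
        unfolding Delta_map_beta_iff[OF m rho_Delta_upper_probs[OF FDelta.prems x] U] \<phi>(2)
          Prob_iff_beta[OF FDelta.prems x \<phi>(1) pq] ..
    qed
  qed
qed

lemma rmap_points: "S \<in> Ing T \<Longrightarrow> maximal T D S x \<Longrightarrow> rmap T D S x \<in> points (app S X0)"
  using measurable_mapD(1)[OF measurable_rmap] by (simp add: points_can_space)

lemma coalgebra_can_coalg: "coalgebra T X0 (can_coalg T D)"
  unfolding coalgebra_def can_coalg_def
proof (rule measurable_comp[OF _ measurable_rmap[OF Ing_self]])
  have e: "edge T NEXT FId T" by (rule edge.intros)
  have "rho_Id x \<in> points (X T)" if "x \<in> points X0" for x
    using that maximal_unbox_NEXT by (simp add: points_can_space rho_Id_def)
  moreover have "rho_Id -` V \<inter> points X0 \<in> meas X0" if V: "V \<in> meas (X T)" for V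
  proof -
    obtain \<phi> where \<phi>: "\<phi> \<in> mForm T T" "V = ext T D T \<phi>" using V by (auto simp: meas_can_space)
    have "{x \<in> points X0. rho_Id x \<in> V} \<in> meas X0"
    proof (rule meas_can_spaceI)
      show "Box NEXT \<phi> \<in> mForm T FId" using \<phi>(1) by (simp add: mForm_def has_sort_Box[OF e])
      fix x assume "maximal T D FId x"
      then show "rho_Id x \<in> V \<longleftrightarrow> Box NEXT \<phi> \<in> x"
        using maximal_unbox_NEXT by (simp add: \<phi>(2) ext_def rho_Id_def unbox_iff)
    qed
    moreover have "rho_Id -` V \<inter> points X0 = {x \<in> points X0. rho_Id x \<in> V}" by blast
    ultimately show ?thesis by simp
  qed
  ultimately show "measurable_map X0 (X T) rho_Id"
    using uncertainty_X0 uncertainty_can_space[OF Ing_self] unfolding measurable_map_def by blast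
qed

text \<open>The maximal set varies in the induction: boxes pass to an unboxed set, and the
  probability case uses all maximal sets of the smaller sort.\<close>

lemma truth_lemma:
  "has_sort T b S \<phi> \<Longrightarrow> S \<in> Ing T \<Longrightarrow> maximal T D S x \<Longrightarrow>
    rmap T D S x \<in> sem T X0 (can_coalg T D) S \<phi> \<longleftrightarrow> \<phi> \<in> x"
proof (induction arbitrary: x rule: has_sort.induct)
  case (1 b S)
  then show ?case using maximal_Bot by simp
next
  case (2 b S \<phi> \<psi>)
  have "\<phi> \<in> Form T S" "\<psi> \<in> Form T S" using 2(1,2) has_sort_False by (auto simp: Form_def)
  then show ?case
    using maximal_Imp[OF 2(5,6)] 2(3,4)[OF 2(5,6)] rmap_points[OF 2(5,6)] by simp
next
  case (3 A M b)
  have "Cst A \<in> Form T (FConst M)" using 3(1) by (auto simp: Form_def intro: has_sort.intros)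
  then obtain c where "rmap T D (FConst M) x = VConst c" "Cst A \<in> x \<longleftrightarrow> c \<in> A"
    using rmap_FConst[OF 3(2,3)] by metis
  then show ?case by (auto simp del: rmap.simps)
next
  case (4 m M)
  have "Cst {m} \<in> Form T (FConst M)" using 4(1) by (auto simp: Form_def intro: has_sort.intros)
  then obtain c where "rmap T D (FConst M) x = VConst c" "Cst {m} \<in> x \<longleftrightarrow> c \<in> {m}"
    using rmap_FConst[OF 4(2,3)] by metis
  then show ?case by (auto simp del: rmap.simps)
next
  case (5 \<kappa> S S' b \<phi>)
  note S = \<open>S \<in> Ing T\<close> and x = \<open>maximal T D S x\<close>
  have IH: "rmap T D S' y \<in> sem T X0 (can_coalg T D) S' \<phi> \<longleftrightarrow> \<phi> \<in> y" if "maximal T D S' y" for y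
    using 5(3)[OF Ing_edge[OF 5(1) S] that] .
  have \<phi>: "\<phi> \<in> Form T S'" using 5(2) has_sort_False by (auto simp: Form_def)
  note rp = rmap_points[OF S x]
  note e = \<open>edge T \<kappa> S S'\<close>
  from e show ?case
  proof cases
    case (1 S2)
    have "maximal T D S' (unbox \<kappa> x)" by (rule maximal_unbox_PR[OF e _ S x]) (simp add: 1)
    then show ?thesis
      using IH[of "unbox \<kappa> x"] rp unfolding 1 by (simp add: rmap_FProd unbox_iff del: rmap.simps app.simps)
  next
    case (2 S1)
    have "maximal T D S' (unbox \<kappa> x)" by (rule maximal_unbox_PR[OF e _ S x]) (simp add: 2)
    then show ?thesis
      using IH[of "unbox \<kappa> x"] rp unfolding 2 by (simp add: rmap_FProd unbox_iff del: rmap.simps app.simps)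
  next
    case (3 S2)
    have S3: "FSum S' S2 \<in> Ing T" "maximal T D (FSum S' S2) x" using S x 3 by auto
    have "S2 \<in> Ing T" using Ing_FSumD[OF S3(1)] by blast
    \<comment> \<open>In the second summand the box is vacuously true: syntactically by
      \<open>maximal_FSum\<close>, semantically because the value is a point of that
      summand.\<close>
    then have "rmap T D S2 (unbox IN2 x) \<in> points (app S2 X0)" if "Box IN1 (Bot S') \<in> x"
      by (rule rmap_points[OF _ maximal_FSum(3)[OF S3 that]])
    then show ?thesis
      using IH[OF maximal_FSum(2)[OF S3]] maximal_FSum(4)[OF S3 _ \<phi>]
      unfolding 3 rmap_FSum[OF S3] sem.simps
      by (cases "Box IN1 (Bot S') \<in> x") (simp_all add: unbox_iff image_iff)
  next
    case (4 S1)
    have S3: "FSum S1 S' \<in> Ing T" "maximal T D (FSum S1 S') x" using S x 4 by auto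
    have "S1 \<in> Ing T" using Ing_FSumD[OF S3(1)] by blast
    then have "rmap T D S1 (unbox IN1 x) \<in> points (app S1 X0)" if "Box IN1 (Bot S1) \<notin> x"
      by (rule rmap_points[OF _ maximal_FSum(2)[OF S3 that]])
    then show ?thesis
      using IH[OF maximal_FSum(3)[OF S3]] maximal_FSum(5)[OF S3 _ \<phi>]
      unfolding 4 rmap_FSum[OF S3] sem.simps
      by (cases "Box IN1 (Bot S1) \<in> x") (simp_all add: unbox_iff image_iff)
  next
    case 5
    have "x \<in> points X0" "maximal T D T (unbox NEXT x)"
      using x maximal_unbox_NEXT by (auto simp: 5 points_can_space)
    moreover have "can_coalg T D x = rmap T D T (unbox NEXT x)" by (simp add: can_coalg_def rho_Id_def)
    ultimately show ?thesis
      using IH[of "unbox NEXT x"] unfolding 5 by (auto simp: unbox_iff)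
  qed
next
  case (6 p q S \<phi> b)
  note FS = \<open>FDelta S \<in> Ing T\<close> and x = \<open>maximal T D (FDelta S) x\<close>
  have S: "S \<in> Ing T" by (rule Ing_FDeltaD[OF FS])
  have \<phi>: "\<phi> \<in> mForm T S" using 6(3) by (simp add: mForm_def)
  note m = measurable_rmap[OF S]
  have g: "rho_Delta T D S x \<in> upper_probs (X S)" by (rule rho_Delta_upper_probs[OF FS x])
  have U: "sem T X0 (can_coalg T D) S \<phi> \<in> meas (app S X0)"
    by (rule meas_sem[OF upp coalgebra_can_coalg 6(3) _ S]) simp
  \<comment> \<open>The induction hypothesis as a set equation; it reduces membership in
    \<open>beta\<close> over the canonical coalgebra to membership over the space of maximal
    sets.\<close>
  have "rmap T D S -` sem T X0 (can_coalg T D) S \<phi> \<inter> points (X S) = ext T D S \<phi>"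
    using 6(4)[OF S] by (auto simp: points_can_space ext_def)
  then show ?case
    unfolding rmap.simps sem.simps enc_beta_iff[OF uncertainty_X0 upp_Ing[OF S] Delta_map_upper_probs[OF m g]]
      Delta_map_beta_iff[OF m g U] Prob_iff_beta[OF FS x \<phi> 6(1,2)] by simp
qed

lemma des_rmap:
  assumes "S \<in> Ing T" and x: "maximal T D S x"
  shows "des T X0 (can_coalg T D) S (rmap T D S x) = x"
  using truth_lemma[OF _ assms, of False] maximalD(1)[OF x] unfolding des_def Form_def by blast

section \<open>Descriptions\<close>

context
  fixes Y :: "'y uspace" and \<delta> :: "'y \<Rightarrow> ('y, 'm) val"
  assumes sound: "sound TYPE('y) T D" and coalg: "coalgebra T Y \<delta>"
begin

lemma uncertainty_Y: "uncertainty_space Y"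
  using coalg by (simp add: coalgebra_def measurable_map_def)

text \<open>Completeness under negation is semantic. Consistency is where soundness enters: a
  derivation of falsum would make it true at \<open>v\<close>.\<close>

lemma maximal_des:
  assumes S: "S \<in> Ing T" and v: "v \<in> points (app S Y)"
  shows "maximal T D S (des T Y \<delta> S v)"
proof -
  have "\<not> D S (des T Y \<delta> S v) (Bot S)"
  proof
    assume "D S (des T Y \<delta> S v) (Bot S)"
    then have "sem_conseq TYPE('y) T S (des T Y \<delta> S v) (Bot S)" using sound S by (auto simp: sound_def)
    then show False using coalg v by (force simp: sem_conseq_def des_def)
  qed
  then show ?thesis using v by (auto simp: maximal_def consistent_def des_def Form_def Neg_def)
qed

lemma des_vimage_ext:
  assumes S: "S \<in> Ing T" and \<phi>: "\<phi> \<in> mForm T S"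
  shows "des T Y \<delta> S -` ext T D S \<phi> \<inter> points (app S Y) = sem T Y \<delta> S \<phi>"
proof -
  have "sem T Y \<delta> S \<phi> \<subseteq> points (app S Y)"
    using meas_subset[OF uncertainty_app[OF uncertainty_Y upp_Ing[OF S]] meas_sem[OF upp coalg _ _ S]] \<phi>
    by (simp add: mForm_def)
  then show ?thesis
    using maximal_des[OF S] mFormD[OF \<phi>] by (auto simp: ext_def des_def)
qed

lemma measurable_des:
  assumes S: "S \<in> Ing T"
  shows "measurable_map (app S Y) (X S) (des T Y \<delta> S)"
proof -
  have "des T Y \<delta> S -` V \<inter> points (app S Y) \<in> meas (app S Y)" if V: "V \<in> meas (X S)" for V
  proof -
    obtain \<phi> where \<phi>: "\<phi> \<in> mForm T S" "V = ext T D S \<phi>" using V by (auto simp: meas_can_space)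
    then show ?thesis
      using des_vimage_ext[OF S \<phi>(1)] meas_sem[OF upp coalg _ _ S, of True \<phi>] by (simp add: mForm_def)
  qed
  moreover have "des T Y \<delta> S \<in> points (app S Y) \<rightarrow> points (X S)"
    using maximal_des[OF S] by (auto simp: points_can_space)
  ultimately show ?thesis
    using uncertainty_can_space[OF S] uncertainty_app[OF uncertainty_Y upp_Ing[OF S]]
    unfolding measurable_map_def by blast
qed

text \<open>Stated on \<open>Y\<close> itself and not on its tagged copy, so that it can be an
  argument of \<open>fmap\<close>.\<close>

definition des_state :: "'y \<Rightarrow> 'm form set" where
  "des_state y = des T Y \<delta> FId (VId y)"

lemma measurable_des_state: "measurable_map Y X0 des_state"
proof -
  have "measurable_map Y (app FId Y) (VId :: 'y \<Rightarrow> ('y, 'm) val)"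
    by (rule uspace_iso_measurable[OF app_iso(1)[OF uncertainty_Y]])
  then have "measurable_map Y X0 (des T Y \<delta> FId \<circ> VId)"
    by (rule measurable_comp[OF _ measurable_des[OF FId_in_Ing]])
  moreover have "des_state = des T Y \<delta> FId \<circ> VId" by (simp add: fun_eq_iff des_state_def)
  ultimately show ?thesis by simp
qed

text \<open>The lower bounds \<open>Uge q \<phi>\<close> true at the encoded \<open>g\<close> are
  those with \<open>q\<close> in the interval from \<open>0\<close> to the value of \<open>g\<close>
  at the interpretation of \<open>\<phi>\<close>, so the supremum returns that value.\<close>

lemma rho_Delta_des:
  assumes FS: "FDelta S \<in> Ing T" and g: "g \<in> upper_probs (app S Y)"
  shows "rho_Delta T D S (des T Y \<delta> (FDelta S) (enc (app S Y) g)) =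
    Delta_map (app S Y) (X S) (des T Y \<delta> S) g"
proof
  let ?x = "des T Y \<delta> (FDelta S) (enc (app S Y) g)"
  have S: "S \<in> Ing T" by (rule Ing_FDeltaD[OF FS])
  have x: "maximal T D (FDelta S) ?x" using g by (intro maximal_des[OF FS]) (auto simp only: points_app)
  fix U
  show "rho_Delta T D S ?x U = Delta_map (app S Y) (X S) (des T Y \<delta> S) g U"
  proof (cases "U \<in> meas (X S)")
    case False
    then show ?thesis by (simp add: rho_Delta_def Delta_map_def)
  next
    case True
    then obtain \<phi> where \<phi>: "\<phi> \<in> mForm T S" "U = ext T D S \<phi>" by (auto simp: meas_can_space)
    let ?V = "sem T Y \<delta> S \<phi>"
    have V: "?V \<in> meas (app S Y)" using meas_sem[OF upp coalg _ _ S, of True \<phi>] \<phi>(1) by (simp add: mForm_def)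
    have g01: "g W \<in> {0..1}" if "W \<in> meas (app S Y)" for W
      using g that by (auto simp: upper_probs_def PiE_def Pi_def)
    have "Uge q \<phi> \<in> ?x \<longleftrightarrow> q \<le> g ?V" if q: "q \<in> {0..1}" for q
    proof -
      have "Uge q \<phi> \<in> Form T (FDelta S)" using \<phi>(1) q by (simp add: Uge_def Form_def mForm_def)
      \<comment> \<open>This makes the second threshold of \<open>beta\<close>, which is
        \<open>0\<close> for \<open>Uge\<close>, automatic.\<close>
      moreover have "g (points (app S Y) - ?V) \<le> 1"
        using g01 meas_closed(3)[OF uncertainty_app[OF uncertainty_Y upp_Ing[OF S]] V] by auto
      ultimately show ?thesis
        using g enc_beta_iff[OF uncertainty_Y upp_Ing[OF S] g, of q 0 ?V] by (simp add: des_def Uge_def beta_def)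
    qed
    then have "{q \<in> {0..1}. Uge q \<phi> \<in> ?x} = {0..g ?V}" using g01[OF V] by auto
    then have "upper_value ?x \<phi> = g ?V" using g01[OF V] by (simp add: upper_value_def)
    then show ?thesis
      using rho_Delta_ext[OF FS x \<phi>(1)] des_vimage_ext[OF S \<phi>(1)] True by (simp add: \<phi>(2) Delta_map_def)
  qed
qed

lemma unbox_des:
  assumes "FProd S1 S2 \<in> Ing T" and "VPair v w \<in> points (app (FProd S1 S2) Y)"
  shows "unbox PR1 (des T Y \<delta> (FProd S1 S2) (VPair v w)) = des T Y \<delta> S1 v"
    and "unbox PR2 (des T Y \<delta> (FProd S1 S2) (VPair v w)) = des T Y \<delta> S2 w"
  using assms(2) has_sort_Box[OF edge.intros(1), of T False S1 S2] has_sort_Box[OF edge.intros(2), of T False S1 S2]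
  by (auto simp: unbox_def des_def Form_def simp del: app.simps)

lemma unbox_des_NEXT:
  assumes "y \<in> points Y"
  shows "unbox NEXT (des_state y) = des T Y \<delta> T (\<delta> y)"
  using assms has_sort_Box[OF edge.intros(5), of T False]
  by (auto simp: unbox_def des_def des_state_def Form_def)

text \<open>Induction on the functor suffices, because at \<open>FId\<close> both sides are the
  tagged description and the structure map is never unfolded.\<close>

theorem rmap_des:
  "S \<in> Ing T \<Longrightarrow> v \<in> points (app S Y) \<Longrightarrow> rmap T D S (des T Y \<delta> S v) = fmap S Y X0 des_state v"
proof (induction S arbitrary: v)
  case FId
  from FId(2) show ?case unfolding points_app by (auto simp: des_state_def)
next
  case (FConst M)
  obtain m where m: "m \<in> points M" "v = VConst m" using FConst(2) unfolding points_app by blast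
  have F: "Cst {m} \<in> Form T (FConst M)" using m(1) by (auto simp: Form_def intro: has_sort.intros)
  obtain c where "rmap T D (FConst M) (des T Y \<delta> (FConst M) v) = VConst c"
      "Cst {m} \<in> des T Y \<delta> (FConst M) v \<longleftrightarrow> c \<in> {m}"
    using rmap_FConst[OF FConst(1) maximal_des[OF FConst]] F by metis
  moreover have "Cst {m} \<in> des T Y \<delta> (FConst M) v" using F by (simp add: des_def m(2))
  ultimately show ?case by (simp add: m(2))
next
  case (FProd S1 S2)
  have S12: "S1 \<in> Ing T" "S2 \<in> Ing T" using Ing_FProdD[OF FProd.prems(1)] by auto
  obtain w1 w2 where v: "v = VPair w1 w2" "w1 \<in> points (app S1 Y)" "w2 \<in> points (app S2 Y)"
    using FProd.prems(2) unfolding points_app by blast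
  then show ?case
    using FProd.IH(1)[OF S12(1) v(2)] FProd.IH(2)[OF S12(2) v(3)] unbox_des[OF FProd.prems(1)] FProd.prems(2)
    by (simp add: rmap_FProd del: rmap.simps app.simps)
next
  case (FSum S1 S2)
  let ?S = "FSum S1 S2"
  have S12: "S1 \<in> Ing T" "S2 \<in> Ing T" using Ing_FSumD[OF FSum.prems(1)] by auto
  have F: "Box IN1 \<phi> \<in> Form T ?S \<longleftrightarrow> \<phi> \<in> Form T S1" "Box IN2 \<phi> \<in> Form T ?S \<longleftrightarrow> \<phi> \<in> Form T S2" for \<phi>
    by (simp_all add: Form_def has_sort_Box[OF edge.intros(3)] has_sort_Box[OF edge.intros(4)])
  note r = rmap_FSum[OF FSum.prems(1) maximal_des[OF FSum.prems]]
  consider w where "v = VInl w" "w \<in> points (app S1 Y)" | w where "v = VInr w" "w \<in> points (app S2 Y)"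
    using FSum.prems(2) unfolding points_app by blast
  then show ?case
  proof cases
    case 1
    then have "Box IN1 (Bot S1) \<notin> des T Y \<delta> ?S v" by (auto simp: des_def)
    moreover have "unbox IN1 (des T Y \<delta> ?S v) = des T Y \<delta> S1 w" using 1 F by (auto simp: unbox_def des_def)
    ultimately show ?thesis unfolding r using FSum.IH(1)[OF S12(1) 1(2)] 1(1) by simp
  next
    case 2
    then have "Box IN1 (Bot S1) \<in> des T Y \<delta> ?S v" using F by (auto simp: des_def Form_def)
    moreover have "unbox IN2 (des T Y \<delta> ?S v) = des T Y \<delta> S2 w" using 2 F by (auto simp: unbox_def des_def)
    ultimately show ?thesis unfolding r using FSum.IH(2)[OF S12(2) 2(2)] 2(1) by simp
  qed
next
  case (FDelta S)
  have S: "S \<in> Ing T" by (rule Ing_FDeltaD[OF FDelta.prems(1)])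
  obtain g where g: "g \<in> upper_probs (app S Y)" "v = enc (app S Y) g"
    using FDelta.prems(2) unfolding points_app by blast
  have "Delta_map (X S) (app S X0) (rmap T D S) (Delta_map (app S Y) (X S) (des T Y \<delta> S) g) =
      Delta_map (app S Y) (app S X0) (fmap S Y X0 des_state) g"
  proof
    fix U
    show "Delta_map (X S) (app S X0) (rmap T D S) (Delta_map (app S Y) (X S) (des T Y \<delta> S) g) U =
        Delta_map (app S Y) (app S X0) (fmap S Y X0 des_state) g U"
    proof (cases "U \<in> meas (app S X0)")
      case True
      \<comment> \<open>Pushing forward twice means taking preimages twice; by induction the
        composite has the same preimages as \<open>fmap\<close>.\<close>
      have "des T Y \<delta> S -` (rmap T D S -` U \<inter> points (X S)) \<inter> points (app S Y) =
          fmap S Y X0 des_state -` U \<inter> points (app S Y)"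
        using FDelta.IH[OF S] measurable_mapD(1)[OF measurable_des[OF S]] by auto
      then show ?thesis
        using True measurable_mapD(2)[OF measurable_rmap[OF S] True] by (simp add: Delta_map_def)
    qed (simp add: Delta_map_def)
  qed
  then show ?case
    unfolding g(2) fmap_FDelta_enc[OF uncertainty_Y upp_Ing[OF S] g(1)] rmap.simps
      rho_Delta_des[OF FDelta.prems(1) g(1)] by simp
qed

text \<open>Unboxing \<open>NEXT\<close> in the description of \<open>y\<close> gives the
  description of \<open>\<delta> y\<close> at sort \<open>T\<close>, to which
  \<open>rmap_des\<close> applies.\<close>

theorem des_state_morphism: "coalgebra_morphism T Y \<delta> X0 (can_coalg T D) des_state"
  unfolding coalgebra_morphism_def
proof (intro conjI ballI coalg coalgebra_can_coalg measurable_des_state)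
  fix y assume y: "y \<in> points Y"
  have "\<delta> y \<in> points (app T Y)" using measurable_mapD(1)[OF coalg[unfolded coalgebra_def] y] .
  then show "can_coalg T D (des_state y) = fmap T Y X0 des_state (\<delta> y)"
    using rmap_des[OF Ing_self] unbox_des_NEXT[OF y] by (simp add: can_coalg_def rho_Id_def)
qed

end

end

section \<open>Invariance of descriptions, the canonical isomorphisms and finality\<close>

lemma des_fmap:
  assumes "upp_functor T" and "coalgebra_morphism T X \<alpha> Y \<delta> f" and "S \<in> Ing T" and "v \<in> points (app S X)"
  shows "des T Y \<delta> S (fmap S X Y f v) = des T X \<alpha> S v"
  using sem_fmap_iff[OF assms(1,2) _ assms(3,4), of False] unfolding des_def Form_def by blast

context lindenbaum_system
begin

lemma can_coalg_iso:
  assumes sound: "sound TYPE('m form set) T D" and S: "S \<in> Ing T"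
  shows "uspace_iso (app S X0) (X S) (des T X0 (can_coalg T D) S)"
    and "x \<in> points (X S) \<Longrightarrow> inv_into (points (app S X0)) (des T X0 (can_coalg T D) S) x = rmap T D S x"
    and "points (X S) = {des T X0 (can_coalg T D) S (rmap T D S x) | x. x \<in> points (X S)}"
proof -
  let ?d = "des T X0 (can_coalg T D) S"
  have m: "measurable_map (app S X0) (X S) ?d"
    by (rule measurable_des[OF sound coalgebra_can_coalg S])
  have dr: "?d (rmap T D S x) = x" if "x \<in> points (X S)" for x
    using des_rmap[OF S] that by (simp add: points_can_space)
  have rd: "rmap T D S (?d v) = v" if v: "v \<in> points (app S X0)" for v
  proof -
    \<comment> \<open>On the canonical carrier \<open>rmap\<close> at \<open>FId\<close> is just the
      tag, so the truth lemma says that a state is its own description.\<close>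
    have "des_state X0 (can_coalg T D) x = x" if "x \<in> points X0" for x
      using des_rmap[OF FId_in_Ing, of x] that
      by (simp add: des_state_def[OF sound coalgebra_can_coalg] points_can_space)
    then show ?thesis
      using rmap_des[OF sound coalgebra_can_coalg S v] fmap_id[OF uncertainty_X0 _ upp_Ing[OF S] v] by simp
  qed
  have r: "rmap T D S x \<in> points (app S X0)" if "x \<in> points (X S)" for x
    using rmap_points[OF S] that by (simp add: points_can_space)
  have inj: "inj_on ?d (points (app S X0))" by (rule inj_on_inverseI[of _ "rmap T D S"]) (rule rd)
  show inv: "inv_into (points (app S X0)) ?d x = rmap T D S x" if "x \<in> points (X S)" for x
    using inv_into_f_f[OF inj r[OF that]] dr[OF that] by simp
  have bij: "bij_betw ?d (points (app S X0)) (points (X S))"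
    using rd dr r measurable_mapD(1)[OF m] by (intro bij_betwI[of _ _ _ "rmap T D S"]) auto
  \<comment> \<open>The inverse is only pinned down on the points of \<open>X S\<close>, so
    preimages are compared there before measurability is transferred from
    \<open>rmap\<close>.\<close>
  have "inv_into (points (app S X0)) ?d -` V \<inter> points (X S) = rmap T D S -` V \<inter> points (X S)" for V
    using inv by auto
  then have "measurable_map (X S) (app S X0) (inv_into (points (app S X0)) ?d)"
    using measurable_rmap[OF S] inv unfolding measurable_map_def by (auto simp: Pi_def)
  then show "uspace_iso (app S X0) (X S) ?d" using bij m by (simp add: uspace_iso_def)
  show "points (X S) = {?d (rmap T D S x) | x. x \<in> points (X S)}" using dr by force
qed

lemma morphism_unique:
  assumes h: "coalgebra_morphism T Y \<delta> X0 (can_coalg T D) h" and y: "y \<in> points Y"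
  shows "h y = des T Y \<delta> FId (VId y)"
proof -
  have "measurable_map Y X0 h" using h by (simp add: coalgebra_morphism_def)
  then have hy: "h y \<in> points X0" using y by (rule measurable_mapD(1))
  have "des T X0 (can_coalg T D) FId (fmap FId Y X0 h (VId y)) = des T Y \<delta> FId (VId y)"
    using y by (intro des_fmap[OF upp h FId_in_Ing]) (auto simp only: points_app)
  then show ?thesis using des_rmap[OF FId_in_Ing, of "h y"] hy by (simp add: points_can_space)
qed

end

theorem theorem4p12:
  fixes T :: "'m pfun" and D :: "'m derivability"
  assumes "upp_functor T"
    and "deduction_system T D"
    and "lower_upper_dual T D"
    and "lindenbaum T D"
    and "sound TYPE('y) T D" and "sound TYPE('m form set) T D"
  shows
    "(\<forall>S\<in>Ing T. \<forall>(Y::'y uspace) \<delta>. coalgebra T Y \<delta> \<longrightarrow>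
        measurable_map (app S Y) (can_space T D S) (des T Y \<delta> S)) \<and>
     (\<forall>(X::'x uspace) \<alpha> (Y::'y uspace) \<delta> f. coalgebra_morphism T X \<alpha> Y \<delta> f \<longrightarrow>
        (\<forall>S\<in>Ing T. \<forall>v\<in>points (app S X). des T Y \<delta> S (fmap S X Y f v) = des T X \<alpha> S v)) \<and>
     (let X = can_space T D FId; \<alpha> = can_coalg T D in
        coalgebra T X \<alpha> \<and>
        (\<forall>S\<in>Ing T.
           uspace_iso (app S X) (can_space T D S) (des T X \<alpha> S) \<and>
           (\<forall>x\<in>points (can_space T D S). inv_into (points (app S X)) (des T X \<alpha> S) x = rmap T D S x) \<and>
           points (can_space T D S) = {des T X \<alpha> S (rmap T D S x) | x. x \<in> points (can_space T D S)}) \<and>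
        (\<forall>(Y::'y uspace) \<delta>. coalgebra T Y \<delta> \<longrightarrow>
           coalgebra_morphism T Y \<delta> X \<alpha> (\<lambda>y. des T Y \<delta> FId (VId y)) \<and>
           (\<forall>h. coalgebra_morphism T Y \<delta> X \<alpha> h \<longrightarrow> (\<forall>y\<in>points Y. h y = des T Y \<delta> FId (VId y)))) \<and>
        final_coalgebra TYPE('y) T X \<alpha>)"
proof -
  interpret lindenbaum_system T D
    by (intro lindenbaum_system.intro lindenbaum_system_axioms.intro assms)
  note sound = assms(5) and sound_can = assms(6)
  have mor: "coalgebra_morphism T Y \<delta> X0 (can_coalg T D) (\<lambda>y. des T Y \<delta> FId (VId y))"
    if "coalgebra T Y \<delta>" for Y :: "'y uspace" and \<delta>
    using des_state_morphism[OF sound that] unfolding des_state_def[OF sound that, abs_def] .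
  have "final_coalgebra TYPE('y) T X0 (can_coalg T D)"
    unfolding final_coalgebra_def
  proof (intro conjI allI impI coalgebra_can_coalg)
    fix Y :: "'y uspace" and \<delta> assume Y: "coalgebra T Y \<delta>"
    show "\<exists>f. coalgebra_morphism T Y \<delta> X0 (can_coalg T D) f \<and>
        (\<forall>h. coalgebra_morphism T Y \<delta> X0 (can_coalg T D) h \<longrightarrow> (\<forall>y\<in>points Y. h y = f y))"
      by (rule exI[of _ "\<lambda>y. des T Y \<delta> FId (VId y)"])
        (intro conjI mor[OF Y] allI impI ballI morphism_unique)
  qed
  then show ?thesis
    unfolding Let_def
    by (intro conjI allI ballI impI measurable_des[OF sound] des_fmap[OF upp] coalgebra_can_coalg
        can_coalg_iso[OF sound_can] mor morphism_unique)
qed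

end
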